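(* If $\overline{\mathcal N}_{\hat\rho_e}$ is countable for each $\hat\rho_e\ge1$, then the (regular) ETIS states of the SSM on $\widehat X^*$ are precisely the irreducible basic states $\gamma_*\tilde\mu^{(\lambda,\nu,A)}$.
   Context: SSM (symmetric stack model): the discrete-time Markov process on $\widehat X=\mathbb Z_+^{\mathbb Z}$, $\mathbb Z_+=\{0,1,2,\dots\}$. A stack $\mathbf n(i)$ is short if $\mathbf n(i)\le1$ and tall otherwise. In passing from $\mathbf n_t$ to $\mathbf n_{t+1}$, simultaneously for each bond $\langle k,k+1\rangle$: if both stacks are short no particle crosses the bond; if one is short and one tall, one particle moves from the tall to the short stack; if both are tall, one particle moves across the bond in a direction chosen with probability $1/2$ each (independently for different bonds). $\widehat X^*\subset\widehat X$ is the set of configurations with no two adjacent short stacks, and $\widehat X^*_e\subset\widehat X^*$ is the subset of configurations with every $\mathbf n(i)$ even; both are invariant under the dynamics. $S=\{0,1\}^{\mathbb Z}$. $\gamma:\widehat X^*_e\times S\to\widehat X^*$ is $\gamma(\mathbf m,\sigma)=\mathbf m+\sigma$ (site by site), and $\gamma_*$ denotes push-forward. Translation $\tau$ acts on configurations by $(\tau\eta)(i)=\eta(i-1)$ and on measures by $\tau_*$. States are Borel probability measures; TI = translation invariant; TIS = TI and stationary; ETIS = extremal among TIS states; a TI state is regular if the mean of $\mathbf n(0)$ is finite. A state has density $\hat\rho$ ($<\infty$) if almost every configuration satisfies $\lim_{N}\frac1N\sum_{i=1}^N\mathbf n(i)=\lim_{N}\frac1N\sum_{i=-N}^{-1}\mathbf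 n(i)=\hat\rho$. $\mathcal N_{\hat\rho_e}$ is the family of all stationary states of the SSM on $\widehat X^*_e$ (TI or not) with density $\hat\rho_e$, and $\overline{\mathcal N}_{\hat\rho_e}$ is the set of its extremal elements. Basic states. Let $\lambda$ be an ergodic TI probability measure on $S$, let $\nu\in\overline{\mathcal N}_{\hat\rho_e}$ (for some $\hat\rho_e\ge 1$) have finite (minimal) period $n=n(\nu)$ under translation, and let $m,q$ be positive integers with $n=qm$. (a) A $(\lambda,m)$-partition of $S$ is an ordered family $A=(A_i)_{i=0}^{m-1}$ of (measurable) subsets of $S$ such that $\bigcup_iA_i=S$ and $A_i\cap A_j=\emptyset$ for $0\le i<j\le m-1$, both up to sets of $\lambda$-measure zero, and such that $\tau(A_k)=A_{(k+1)\bmod m}$. (b) For a $(\lambda,m)$-partition $A$, let $\nu^{(q)}:=q^{-1}\sum_{i=0}^{q-1}\tau_*^{im}\nu$. Then $\tilde\mu^{(\lambda,\nu,A)}$ is the state on $\widehat X^*_e\times S$ given by $\tilde\mu^{(\lambda,\nu,A)}(d\mathbf n\,d\sigma)=\mu_\sigma^{(\nu,A)}(d\mathbf n)\lambda(d\sigma)$, where $\mu_\sigma^{(\nu,A)}=\tau_*^k\nu^{(q)}$ for $\sigma\in A_k$. The states $\tilde\mu^{(\lambda,\nu,A)}$ and $\gamma_*\tilde\mu^{(\lambda,\nu,A)}$ are called basic states. (c) The basic state $\tilde\mu^{(\lambda,\nu,A)}$ is reducible if there is a basic state $\tilde\mu^{(\lambda,\nu,A')}$ (so $A'$ is a $(\lambda,m')$-partition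 with $m'$ dividing $n$) such that $A'$ is a proper refinement of $A$; then $\gamma_*\tilde\mu^{(\lambda,\nu,A)}$ is also called reducible. Basic states which are not reducible are irreducible. *)

theory Defs
  imports "HOL-Probability.Probability"
begin

text \<open>This makes \<open>borel\<close> on \<open>int \<Rightarrow> bool\<close> the product sigma-algebra.\<close>

instance bool :: second_countable_topology
proof
  have "open = generate_topology (range (\<lambda>b::bool. {b}))"
  proof (intro ext iffI)
    fix U :: "bool set"
    have "generate_topology (range (\<lambda>b::bool. {b})) (\<Union>b\<in>U. {b})"
      by (rule generate_topology.UN) (auto intro: generate_topology.Basis)
    then show "generate_topology (range (\<lambda>b::bool. {b})) U" by simp
  qed (rule Topological_Spaces.open_discrete)
  then show "\<exists>B::bool set set. countable B \<and> open = generate_topology B"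
    by (intro exI[of _ "range (\<lambda>b::bool. {b})"]) simp
qed

type_synonym config = "int \<Rightarrow> nat"

text \<open>The space \<open>S = {0,1}\<^sup>\<int>\<close> is rendered as \<open>int \<Rightarrow> bool\<close>.  Both \<open>config\<close> and \<open>spins\<close>
  carry the product of the discrete topologies, and \<open>borel\<close> is the Borel sigma-algebra of that
  topology.\<close>

type_synonym spins = "int \<Rightarrow> bool"


section \<open>Translations and states\<close>

definition translate :: "(int \<Rightarrow> 'a) \<Rightarrow> int \<Rightarrow> 'a" where
  "translate \<eta> = (\<lambda>i. \<eta> (i - 1))"

definition push_translate :: "(int \<Rightarrow> 'a::topological_space) measure \<Rightarrow> (int \<Rightarrow> 'a) measure" where
  "push_translate M = distr M borel translate"

definition states_on :: "'b::topological_space set \<Rightarrow> 'b measure set" where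
  "states_on Z = {M. prob_space M \<and> sets M = sets borel \<and> (AE x in M. x \<in> Z)}"

definition transl_inv :: "(int \<Rightarrow> 'a::topological_space) measure \<Rightarrow> bool" where
  "transl_inv M \<longleftrightarrow> push_translate M = M"

definition ergodic :: "(int \<Rightarrow> 'a::topological_space) measure \<Rightarrow> bool" where
  "ergodic M \<longleftrightarrow> M \<in> states_on UNIV \<and> transl_inv M \<and>
     (\<forall>B\<in>sets borel. translate -` B = B \<longrightarrow> measure M B = 0 \<or> measure M B = 1)"

definition minimal_period :: "(int \<Rightarrow> 'a::topological_space) measure \<Rightarrow> nat \<Rightarrow> bool" where
  "minimal_period M n \<longleftrightarrow> n > 0 \<and> (push_translate ^^ n) M = M \<and>
     (\<forall>k. 0 < k \<and> k < n \<longrightarrow> (push_translate ^^ k) M \<noteq> M)"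

definition extremal_states :: "'b::topological_space measure set \<Rightarrow> 'b measure set" where
  "extremal_states C = {M \<in> C. \<forall>M1\<in>C. \<forall>M2\<in>C. \<forall>t::real. 0 < t \<and> t < 1 \<and>
     (\<forall>B\<in>sets borel. measure M B = t * measure M1 B + (1 - t) * measure M2 B) \<longrightarrow>
     M1 = M \<and> M2 = M}"


section \<open>The symmetric stack model\<close>

definition short :: "nat \<Rightarrow> bool" where
  "short j \<longleftrightarrow> j \<le> 1"

definition Xstar :: "config set" where
  "Xstar = {\<eta>. \<forall>i. \<not> (short (\<eta> i) \<and> short (\<eta> (i + 1)))}"

definition Xstar_even :: "config set" where
  "Xstar_even = {\<eta> \<in> Xstar. \<forall>i. even (\<eta> i)}"

text \<open>\<open>ssm_flux \<eta> b k\<close> is the signed number of particles that cross the bond \<open>\<langle>k,k+1\<rangle>\<close> from left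
  to right; the coin \<open>b k\<close> decides the direction when both stacks are tall.\<close>

definition ssm_flux :: "config \<Rightarrow> (int \<Rightarrow> bool) \<Rightarrow> int \<Rightarrow> int" where
  "ssm_flux \<eta> b k =
     (if short (\<eta> k) \<and> short (\<eta> (k + 1)) then 0
      else if short (\<eta> (k + 1)) then 1
      else if short (\<eta> k) then - 1
      else if b k then 1 else - 1)"

definition ssm_step :: "config \<Rightarrow> (int \<Rightarrow> bool) \<Rightarrow> config" where
  "ssm_step \<eta> b = (\<lambda>i. nat (int (\<eta> i) + ssm_flux \<eta> b (i - 1) - ssm_flux \<eta> b i))"

lemma int_ssm_step:
  "int (ssm_step \<eta> b i) = int (\<eta> i) + ssm_flux \<eta> b (i - 1) - ssm_flux \<eta> b i"
  by (auto simp: ssm_step_def ssm_flux_def short_def)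

definition coins :: "(int \<Rightarrow> bool) measure" where
  "coins = (\<Pi>\<^sub>M k\<in>UNIV. measure_pmf (bernoulli_pmf (1 / 2)))"

definition ssm_kernel :: "config \<Rightarrow> config measure" where
  "ssm_kernel \<eta> = distr coins borel (ssm_step \<eta>)"

definition ssm_stationary :: "config measure \<Rightarrow> bool" where
  "ssm_stationary M \<longleftrightarrow> M \<bind> ssm_kernel = M"

definition TIS :: "config measure set" where
  "TIS = {M \<in> states_on Xstar. transl_inv M \<and> ssm_stationary M}"

definition ETIS :: "config measure set" where
  "ETIS = extremal_states TIS"

definition regular :: "config measure \<Rightarrow> bool" where
  "regular M \<longleftrightarrow> (\<integral>\<^sup>+\<eta>. of_nat (\<eta> 0) \<partial>M) < \<infinity>"

definition has_density :: "config measure \<Rightarrow> real \<Rightarrow> bool" where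
  "has_density M \<rho> \<longleftrightarrow> (AE \<eta> in M.
     (\<lambda>N::nat. (\<Sum>i\<in>{1..int N}. real (\<eta> i)) / real N) \<longlonglongrightarrow> \<rho> \<and>
     (\<lambda>N::nat. (\<Sum>i\<in>{- int N..- 1}. real (\<eta> i)) / real N) \<longlonglongrightarrow> \<rho>)"

definition N_states :: "real \<Rightarrow> config measure set" where
  "N_states \<rho> = {M \<in> states_on Xstar_even. ssm_stationary M \<and> has_density M \<rho>}"

definition N_extremal :: "real \<Rightarrow> config measure set" where
  "N_extremal \<rho> = extremal_states (N_states \<rho>)"


section \<open>Basic states\<close>

definition partition_family :: "spins measure \<Rightarrow> nat \<Rightarrow> (nat \<Rightarrow> spins set) \<Rightarrow> bool" where
  "partition_family lam m A \<longleftrightarrow>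
     (\<forall>i<m. A i \<in> sets borel) \<and>
     (AE \<sigma> in lam. \<sigma> \<in> (\<Union>i<m. A i)) \<and>
     (\<forall>i j. i < j \<and> j < m \<longrightarrow> (AE \<sigma> in lam. \<sigma> \<notin> A i \<inter> A j)) \<and>
     (\<forall>k<m. translate ` A k = A ((k + 1) mod m))"

text \<open>Partitions are only determined up to null sets, hence so is refinement.  It is proper if the
  two partitions differ modulo null sets.\<close>

definition refines ::
  "spins measure \<Rightarrow> nat \<Rightarrow> (nat \<Rightarrow> spins set) \<Rightarrow> nat \<Rightarrow> (nat \<Rightarrow> spins set) \<Rightarrow> bool" where
  "refines lam m' A' m A \<longleftrightarrow> (\<forall>j<m'. \<exists>i<m. AE \<sigma> in lam. \<sigma> \<in> A' j \<longrightarrow> \<sigma> \<in> A i)"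

definition properly_refines ::
  "spins measure \<Rightarrow> nat \<Rightarrow> (nat \<Rightarrow> spins set) \<Rightarrow> nat \<Rightarrow> (nat \<Rightarrow> spins set) \<Rightarrow> bool" where
  "properly_refines lam m' A' m A \<longleftrightarrow> refines lam m' A' m A \<and> \<not> refines lam m A m' A'"

definition averaged :: "config measure \<Rightarrow> nat \<Rightarrow> nat \<Rightarrow> config measure" where
  "averaged \<nu> m q = measure_of UNIV (sets borel)
     (\<lambda>B. (\<Sum>i<q. emeasure ((push_translate ^^ (i * m)) \<nu>) B) / of_nat q)"

text \<open>If \<open>n = q * m\<close> is the period of \<open>\<nu>\<close>, then \<open>averaged \<nu> m q\<close> is \<open>\<nu>\<close> averaged over its translates by
  multiples of \<open>m\<close>.  \<open>LEAST\<close> only selects a version on the null set of spin configurations that lie in no cell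
  or in several cells.\<close>

definition fibre_state ::
  "config measure \<Rightarrow> nat \<Rightarrow> nat \<Rightarrow> (nat \<Rightarrow> spins set) \<Rightarrow> spins \<Rightarrow> config measure" where
  "fibre_state \<nu> m q A \<sigma> = (push_translate ^^ (LEAST k. k < m \<and> \<sigma> \<in> A k)) (averaged \<nu> m q)"

definition pre_basic_state ::
  "spins measure \<Rightarrow> config measure \<Rightarrow> nat \<Rightarrow> nat \<Rightarrow> (nat \<Rightarrow> spins set) \<Rightarrow> (config \<times> spins) measure"
where
  "pre_basic_state lam \<nu> m q A =
     lam \<bind> (\<lambda>\<sigma>. distr (fibre_state \<nu> m q A \<sigma>) borel (\<lambda>\<eta>. (\<eta>, \<sigma>)))"

definition basic_data ::
  "spins measure \<Rightarrow> config measure \<Rightarrow> nat \<Rightarrow> nat \<Rightarrow> (nat \<Rightarrow> spins set) \<Rightarrow> bool" where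
  "basic_data lam \<nu> m q A \<longleftrightarrow> ergodic lam \<and> (\<exists>\<rho>\<ge>1. \<nu> \<in> N_extremal \<rho>) \<and>
     m > 0 \<and> q > 0 \<and> minimal_period \<nu> (q * m) \<and> partition_family lam m A"

definition pre_basic :: "(config \<times> spins) measure \<Rightarrow> bool" where
  "pre_basic P \<longleftrightarrow> (\<exists>lam \<nu> m q A. basic_data lam \<nu> m q A \<and> P = pre_basic_state lam \<nu> m q A)"

definition pre_reducible :: "(config \<times> spins) measure \<Rightarrow> bool" where
  "pre_reducible P \<longleftrightarrow> (\<exists>lam \<nu> m q A m' q' A'.
     basic_data lam \<nu> m q A \<and> P = pre_basic_state lam \<nu> m q A \<and>
     basic_data lam \<nu> m' q' A' \<and> properly_refines lam m' A' m A)"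

definition combine :: "config \<times> spins \<Rightarrow> config" where
  "combine = (\<lambda>(\<eta>, \<sigma>) i. \<eta> i + of_bool (\<sigma> i))"

definition basic_state :: "config measure \<Rightarrow> bool" where
  "basic_state M \<longleftrightarrow> (\<exists>P. pre_basic P \<and> M = distr P borel combine)"

definition reducible :: "config measure \<Rightarrow> bool" where
  "reducible M \<longleftrightarrow> (\<exists>P. pre_reducible P \<and> M = distr P borel combine)"

definition irreducible_basic_state :: "config measure \<Rightarrow> bool" where
  "irreducible_basic_state M \<longleftrightarrow> basic_state M \<and> \<not> reducible M"

end

theory Submission
  imports Defs
begin

text \<open>On configurations without adjacent short stacks exactly one particle crosses every bond, so
  the parities \<open>\<sigma>\<close> of the stacks are frozen and the even part \<open>2\<lfloor>\<eta>/2\<rfloor>\<close> performs the dynamics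
  by itself.  A stationary state is thus a family of stationary states of the even system indexed
  by \<open>\<sigma>\<close>.  The even marginal has an ergodic decomposition \<open>x \<mapsto> Q x\<close> whose values are, by the
  countability hypothesis, countably many mutually singular extremal states; hence a regular TIS
  state is \<open>\<Sum>\<^sub>i \<nu>\<^sub>i \<otimes> w\<^sub>i\<close> with measures \<open>w\<^sub>i\<close> on \<open>S\<close>.  Translation permutes the \<open>\<nu>\<^sub>i\<close>, all of the
  same mass along an orbit, so orbits are finite.  If \<open>\<nu>\<close> has period \<open>n\<close>, its weight is invariant
  under the \<open>n\<close>-th power of the shift, and the \<open>\<sigma>\<close>-algebra of sets invariant under that power
  consists of finitely many cyclically permuted atoms.  These atoms form the finest partition, and
  the extremal states are those whose weight sits on one atom; that is irreducibility.\<close>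

section \<open>Markov kernels and the mean ergodic theorem\<close>

text \<open>Extremality enters only through domination: if \<open>c * M' \<le> M\<close> for some
  \<open>c > 0\<close> and \<open>M'\<close> belongs to the same class, then \<open>M' = M\<close>.
  A regular extremal state is therefore never decomposed completely; it suffices to find one basic
  state below it. The main obstacle is to construct \<open>Q\<close>: invariance and extremality of
  its values have to hold off one null set, while ergodic limits are determined only up to null sets
  that depend on the function. Hence everything is tested on countably many functions, and almost
  sure identities are deduced from identities of integrals against all invariant measures absolutely
  continuous with respect to the given one. The mean ergodic theorem is stated for an arbitrary
  kernel because it is needed twice, for the dynamics and for powers of the shift of the parities.
  Countability is assumed for one density at a time, so an extremal state must be shown to have a
  constant density; this combines the maximal ergodic lemma with a zero-one law for events invariant
  under both translation and dynamics, and it is the place where the finite mean is used.\<close>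

definition invariant_under :: "'a measure \<Rightarrow> ('a \<Rightarrow> 'a measure) \<Rightarrow> 'a measure \<Rightarrow> bool" where
  "invariant_under N K \<mu> \<longleftrightarrow> sets \<mu> = sets N \<and> finite_measure \<mu> \<and>
     (\<forall>B\<in>sets N. emeasure \<mu> B = (\<integral>\<^sup>+x. emeasure (K x) B \<partial>\<mu>))"

definition kint :: "('a \<Rightarrow> 'a measure) \<Rightarrow> ('a \<Rightarrow> real) \<Rightarrow> 'a \<Rightarrow> real" where
  "kint K f x = (\<integral>y. f y \<partial>K x)"

text \<open>Instantiated by the dynamics, by deterministic maps such as the shift, and by the
  conditional laws \<open>Q\<close> themselves, so that facts about stationarity also apply to
  mixtures over \<open>Q\<close>.\<close>

locale markov_kernel =
  fixes N :: "'a measure" and K :: "'a \<Rightarrow> 'a measure"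
  assumes space_UNIV: "space N = UNIV"
    and kernel_measurable [measurable]: "K \<in> N \<rightarrow>\<^sub>M prob_algebra N"
begin

lemma kernel_subprob [measurable]: "K \<in> N \<rightarrow>\<^sub>M subprob_algebra N"
  by (rule measurable_prob_algebraD) simp

lemma prob_space_kernel: "prob_space (K x)"
  using measurable_space[OF kernel_measurable, of x] by (simp add: space_UNIV space_prob_algebra)

lemma sets_kernel [simp, measurable_cong]: "sets (K x) = sets N"
  using measurable_space[OF kernel_measurable, of x] by (simp add: space_UNIV space_prob_algebra)

lemma space_kernel [simp]: "space (K x) = UNIV"
  using sets_eq_imp_space_eq[OF sets_kernel] by (simp add: space_UNIV)

abbreviation "inv_meas \<equiv> invariant_under N K"

lemma inv_measD:
  assumes "inv_meas \<mu>"
  shows "sets \<mu> = sets N" "finite_measure \<mu>" "space \<mu> = UNIV"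
    "\<And>B. B \<in> sets N \<Longrightarrow> emeasure \<mu> B = (\<integral>\<^sup>+x. emeasure (K x) B \<partial>\<mu>)"
  using assms sets_eq_imp_space_eq[of \<mu> N] by (auto simp: invariant_under_def space_UNIV)

lemma inv_meas_bind:
  assumes "inv_meas \<mu>"
  shows "\<mu> \<bind> K = \<mu>"
proof (rule measure_eqI)
  note m = inv_measD[OF assms]
  have K: "K \<in> measurable \<mu> (subprob_algebra N)"
    using kernel_subprob m(1) by (simp cong: measurable_cong_sets)
  show s: "sets (\<mu> \<bind> K) = sets \<mu>"
    using m by (subst sets_bind[where N=N]) auto
  show "emeasure (\<mu> \<bind> K) A = emeasure \<mu> A" if "A \<in> sets (\<mu> \<bind> K)" for A
    using that s m K by (subst emeasure_bind[where N=N]) auto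
qed

lemma kint_measurable [measurable]:
  assumes [measurable]: "f \<in> borel_measurable N"
  shows "kint K f \<in> borel_measurable N"
  unfolding kint_def
  by (rule measurable_compose[OF kernel_subprob]) (rule integral_measurable_subprob_algebra, measurable)

lemma integrable_kernel:
  assumes [measurable]: "f \<in> borel_measurable N" and "\<And>x. \<bar>f x\<bar> \<le> (B::real)"
  shows "integrable (K x) f"
proof -
  interpret prob_space "K x" by (rule prob_space_kernel)
  have "f \<in> borel_measurable (K x)"
    using assms(1) by (simp cong: measurable_cong_sets)
  then show ?thesis using assms(2) by (intro integrable_const_bound[where B=B]) auto
qed

lemma integrable_inv:
  assumes "inv_meas \<mu>" "f \<in> borel_measurable N" and "\<And>x. \<bar>f x\<bar> \<le> (B::real)"
  shows "integrable \<mu> f"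
proof -
  interpret finite_measure \<mu> using inv_measD[OF assms(1)] by simp
  show ?thesis by (rule integrable_const_bound[where B=B])
    (use assms inv_measD[OF assms(1)] in \<open>auto cong: measurable_cong_sets\<close>)
qed

lemma kint_bounded:
  assumes [measurable]: "f \<in> borel_measurable N" and "\<And>x. \<bar>f x\<bar> \<le> (B::real)"
  shows "\<bar>kint K f x\<bar> \<le> B"
proof -
  interpret prob_space "K x" by (rule prob_space_kernel)
  have "\<bar>kint K f x\<bar> \<le> (\<integral>y. \<bar>f y\<bar> \<partial>K x)"
    unfolding kint_def by (rule integral_abs_bound)
  also have "\<dots> \<le> (\<integral>y. B \<partial>K x)"
    by (rule integral_mono) (use assms integrable_kernel[of "\<lambda>x. \<bar>f x\<bar>" B] in auto)
  finally show ?thesis using prob_space by simp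
qed

lemma kint_mono:
  assumes [measurable]: "f \<in> borel_measurable N" "g \<in> borel_measurable N"
    and "\<And>x. \<bar>f x\<bar> \<le> (B::real)" "\<And>x. \<bar>g x\<bar> \<le> (C::real)" "\<And>x. f x \<le> g x"
  shows "kint K f x \<le> kint K g x"
  unfolding kint_def
  by (intro integral_mono integrable_kernel[OF assms(1,3)] integrable_kernel[OF assms(2,4)] assms(5))

lemma kint_diff:
  assumes [measurable]: "f \<in> borel_measurable N" "g \<in> borel_measurable N"
    and "\<And>x. \<bar>f x\<bar> \<le> (B::real)" "\<And>x. \<bar>g x\<bar> \<le> (C::real)"
  shows "kint K (\<lambda>x. f x - g x) x = kint K f x - kint K g x"
  unfolding kint_def
  by (intro Bochner_Integration.integral_diff integrable_kernel[OF assms(1,3)] integrable_kernel[OF assms(2,4)])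

lemma kint_const: "kint K (\<lambda>_. c) x = c"
proof -
  interpret prob_space "K x" by (rule prob_space_kernel)
  show ?thesis using prob_space by (simp add: kint_def)
qed

lemma integral_bind_kernel:
  assumes M: "sets M = sets N" and f[measurable]: "f \<in> borel_measurable N"
    and b: "\<And>x. 0 \<le> f x" "\<And>x. f x \<le> (B::real)"
  shows "(\<integral>x. f x \<partial>(M \<bind> K)) = (\<integral>x. kint K f x \<partial>M)"
proof -
  have 1: "(\<integral>\<^sup>+y. ennreal (f y) \<partial>K x) = ennreal (kint K f x)" for x
    unfolding kint_def using b by (intro nn_integral_eq_integral integrable_kernel[of f B]) auto
  have k0: "0 \<le> kint K f x" for x
    unfolding kint_def using b by simp
  have K: "K \<in> measurable M (subprob_algebra N)"
    using kernel_subprob M by (simp cong: measurable_cong_sets)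
  have "space M \<noteq> {}"
    using sets_eq_imp_space_eq[OF M] by (simp add: space_UNIV)
  then have "sets (M \<bind> K) = sets N"
    by (intro sets_bind[where N=N]) auto
  then have m: "f \<in> borel_measurable (M \<bind> K)" "kint K f \<in> borel_measurable M"
    using M f by (simp_all cong: measurable_cong_sets)
  have "(\<integral>\<^sup>+x. ennreal (f x) \<partial>(M \<bind> K)) = (\<integral>\<^sup>+x. ennreal (kint K f x) \<partial>M)"
    by (subst nn_integral_bind[OF _ K]) (simp_all add: 1)
  then show ?thesis
    using k0 b m by (simp add: integral_eq_nn_integral)
qed

lemma integral_kint_nonneg:
  assumes inv: "inv_meas \<mu>" and f: "f \<in> borel_measurable N"
    and b: "\<And>x. 0 \<le> f x" "\<And>x. f x \<le> (B::real)"
  shows "(\<integral>x. kint K f x \<partial>\<mu>) = (\<integral>x. f x \<partial>\<mu>)"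
  using integral_bind_kernel[OF inv_measD(1)[OF inv] f b] inv_meas_bind[OF inv] by simp

lemma integral_kint:
  assumes inv: "inv_meas \<mu>" and f[measurable]: "f \<in> borel_measurable N"
    and b: "\<And>x. \<bar>f x\<bar> \<le> (B::real)"
  shows "(\<integral>x. kint K f x \<partial>\<mu>) = (\<integral>x. f x \<partial>\<mu>)"
proof -
  interpret finite_measure \<mu> using inv_measD[OF inv] by simp
  have b': "- B \<le> f x" "f x \<le> B" for x
    using b[of x] by auto
  have b'': "\<bar>f x - (-B)\<bar> \<le> 2 * B" for x
    using b'[of x] by auto
  \<comment> \<open>Adding the bound \<open>B\<close> makes the function nonnegative, the case
    already treated.\<close>
  have "(\<integral>x. kint K (\<lambda>x. f x - (-B)) x \<partial>\<mu>) = (\<integral>x. f x - (-B) \<partial>\<mu>)"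
  proof (rule integral_kint_nonneg[OF inv, where B="2*B"])
    show "0 \<le> f x - (- B)" "f x - (- B) \<le> 2 * B" for x
      using b'[of x] by auto
  qed simp
  moreover have "kint K (\<lambda>x. f x - (-B)) = (\<lambda>x. kint K f x - (-B))"
    using kint_diff[of f "\<lambda>_. -B" B "\<bar>B\<bar>"] b by (auto simp: kint_const)
  moreover have "integrable \<mu> f" "integrable \<mu> (kint K f)"
    using integrable_inv[OF inv] kint_bounded[OF f b] b f kint_measurable[OF f] by blast+
  ultimately show ?thesis by simp
qed

text \<open>Jensen's inequality for the square, read off from the nonnegative variance of
  \<open>f\<close> under \<open>K x\<close>.\<close>

lemma kint_square_le:
  assumes f[measurable]: "f \<in> borel_measurable N" and b: "\<And>x. \<bar>f x\<bar> \<le> (B::real)"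
  shows "(kint K f x)\<^sup>2 \<le> kint K (\<lambda>x. (f x)\<^sup>2) x"
proof -
  interpret prob_space "K x" by (rule prob_space_kernel)
  have b2: "\<bar>(f x)\<^sup>2\<bar> \<le> B\<^sup>2" for x
    using power_mono[OF b[of x], of 2] by simp
  have i: "integrable (K x) f" "integrable (K x) (\<lambda>x. (f x)\<^sup>2)"
    by (rule integrable_kernel[OF _ b] integrable_kernel[OF _ b2]; measurable)+
  show ?thesis
    using variance_eq[OF i] variance_positive[of f] by (simp add: kint_def)
qed

text \<open>Midpoints replace general convex combinations because the parallelogram law uses nothing
  else; closure under \<open>kint K\<close> makes the minimiser invariant.\<close>

inductive_set erg_hull :: "('a \<Rightarrow> real) \<Rightarrow> ('a \<Rightarrow> real) set" for f where
  base: "f \<in> erg_hull f"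
| push: "c \<in> erg_hull f \<Longrightarrow> kint K c \<in> erg_hull f"
| mid: "c \<in> erg_hull f \<Longrightarrow> d \<in> erg_hull f \<Longrightarrow> (\<lambda>x. (c x + d x) / 2) \<in> erg_hull f"

text \<open>The integral is preserved under every invariant measure, not only under the one that
  defines the norm to be minimised. This lets a limit found under one measure be compared with all
  the others.\<close>

lemma hull_props:
  assumes "c \<in> erg_hull f" and f: "f \<in> borel_measurable N" "\<And>x. 0 \<le> f x" "\<And>x. f x \<le> 1"
  shows "c \<in> borel_measurable N \<and> (\<forall>x. 0 \<le> c x \<and> c x \<le> 1) \<and>
    (\<forall>\<mu>. inv_meas \<mu> \<longrightarrow> (\<integral>x. c x \<partial>\<mu>) = (\<integral>x. f x \<partial>\<mu>))"
  using assms(1)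
proof induction
  case base
  show ?case using f by simp
next
  case (push c)
  then have c: "c \<in> borel_measurable N" "\<bar>c x\<bar> \<le> 1" "0 \<le> c x" for x by auto
  have "0 \<le> kint K c x" for x unfolding kint_def using c by simp
  moreover have "kint K c x \<le> 1" for x using kint_bounded[OF c(1,2)] by (simp add: abs_le_iff)
  ultimately show ?case using push integral_kint[OF _ c(1,2)] kint_measurable[OF c(1)] by simp
next
  case (mid c d)
  have "(\<integral>x. (c x + d x) / 2 \<partial>\<mu>) = (\<integral>x. f x \<partial>\<mu>)" if i: "inv_meas \<mu>" for \<mu>
  proof -
    have "integrable \<mu> c" "integrable \<mu> d"
      using mid by (auto intro!: integrable_inv[OF i, of _ 1])
    then show ?thesis using mid i by simp
  qed
  moreover have "0 \<le> (c x + d x) / 2" "(c x + d x) / 2 \<le> 1" for x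
    using mid.IH add_mono[of "c x" 1 "d x" 1] by auto
  ultimately show ?case using mid by auto
qed

text \<open>Cauchy-Schwarz on a probability space, as nonnegativity of the variance of the
  modulus.\<close>

lemma L1_le_L2:
  fixes h :: "'b \<Rightarrow> real"
  assumes "prob_space \<mu>" "h \<in> borel_measurable \<mu>" "\<And>x. \<bar>h x\<bar> \<le> B"
  shows "(\<integral>x. \<bar>h x\<bar> \<partial>\<mu>)\<^sup>2 \<le> (\<integral>x. (h x)\<^sup>2 \<partial>\<mu>)"
proof -
  interpret prob_space \<mu> by fact
  have b2: "\<bar>h x\<bar>\<^sup>2 \<le> B\<^sup>2" for x
    using power_mono[OF assms(3)[of x], of 2] by simp
  have i: "integrable \<mu> (\<lambda>x. \<bar>h x\<bar>)" "integrable \<mu> (\<lambda>x. \<bar>h x\<bar>\<^sup>2)"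
    using assms b2 by (intro integrable_const_bound[where B=B] integrable_const_bound[where B="B\<^sup>2"]; simp)+
  show ?thesis
    using variance_eq[OF i] variance_positive[of "\<lambda>x. \<bar>h x\<bar>"] by simp
qed

text \<open>An \<open>L\<^sup>2\<close>-minimising sequence in the midpoint-convex hull of the orbit of \<open>f\<close> is Cauchy, and
  applying \<open>K\<close> keeps it minimising, so its limit is \<open>K\<close>-invariant.\<close>

lemma mean_ergodic:
  assumes inv: "inv_meas \<nu>" and prob: "prob_space \<nu>"
    and f: "f \<in> borel_measurable N" "\<And>x. 0 \<le> f x" "\<And>x. f x \<le> 1"
  obtains c g where "\<And>j. c j \<in> borel_measurable N" "\<And>j x. 0 \<le> c j x" "\<And>j x. c j x \<le> 1"
    "g \<in> borel_measurable N" "\<And>x. 0 \<le> g x" "\<And>x. g x \<le> 1"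
    "AE x in \<nu>. (\<lambda>j. c j x) \<longlonglongrightarrow> g x"
    "\<And>\<mu> j. inv_meas \<mu> \<Longrightarrow> (\<integral>x. c j x \<partial>\<mu>) = (\<integral>x. f x \<partial>\<mu>)"
    "AE x in \<nu>. kint K g x = g x"
proof -
  interpret prob_space \<nu> by fact
  note hull = hull_props[OF _ f]
  have mN: "h \<in> borel_measurable N \<longleftrightarrow> h \<in> borel_measurable \<nu>" for h :: "'a \<Rightarrow> real"
    using inv_measD[OF inv] by (simp cong: measurable_cong_sets)
  define n2 where "n2 c = (\<integral>x. (c x)\<^sup>2 \<partial>\<nu>)" for c :: "'a \<Rightarrow> real"
  define \<alpha> where "\<alpha> = Inf (n2 ` erg_hull f)"
  have n2_0: "0 \<le> n2 c" for c by (simp add: n2_def)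
  have ne: "erg_hull f \<noteq> {}" using erg_hull.base by blast
  have bb: "bdd_below (n2 ` erg_hull f)" using n2_0 by (auto intro!: bdd_belowI[where m=0])
  have \<alpha>_le: "\<alpha> \<le> n2 c" if "c \<in> erg_hull f" for c
    unfolding \<alpha>_def using that by (intro cInf_lower bb) auto
  have ex: "\<exists>c\<in>erg_hull f. n2 c < \<alpha> + e" if "e > 0" for e
    using cInf_lessD[of "n2 ` erg_hull f" "\<alpha> + e"] ne that by (auto simp: \<alpha>_def)
  have int2: "integrable \<nu> (\<lambda>x. (c x)\<^sup>2)" "integrable \<nu> (\<lambda>x. c x * d x)" if "c \<in> erg_hull f" "d \<in> erg_hull f" for c d
  proof -
    have m: "c \<in> borel_measurable N" "d \<in> borel_measurable N" "\<And>x. 0 \<le> c x" "\<And>x. c x \<le> 1"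
      "\<And>x. 0 \<le> d x" "\<And>x. d x \<le> 1"
      using hull that by blast+
    show "integrable \<nu> (\<lambda>x. (c x)\<^sup>2)"
      by (rule integrable_inv[OF inv, of _ 1]) (use m in \<open>auto simp: power_le_one abs_mult mult_le_one\<close>)
    show "integrable \<nu> (\<lambda>x. c x * d x)"
      by (rule integrable_inv[OF inv, of _ 1]) (use m in \<open>auto simp: power_le_one abs_mult mult_le_one\<close>)
  qed
  \<comment> \<open>Parallelogram law: the midpoint is again in the hull, so its squared norm is at
    least \<alpha>, which leaves little room for the difference.\<close>
  have par: "(\<integral>x. (c x - d x)\<^sup>2 \<partial>\<nu>) \<le> 4 * e"
    if cd: "c \<in> erg_hull f" "d \<in> erg_hull f" "n2 c \<le> \<alpha> + e" "n2 d \<le> \<alpha> + e" for c d e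
  proof -
    have i: "integrable \<nu> (\<lambda>x. (c x)\<^sup>2)" "integrable \<nu> (\<lambda>x. (d x)\<^sup>2)" "integrable \<nu> (\<lambda>x. c x * d x)"
      using int2 cd by blast+
    have "(\<integral>x. (c x - d x)\<^sup>2 \<partial>\<nu>) = n2 c + n2 d - 2 * (\<integral>x. c x * d x \<partial>\<nu>)"
      unfolding n2_def power2_diff using i by (simp add: mult.assoc)
    moreover have "4 * n2 (\<lambda>x. (c x + d x) / 2) = n2 c + n2 d + 2 * (\<integral>x. c x * d x \<partial>\<nu>)"
      unfolding n2_def power_divide power2_sum using i by (simp add: mult.assoc)
    moreover have "\<alpha> \<le> n2 (\<lambda>x. (c x + d x) / 2)"
      using cd by (intro \<alpha>_le erg_hull.mid)
    ultimately show ?thesis using cd by linarith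
  qed
  have L1: "(\<integral>x. \<bar>c x - d x\<bar> \<partial>\<nu>) \<le> 2 * sqrt e"
    if cd: "c \<in> erg_hull f" "d \<in> erg_hull f" "n2 c \<le> \<alpha> + e" "n2 d \<le> \<alpha> + e" for c d e
  proof -
    have "\<bar>c x - d x\<bar> \<le> 1" for x
    proof -
      have "0 \<le> c x \<and> c x \<le> 1" "0 \<le> d x \<and> d x \<le> 1"
        using hull[OF cd(1)] hull[OF cd(2)] by auto
      then show ?thesis by linarith
    qed
    then have "(\<integral>x. \<bar>c x - d x\<bar> \<partial>\<nu>)\<^sup>2 \<le> (\<integral>x. (c x - d x)\<^sup>2 \<partial>\<nu>)"
      using hull[OF cd(1)] hull[OF cd(2)]
      by (intro L1_le_L2[OF prob, where B=1]) (auto simp: mN)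
    also have "\<dots> \<le> 4 * e" using par[OF cd] .
    finally have "sqrt ((\<integral>x. \<bar>c x - d x\<bar> \<partial>\<nu>)\<^sup>2) \<le> sqrt (4 * e)"
      by (rule real_sqrt_le_mono)
    then show ?thesis by (simp add: real_sqrt_mult)
  qed
  have "\<exists>c. \<forall>j. c j \<in> erg_hull f \<and> n2 (c j) < \<alpha> + 1 / real (Suc j)"
    using ex by (intro choice) (meson divide_pos_pos of_nat_0_less_iff zero_less_Suc zero_less_one)
  then obtain c0 where c0: "\<And>j. c0 j \<in> erg_hull f" "\<And>j. n2 (c0 j) < \<alpha> + 1 / real (Suc j)"
    by blast
  have c0_le: "n2 (c0 i) \<le> \<alpha> + 1 / real (Suc j)" if "i \<ge> j" for i j
  proof -
    have "1 / real (Suc i) \<le> 1 / real (Suc j)" using that by (simp add: frac_le)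
    then show ?thesis using c0(2)[of i] by linarith
  qed
  have sq0: "(\<lambda>j. 2 * sqrt (1 / real (Suc j))) \<longlonglongrightarrow> 0"
    using tendsto_mult_left[OF tendsto_real_sqrt[OF LIMSEQ_inverse_real_of_nat], of 2]
    by (simp add: inverse_eq_divide)
  have ic: "integrable \<nu> (c0 j)" for j
    using hull[OF c0(1)] by (intro integrable_inv[OF inv, of _ 1]) auto
  \<comment> \<open>The minimising sequence is Cauchy in \<open>L1\<close>; a subsequence converges
    almost everywhere, which provides the pointwise limit \<open>g\<close>.\<close>
  obtain r where r: "strict_mono r" "AE x in \<nu>. Cauchy (\<lambda>i. c0 (r i) x)"
  proof (rule cauchy_L1_AE_cauchy_subseq[of \<nu> c0])
    show "integrable \<nu> (c0 n)" for n by (rule ic)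
    fix e :: real assume "e > 0"
    then obtain n where n: "2 * sqrt (1 / real (Suc n)) < e"
      using order_tendstoD(2)[OF sq0] by (auto simp: eventually_sequentially)
    show "\<exists>n. \<forall>i\<ge>n. \<forall>j\<ge>n. (LINT x|\<nu>. norm (c0 i x - c0 j x)) < e"
      using L1[OF c0(1) c0(1) c0_le c0_le, of n] n
      by (intro exI[of _ n]) (auto intro: le_less_trans)
  qed blast
  define c where "c j = c0 (r j)" for j
  \<comment> \<open>The default 0 keeps \<open>g\<close> measurable and between 0 and 1 at every
    point.\<close>
  define g where "g x = (if Cauchy (\<lambda>j. c j x) then lim (\<lambda>j. c j x) else 0)" for x
  have c: "c j \<in> borel_measurable N" "0 \<le> c j x" "c j x \<le> 1" for j x
    using hull[OF c0(1)] by (auto simp: c_def)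
  have c_lim: "AE x in \<nu>. (\<lambda>j. c j x) \<longlonglongrightarrow> g x"
    using r(2) by eventually_elim (auto simp: g_def c_def Cauchy_convergent_iff convergent_LIMSEQ_iff)
  have gm[measurable]: "g \<in> borel_measurable N"
    unfolding g_def using c(1) by measurable
  have g01: "0 \<le> g x \<and> g x \<le> 1" for x
  proof (cases "Cauchy (\<lambda>j. c j x)")
    case True
    then have "(\<lambda>j. c j x) \<longlonglongrightarrow> g x"
      by (auto simp: g_def Cauchy_convergent_iff convergent_LIMSEQ_iff)
    then show ?thesis using c by (meson LIMSEQ_le_const LIMSEQ_le_const2)
  qed (simp add: g_def)
  have g_abs: "\<bar>g x\<bar> \<le> 1" "\<bar>c j x\<bar> \<le> 1" "\<bar>c j x - g x\<bar> \<le> 1" for j x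
    using g01[of x] c(2,3)[of j x] by auto
  have cg: "(\<lambda>j. \<integral>x. \<bar>c j x - g x\<bar> \<partial>\<nu>) \<longlonglongrightarrow> (\<integral>x. 0 \<partial>\<nu>)"
  proof (rule integral_dominated_convergence[where w="\<lambda>_. 1"])
    show "AE x in \<nu>. (\<lambda>j. \<bar>c j x - g x\<bar>) \<longlonglongrightarrow> 0"
      using c_lim by eventually_elim (simp add: LIM_zero_iff tendsto_rabs_zero_iff)
  qed (use c gm g_abs in \<open>auto simp: mN\<close>)
  \<comment> \<open>By Jensen the kernel does not increase the norm, so \<open>kint K (c j)\<close>
    is as close to minimal as \<open>c j\<close>, and two nearly minimal elements are close to each
    other.\<close>
  have kc: "(\<lambda>j. \<integral>x. \<bar>c j x - kint K (c j) x\<bar> \<partial>\<nu>) \<longlonglongrightarrow> 0"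
  proof (rule tendsto_sandwich[OF _ _ tendsto_const])
    show "\<forall>\<^sub>F j in sequentially. (\<integral>x. \<bar>c j x - kint K (c j) x\<bar> \<partial>\<nu>) \<le> 2 * sqrt (1 / real (Suc j))"
    proof (intro always_eventually allI)
      fix j
      have "n2 (c j) \<le> \<alpha> + 1 / real (Suc j)"
        unfolding c_def by (rule c0_le) (rule strict_mono_imp_increasing[OF r(1)])
      moreover have "n2 (kint K (c j)) \<le> n2 (c j)"
      proof -
        have b2: "\<bar>(c j x)\<^sup>2\<bar> \<le> 1" for x using c(2,3)[of j x] by (simp add: power_le_one)
        have cm: "c j \<in> borel_measurable N" by (rule c)
        have "kint K (c j) \<in> erg_hull f" unfolding c_def by (intro erg_hull.push c0)
        then have "n2 (kint K (c j)) \<le> (\<integral>x. kint K (\<lambda>x. (c j x)\<^sup>2) x \<partial>\<nu>)"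
          unfolding n2_def
          using kint_square_le[OF c(1) g_abs(2)] cm kint_bounded[OF _ b2]
          by (intro integral_mono int2 integrable_inv[OF inv, of _ 1]) auto
        also have "\<dots> = n2 (c j)"
          unfolding n2_def using cm b2 by (intro integral_kint[OF inv]) auto
        finally show ?thesis .
      qed
      ultimately show "(\<integral>x. \<bar>c j x - kint K (c j) x\<bar> \<partial>\<nu>) \<le> 2 * sqrt (1 / real (Suc j))"
        using c0(1) by (intro L1) (auto simp: c_def intro: erg_hull.push)
    qed
    show "\<forall>\<^sub>F j in sequentially. 0 \<le> (\<integral>x. \<bar>c j x - kint K (c j) x\<bar> \<partial>\<nu>)" by simp
    show "(\<lambda>j. 2 * sqrt (1 / real (Suc j))) \<longlonglongrightarrow> 0" by (rule sq0)
  qed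
  have kgm: "kint K g \<in> borel_measurable N" by measurable
  have kcm: "kint K (c j) \<in> borel_measurable N" for j using c by measurable
  have kgb: "\<bar>kint K g x\<bar> \<le> 1" for x by (rule kint_bounded) (use g_abs in auto)
  have kcb: "\<bar>kint K (c j) x\<bar> \<le> 1" for j x by (rule kint_bounded) (use g_abs c in auto)
  \<comment> \<open>Triangle inequality through \<open>c j\<close> and \<open>kint K (c j)\<close>;
    the term to which the kernel is applied integrates to the same value as without it, by
    invariance.\<close>
  have le: "(\<integral>x. \<bar>kint K g x - g x\<bar> \<partial>\<nu>) \<le>
      (\<integral>x. \<bar>c j x - g x\<bar> \<partial>\<nu>) + (\<integral>x. \<bar>c j x - kint K (c j) x\<bar> \<partial>\<nu>) + (\<integral>x. \<bar>c j x - g x\<bar> \<partial>\<nu>)" for j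
  proof -
    have i1: "integrable \<nu> (\<lambda>x. \<bar>c j x - g x\<bar>)"
      by (rule integrable_inv[OF inv, of _ 1]) (use c gm g_abs in auto)
    have i2: "integrable \<nu> (\<lambda>x. kint K (\<lambda>x. \<bar>c j x - g x\<bar>) x)"
      by (rule integrable_inv[OF inv, of _ 1]) (use c gm g_abs in \<open>auto intro!: kint_bounded\<close>)
    have "\<bar>c j x - kint K (c j) x\<bar> \<le> 2" for x
      using g_abs(2)[of j x] kcb[of j x] by linarith
    then have i3: "integrable \<nu> (\<lambda>x. \<bar>c j x - kint K (c j) x\<bar>)"
      by (intro integrable_inv[OF inv, of _ 2]) (use c kcm in auto)
    have "\<bar>kint K g x - g x\<bar> \<le> 2" for x
      using g_abs(1)[of x] kgb[of x] by linarith
    then have i4: "integrable \<nu> (\<lambda>x. \<bar>kint K g x - g x\<bar>)"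
      by (intro integrable_inv[OF inv, of _ 2]) (use kgm gm in auto)
    have "\<bar>kint K g x - g x\<bar> \<le>
      kint K (\<lambda>x. \<bar>c j x - g x\<bar>) x + \<bar>c j x - kint K (c j) x\<bar> + \<bar>c j x - g x\<bar>" for x
    proof -
      have "kint K (c j) x - kint K g x = kint K (\<lambda>x. c j x - g x) x"
        using kint_diff[of "c j" g 1 1] c gm g_abs by simp
      moreover have "\<bar>kint K (\<lambda>x. c j x - g x) x\<bar> \<le> kint K (\<lambda>x. \<bar>c j x - g x\<bar>) x"
        unfolding kint_def by (rule integral_abs_bound)
      ultimately show ?thesis by linarith
    qed
    then have "(\<integral>x. \<bar>kint K g x - g x\<bar> \<partial>\<nu>) \<le>
      (\<integral>x. kint K (\<lambda>x. \<bar>c j x - g x\<bar>) x + \<bar>c j x - kint K (c j) x\<bar> + \<bar>c j x - g x\<bar> \<partial>\<nu>)"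
      by (intro integral_mono i4 Bochner_Integration.integrable_add i1 i2 i3)
    also have "\<dots> = (\<integral>x. kint K (\<lambda>x. \<bar>c j x - g x\<bar>) x \<partial>\<nu>) + (\<integral>x. \<bar>c j x - kint K (c j) x\<bar> \<partial>\<nu>) + (\<integral>x. \<bar>c j x - g x\<bar> \<partial>\<nu>)"
      using i1 i2 i3 by simp
    also have "(\<integral>x. kint K (\<lambda>x. \<bar>c j x - g x\<bar>) x \<partial>\<nu>) = (\<integral>x. \<bar>c j x - g x\<bar> \<partial>\<nu>)"
      using c gm g_abs by (intro integral_kint[OF inv, where B=1]) auto
    finally show ?thesis .
  qed
  have "(\<integral>x. \<bar>kint K g x - g x\<bar> \<partial>\<nu>) \<le> 0 + 0 + 0"
    by (rule LIMSEQ_le_const[OF tendsto_add[OF tendsto_add[OF _ kc]]])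
      (use cg le in auto)
  moreover have "integrable \<nu> (\<lambda>x. \<bar>kint K g x - g x\<bar>)"
  proof (rule integrable_inv[OF inv, of _ 2])
    show "\<bar>\<bar>kint K g x - g x\<bar>\<bar> \<le> 2" for x
      using g_abs(1)[of x] kgb[of x] by linarith
  qed (use kgm gm in auto)
  ultimately have "AE x in \<nu>. \<bar>kint K g x - g x\<bar> = 0"
    by (subst integral_nonneg_eq_0_iff_AE[symmetric]) (auto intro: antisym)
  then have kg: "AE x in \<nu>. kint K g x = g x" by eventually_elim simp
  show ?thesis
    by (rule that[of c g]) (use c gm g01 c_lim kg hull[OF c0(1)] in \<open>auto simp: c_def\<close>)
qed

end

section \<open>Harmonic functions\<close>

context markov_kernel
begin

text \<open>The equation holds almost everywhere, but the bound everywhere, so that \<open>h\<close>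
  is integrable under each \<open>K x\<close> and under every invariant measure.\<close>

definition harmonic :: "'a measure \<Rightarrow> ('a \<Rightarrow> real) \<Rightarrow> bool" where
  "harmonic \<nu> h \<longleftrightarrow> h \<in> borel_measurable N \<and> (\<exists>B. \<forall>x. \<bar>h x\<bar> \<le> B) \<and> (AE x in \<nu>. kint K h x = h x)"

lemma harmonicD:
  assumes "harmonic \<nu> h"
  shows "h \<in> borel_measurable N" "AE x in \<nu>. kint K h x = h x"
    "\<And>thesis. (\<And>B. (\<And>x. \<bar>h x\<bar> \<le> B) \<Longrightarrow> thesis) \<Longrightarrow> thesis"
  using assms by (auto simp: harmonic_def)

lemma harmonicI:
  assumes "h \<in> borel_measurable N" "\<And>x. \<bar>h x\<bar> \<le> B" "AE x in \<nu>. kint K h x = h x"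
  shows "harmonic \<nu> h"
  using assms by (auto simp: harmonic_def)

lemma harmonic_const: "harmonic \<nu> (\<lambda>_. c)"
  by (rule harmonicI[where B="\<bar>c\<bar>"]) (auto simp: kint_const)

lemma harmonic_diff:
  assumes "harmonic \<nu> f" "harmonic \<nu> g"
  shows "harmonic \<nu> (\<lambda>x. f x - g x)"
proof -
  note f = harmonicD(1,2)[OF assms(1)] and g = harmonicD(1,2)[OF assms(2)]
  obtain B C where B: "\<And>x. \<bar>f x\<bar> \<le> B" and C: "\<And>x. \<bar>g x\<bar> \<le> C"
    using harmonicD(3)[OF assms(1)] harmonicD(3)[OF assms(2)] by metis
  have b: "\<bar>f x - g x\<bar> \<le> B + C" for x using B[of x] C[of x] by linarith
  show ?thesis
  proof (rule harmonicI[OF _ b])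
    show "(\<lambda>x. f x - g x) \<in> borel_measurable N" using f g by measurable
    show "AE x in \<nu>. kint K (\<lambda>x. f x - g x) x = f x - g x"
      using f(2) g(2) by eventually_elim (simp add: kint_diff[OF f(1) g(1) B C])
  qed
qed

lemma AE_eq_of_le_integral:
  assumes inv: "inv_meas \<nu>" and [measurable]: "f \<in> borel_measurable N" "g \<in> borel_measurable N"
    and "\<And>x. \<bar>f x\<bar> \<le> (B::real)" "\<And>x. \<bar>g x\<bar> \<le> (C::real)"
    and "AE x in \<nu>. f x \<le> g x" "(\<integral>x. f x \<partial>\<nu>) = (\<integral>x. g x \<partial>\<nu>)"
  shows "AE x in \<nu>. f x = g x"
  by (rule integral_ineq_eq_0_then_AE[OF assms(6) _ _ assms(7)])
    (rule integrable_inv[OF inv assms(2,4)] integrable_inv[OF inv assms(3,5)])+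

text \<open>Both sides have the same integral under the invariant measure, so an inequality between
  them is an equality almost everywhere. This is why positive parts, truncations and squares of
  harmonic functions are harmonic again.\<close>

lemma harmonicI_sub:
  assumes inv: "inv_meas \<nu>" and h: "h \<in> borel_measurable N" "\<And>x. \<bar>h x\<bar> \<le> B"
    and le: "AE x in \<nu>. h x \<le> kint K h x"
  shows "harmonic \<nu> h"
proof (rule harmonicI[OF h])
  have "AE x in \<nu>. h x = kint K h x"
    by (rule AE_eq_of_le_integral[OF inv h(1) _ h(2) kint_bounded[OF h] le])
      (use h in \<open>auto simp: integral_kint[OF inv h]\<close>)
  then show "AE x in \<nu>. kint K h x = h x" by eventually_elim simp
qed

lemma harmonicI_super:
  assumes inv: "inv_meas \<nu>" and h: "h \<in> borel_measurable N" "\<And>x. \<bar>h x\<bar> \<le> B"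
    and le: "AE x in \<nu>. kint K h x \<le> h x"
  shows "harmonic \<nu> h"
proof (rule harmonicI[OF h])
  show "AE x in \<nu>. kint K h x = h x"
    by (rule AE_eq_of_le_integral[OF inv _ h(1) kint_bounded[OF h] h(2) le])
      (use h in \<open>auto simp: integral_kint[OF inv h]\<close>)
qed

lemma harmonic_pos_part:
  assumes inv: "inv_meas \<nu>" and h: "harmonic \<nu> h"
  shows "harmonic \<nu> (\<lambda>x. max 0 (h x))"
proof -
  obtain B where B: "\<And>x. \<bar>h x\<bar> \<le> B" using harmonicD(3)[OF h] by metis
  note [measurable] = harmonicD(1)[OF h]
  have b: "\<bar>max 0 (h x)\<bar> \<le> B" for x using B[of x] by auto
  show ?thesis
  proof (rule harmonicI_sub[OF inv _ b])
    show "AE x in \<nu>. max 0 (h x) \<le> kint K (\<lambda>x. max 0 (h x)) x"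
      using harmonicD(2)[OF h]
    proof eventually_elim
      case (elim x)
      have "kint K h x \<le> kint K (\<lambda>x. max 0 (h x)) x" by (rule kint_mono[OF _ _ B b]) auto
      moreover have "0 \<le> kint K (\<lambda>x. max 0 (h x)) x" by (simp add: kint_def)
      ultimately show ?case using elim by simp
    qed
  qed measurable
qed

lemma harmonic_truncate:
  assumes inv: "inv_meas \<nu>" and h: "harmonic \<nu> h" and pos: "\<And>x. 0 \<le> h x"
  shows "harmonic \<nu> (\<lambda>x. min 1 (real n * h x))"
proof -
  obtain B where B: "\<And>x. \<bar>h x\<bar> \<le> B" using harmonicD(3)[OF h] by metis
  note [measurable] = harmonicD(1)[OF h]
  have b: "\<bar>min 1 (real n * h x)\<bar> \<le> 1" for x using pos[of x] by auto
  have b2: "\<bar>real n * h x\<bar> \<le> real n * B" for x using B[of x] by (simp add: abs_mult mult_left_mono)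
  show ?thesis
  proof (rule harmonicI_super[OF inv _ b])
    show "AE x in \<nu>. kint K (\<lambda>x. min 1 (real n * h x)) x \<le> min 1 (real n * h x)"
      using harmonicD(2)[OF h]
    proof eventually_elim
      case (elim x)
      have "kint K (\<lambda>x. min 1 (real n * h x)) x \<le> kint K (\<lambda>x. real n * h x) x"
        by (rule kint_mono[OF _ _ b b2]) auto
      also have "\<dots> = real n * h x" using elim by (simp add: kint_def)
      finally show ?case using kint_bounded[OF _ b] by (simp add: abs_le_iff)
    qed
  qed measurable
qed

text \<open>The harmonic functions \<open>min 1 (n * max 0 h)\<close> increase to the indicator of
  \<open>{h > 0}\<close>, so the indicator satisfies the same equation: almost surely the chain
  neither enters nor leaves this set.\<close>

lemma kernel_pos_set:
  assumes inv: "inv_meas \<nu>" and h: "harmonic \<nu> h"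
  shows "AE x in \<nu>. emeasure (K x) {x. 0 < h x} = indicator {x. 0 < h x} x"
proof -
  note [measurable] = harmonicD(1)[OF h]
  have [measurable]: "{x. 0 < h x} \<in> sets N"
    using measurable_sets[OF harmonicD(1)[OF h], of "{0<..}"] by (simp add: vimage_def space_UNIV)
  let ?k = "\<lambda>n x. min 1 (real n * max 0 (h x))"
  have k: "harmonic \<nu> (?k n)" for n
    by (rule harmonic_truncate[OF inv harmonic_pos_part[OF inv h]]) simp
  have lim: "(\<lambda>n. ?k n x) \<longlonglongrightarrow> indicator {x. 0 < h x} x" for x
  proof (cases "0 < h x")
    case True
    obtain m where m: "1 / h x < real m" using reals_Archimedean2 by blast
    have "\<forall>\<^sub>F n in sequentially. ?k n x = 1"
      using eventually_ge_at_top[of m]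
    proof eventually_elim
      case (elim n)
      then have "1 / h x \<le> real n" using m by linarith
      then show ?case using True by (simp add: field_simps min_def)
    qed
    then show ?thesis using True by (simp add: tendsto_eventually)
  qed simp
  have "AE x in \<nu>. \<forall>n. kint K (?k n) x = ?k n x"
    unfolding AE_all_countable using k harmonicD(2) by blast
  then show ?thesis
  proof eventually_elim
    case (elim x)
    interpret prob_space "K x" by (rule prob_space_kernel)
    have "(\<lambda>n. kint K (?k n) x) \<longlonglongrightarrow> (\<integral>y. indicator {x. 0 < h x} y \<partial>K x)"
      unfolding kint_def
    proof (rule integral_dominated_convergence[where w="\<lambda>_. 1"])
      show "indicat_real {x. 0 < h x} \<in> borel_measurable (K x)"
        by (rule borel_measurable_indicator) simp
      show "?k n \<in> borel_measurable (K x)" for n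
        using harmonicD(1)[OF k[of n]] by (simp cong: measurable_cong_sets)
    qed (use lim in auto)
    moreover have "(\<lambda>n. kint K (?k n) x) \<longlonglongrightarrow> indicator {x. 0 < h x} x"
      using elim lim by simp
    ultimately have "measure (K x) {x. 0 < h x} = indicator {x. 0 < h x} x"
      using LIMSEQ_unique by fastforce
    then show ?case by (simp add: emeasure_eq_measure split: split_indicator)
  qed
qed

text \<open>No mass crosses the boundary of \<open>E\<close>, so the part of the measure inside
  \<open>E\<close> is balanced by itself.\<close>

lemma inv_meas_restrict:
  assumes inv: "inv_meas \<nu>" and E[measurable]: "E \<in> sets N"
    and KE: "AE x in \<nu>. emeasure (K x) E = indicator E x"
  shows "inv_meas (density \<nu> (indicator E))"
  unfolding invariant_under_def
proof (intro conjI ballI)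
  note m = inv_measD[OF inv]
  interpret finite_measure \<nu> by fact
  have E': "E \<in> sets \<nu>" using m E by simp
  show "sets (density \<nu> (indicator E)) = sets N" using m by simp
  show "finite_measure (density \<nu> (indicator E))"
    using E' by (intro finite_measureI) (simp add: emeasure_density)
  fix B assume B: "B \<in> sets N"
  have KB: "(\<lambda>x. emeasure (K x) B) \<in> borel_measurable \<nu>"
    using measurable_emeasure_kernel[OF kernel_subprob B] m(1) by (simp cong: measurable_cong_sets)
  have "emeasure (density \<nu> (indicator E)) B = emeasure \<nu> (E \<inter> B)"
    using B E' m by (simp add: emeasure_density nn_integral_indicator indicator_inter_arith[symmetric] sets.Int)
  also have "\<dots> = (\<integral>\<^sup>+x. emeasure (K x) (E \<inter> B) \<partial>\<nu>)"
    using B by (intro m) auto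
  also have "\<dots> = (\<integral>\<^sup>+x. indicator E x * emeasure (K x) B \<partial>\<nu>)"
  proof (rule nn_integral_cong_AE)
    show "AE x in \<nu>. emeasure (K x) (E \<inter> B) = indicator E x * emeasure (K x) B"
      using KE
    proof eventually_elim
      case (elim x)
      interpret K: prob_space "K x" by (rule prob_space_kernel)
      show ?case
      proof (cases "x \<in> E")
        case True
        then have "AE y in K x. y \<in> E"
          using elim by (intro K.AE_in_set_eq_1[THEN iffD2]) (auto simp: K.emeasure_eq_measure)
        then have "emeasure (K x) (E \<inter> B) = emeasure (K x) B"
          using B by (intro emeasure_eq_AE) auto
        then show ?thesis using True by simp
      next
        case False
        then have "emeasure (K x) (E \<inter> B) \<le> 0"
          using elim B emeasure_mono[of "E \<inter> B" E "K x"] by auto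
        then show ?thesis using False by simp
      qed
    qed
  qed
  also have "\<dots> = (\<integral>\<^sup>+x. emeasure (K x) B \<partial>density \<nu> (indicator E))"
    using E' KB by (subst nn_integral_density) auto
  finally show "emeasure (density \<nu> (indicator E)) B = (\<integral>\<^sup>+x. emeasure (K x) B \<partial>density \<nu> (indicator E))" .
qed

text \<open>The restriction of \<nu> to \<open>{h > 0}\<close> is itself one of the test measures,
  and the integral of \<open>h\<close> against it is nonnegative. This is the device that turns
  inequalities between integrals into almost sure ones.\<close>

lemma harmonic_nonpos:
  assumes inv: "inv_meas \<nu>" and h: "harmonic \<nu> h"
    and le: "\<And>\<mu>. inv_meas \<mu> \<Longrightarrow> absolutely_continuous \<nu> \<mu> \<Longrightarrow> (\<integral>x. h x \<partial>\<mu>) \<le> 0"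
  shows "AE x in \<nu>. h x \<le> 0"
proof -
  note m = inv_measD[OF inv]
  interpret finite_measure \<nu> by fact
  obtain B where B: "\<And>x. \<bar>h x\<bar> \<le> B" using harmonicD(3)[OF h] by metis
  define E where "E = {x. 0 < h x}"
  have E: "E \<in> sets N"
    using measurable_sets[OF harmonicD(1)[OF h], of "{0<..}"] by (simp add: vimage_def space_UNIV E_def)
  then have E': "E \<in> sets \<nu>" using m by simp
  have hm: "h \<in> borel_measurable \<nu>" using harmonicD(1)[OF h] m by (simp cong: measurable_cong_sets)
  have "inv_meas (density \<nu> (indicator E))"
    by (rule inv_meas_restrict[OF inv E]) (use kernel_pos_set[OF inv h] in \<open>simp add: E_def\<close>)
  moreover have "absolutely_continuous \<nu> (density \<nu> (indicator E))"
    using E' by (intro absolutely_continuousI_density) auto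
  ultimately have "(\<integral>x. h x \<partial>density \<nu> (\<lambda>x. ennreal (indicator E x))) \<le> 0"
    using le by (simp add: ennreal_indicator)
  then have le0: "(\<integral>x. indicator E x * h x \<partial>\<nu>) \<le> 0"
    using hm E' by (subst (asm) integral_density) auto
  have nn: "0 \<le> indicator E x * h x" for x by (simp add: E_def split: split_indicator)
  have i: "integrable \<nu> (\<lambda>x. indicator E x * h x)"
  proof (rule integrable_const_bound[where B=B])
    show "AE x in \<nu>. norm (indicator E x * h x) \<le> B"
      using B order_trans[OF abs_ge_zero B] by (auto split: split_indicator)
  qed (use hm E' in auto)
  have "AE x in \<nu>. indicator E x * h x = 0"
    using le0 nn i by (subst integral_nonneg_eq_0_iff_AE[symmetric]) (auto intro!: antisym)
  then show ?thesis by eventually_elim (auto simp: E_def split: split_indicator_asm)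
qed

lemma harmonic_zero:
  assumes inv: "inv_meas \<nu>" and h: "harmonic \<nu> h"
    and eq: "\<And>\<mu>. inv_meas \<mu> \<Longrightarrow> absolutely_continuous \<nu> \<mu> \<Longrightarrow> (\<integral>x. h x \<partial>\<mu>) = 0"
  shows "AE x in \<nu>. h x = 0"
proof -
  have "AE x in \<nu>. h x \<le> 0" by (rule harmonic_nonpos[OF inv h]) (simp add: eq)
  moreover have "AE x in \<nu>. 0 - h x \<le> 0"
    by (rule harmonic_nonpos[OF inv harmonic_diff[OF harmonic_const h]]) (simp add: eq)
  ultimately show ?thesis by eventually_elim simp
qed

text \<open>The square is subharmonic by Jensen. It serves to compute a variance that shows ergodic
  limits to be constant under the conditional laws.\<close>

lemma harmonic_square:
  assumes inv: "inv_meas \<nu>" and h: "harmonic \<nu> h"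
  shows "harmonic \<nu> (\<lambda>x. (h x)\<^sup>2)"
proof -
  obtain B where B: "\<And>x. \<bar>h x\<bar> \<le> B" using harmonicD(3)[OF h] by metis
  have b: "\<bar>(h x)\<^sup>2\<bar> \<le> B\<^sup>2" for x using power_mono[OF B[of x], of 2] by simp
  note [measurable] = harmonicD(1)[OF h]
  show ?thesis
  proof (rule harmonicI_sub[OF inv _ b])
    show "AE x in \<nu>. (h x)\<^sup>2 \<le> kint K (\<lambda>x. (h x)\<^sup>2) x"
      using harmonicD(2)[OF h]
    proof eventually_elim
      case (elim x)
      then show ?case using kint_square_le[OF harmonicD(1)[OF h] B, of x] by simp
    qed
  qed measurable
qed

lemma AE_kernel:
  assumes inv: "inv_meas \<mu>" and "AE y in \<mu>. R y"
  shows "AE x in \<mu>. AE y in K x. R y"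
proof -
  note m = inv_measD[OF inv]
  obtain Z where Z: "{x \<in> space \<mu>. \<not> R x} \<subseteq> Z" "emeasure \<mu> Z = 0" "Z \<in> sets \<mu>"
    using assms(2) by (rule AE_E)
  have ZN: "Z \<in> sets N" using Z m by simp
  have "(\<integral>\<^sup>+x. emeasure (K x) Z \<partial>\<mu>) = 0" using m(4)[OF ZN] Z by simp
  moreover have "(\<lambda>x. emeasure (K x) Z) \<in> borel_measurable \<mu>"
    using measurable_emeasure_kernel[OF kernel_subprob ZN] m(1) by (simp cong: measurable_cong_sets)
  ultimately have "AE x in \<mu>. emeasure (K x) Z = 0" by (simp add: nn_integral_0_iff_AE)
  then show ?thesis
  proof eventually_elim
    case (elim x)
    then have "AE y in K x. y \<notin> Z" using ZN by (intro AE_not_in) (auto simp: null_sets_def)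
    then show ?case by eventually_elim (use Z m in auto)
  qed
qed

lemma AE_of_AE_kernel:
  assumes inv: "inv_meas \<mu>" and Z: "{x. R x} \<in> sets N" and "AE x in \<mu>. AE y in K x. R y"
  shows "AE y in \<mu>. R y"
proof -
  note m = inv_measD[OF inv]
  have Z': "{x. \<not> R x} \<in> sets N"
    using sets.compl_sets[OF Z] by (simp add: space_UNIV Compl_eq_Diff_UNIV[symmetric] Collect_neg_eq)
  have "emeasure \<mu> {x. \<not> R x} = (\<integral>\<^sup>+x. 0 \<partial>\<mu>)"
    unfolding m(4)[OF Z']
  proof (rule nn_integral_cong_AE)
    show "AE x in \<mu>. emeasure (K x) {x. \<not> R x} = 0"
      using assms(3) by eventually_elim (subst (asm) AE_iff_measurable[OF _ refl], use Z' in auto)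
  qed
  then show ?thesis using Z' m by (subst AE_iff_measurable[OF _ refl]) auto
qed

end

section \<open>Ergodic decomposition\<close>

text \<open>Testing on countably many half-lines lets almost sure identities, one for each rational,
  be united into a single null set.\<close>

lemma borel_measure_eqI_rat:
  fixes M1 M2 :: "real measure"
  assumes s: "sets M1 = sets borel" "sets M2 = sets borel" and fin: "finite_measure M1"
    and eq: "\<And>q::rat. emeasure M1 {..of_rat q} = emeasure M2 {..of_rat q}"
  shows "M1 = M2"
proof (rule measure_eqI_generator_eq)
  let ?E = "range (\<lambda>q::rat. {..of_rat q :: real})"
  have "sigma_sets UNIV (range (\<lambda>r::real. {..r})) = sigma_sets UNIV ?E"
  proof (rule sigma_sets_eqI)
    fix A assume "A \<in> range (\<lambda>r::real. {..r})"
    then obtain r where A: "A = {..r}" by auto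
    have "{..r} = (\<Inter>q\<in>{q::rat. r < of_rat q}. {..of_rat q})"
    proof (intro set_eqI iffI)
      fix x assume x: "x \<in> (\<Inter>q\<in>{q::rat. r < of_rat q}. {..of_rat q :: real})"
      show "x \<in> {..r}"
      proof (rule ccontr)
        assume "x \<notin> {..r}"
        then obtain q where "r < of_rat q" "of_rat q < x" using of_rat_dense[of r x] by auto
        then show False using x by force
      qed
    qed auto
    also have "\<dots> \<in> sets (sigma UNIV ?E)"
    proof (rule sets.countable_INT'')
      obtain q where "r < of_rat q" using of_rat_dense[of r "r + 1"] by auto
      show "UNIV \<in> sets (sigma UNIV ?E)" using sets.top[of "sigma UNIV ?E"] by simp
    qed (auto intro: sigma_sets.Basic)
    also have "sets (sigma UNIV ?E) = sigma_sets UNIV ?E"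
      by (rule sets_measure_of) auto
    finally show "A \<in> sigma_sets UNIV ?E" by (simp add: A)
  next
    fix A assume "A \<in> ?E"
    then show "A \<in> sigma_sets UNIV (range (\<lambda>r::real. {..r}))" by (auto intro: sigma_sets.Basic)
  qed
  then have b: "sets borel = sigma_sets UNIV ?E"
    by (subst borel_eq_atMost) simp
  then show "sets M1 = sigma_sets UNIV ?E" "sets M2 = sigma_sets UNIV ?E"
    using s by auto
  show "Int_stable ?E"
  proof (intro Int_stableI)
    fix a b assume "a \<in> ?E" "b \<in> ?E"
    then obtain p q where "a = {..of_rat p}" "b = {..of_rat q}" by auto
    then have "a \<inter> b = {..of_rat (min p q)}" by (auto simp: min_def of_rat_less_eq split: if_splits)
    then show "a \<inter> b \<in> ?E" by blast
  qed
  show "range (\<lambda>i::nat. {..of_rat (of_nat i) :: real}) \<subseteq> ?E" by blast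
  show "(\<Union>i::nat. {..of_rat (of_nat i) :: real}) = UNIV"
    using real_arch_simple by auto
  show "emeasure M1 {..of_rat (of_nat i)} \<noteq> \<infinity>" for i :: nat
    using finite_measure.emeasure_finite[OF fin] by simp
qed (use eq in auto)

context markov_kernel
begin

lemma harmonic_cong:
  assumes inv: "inv_meas \<nu>" and h: "harmonic \<nu> h"
    and h': "h' \<in> borel_measurable N" "\<And>x. \<bar>h' x\<bar> \<le> B" "AE x in \<nu>. h' x = h x"
  shows "harmonic \<nu> h'"
proof (rule harmonicI[OF h'(1,2)])
  have m: "h \<in> borel_measurable (K x)" "h' \<in> borel_measurable (K x)" for x
    using harmonicD(1)[OF h] h'(1) by (simp_all cong: measurable_cong_sets)
  show "AE x in \<nu>. kint K h' x = h' x"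
    using AE_kernel[OF inv h'(3)] h'(3) harmonicD(2)[OF h]
  proof eventually_elim
    case (elim x)
    then have "kint K h' x = kint K h x"
      unfolding kint_def using m by (intro integral_cong_AE) auto
    then show ?case using elim by simp
  qed
qed

lemma harmonic_limit:
  assumes h: "\<And>n. harmonic \<nu> (h n)" and b: "\<And>n x. \<bar>h n x\<bar> \<le> B"
    and lim: "\<And>x. (\<lambda>n. h n x) \<longlonglongrightarrow> g x"
  shows "harmonic \<nu> g"
proof (rule harmonicI)
  show m: "g \<in> borel_measurable N"
    by (rule borel_measurable_LIMSEQ_real[of N h]) (use lim harmonicD(1)[OF h] in auto)
  show "\<bar>g x\<bar> \<le> B" for x
    by (rule LIMSEQ_le_const2[OF tendsto_rabs[OF lim]]) (use b in blast)
  have "AE x in \<nu>. \<forall>n. kint K (h n) x = h n x"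
    unfolding AE_all_countable using h harmonicD(2) by blast
  then show "AE x in \<nu>. kint K g x = g x"
  proof eventually_elim
    case (elim x)
    interpret prob_space "K x" by (rule prob_space_kernel)
    have "(\<lambda>n. kint K (h n) x) \<longlonglongrightarrow> kint K g x"
      unfolding kint_def
    proof (rule integral_dominated_convergence[where w="\<lambda>_. B"])
      show "g \<in> borel_measurable (K x)" "h n \<in> borel_measurable (K x)" for n
        using m harmonicD(1)[OF h] by (simp_all cong: measurable_cong_sets)
    qed (use lim b in auto)
    then show ?case using lim[of x] elim by (simp add: LIMSEQ_unique)
  qed
qed

end

text \<open>A code with a measurable left inverse plays the part of a standard Borel structure:
  measures on the space can be built and compared through distribution functions on
  \<open>[0,1]\<close>.\<close>

locale coded_kernel = markov_kernel N K
  for N :: "'a measure" and K +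
  fixes \<phi> :: "'a \<Rightarrow> real" and \<psi> :: "real \<Rightarrow> 'a"
  assumes \<phi>_measurable [measurable]: "\<phi> \<in> borel_measurable N"
    and \<psi>_measurable [measurable]: "\<psi> \<in> borel \<rightarrow>\<^sub>M N"
    and \<psi>_\<phi>: "\<psi> (\<phi> x) = x"
    and \<phi>_ge: "0 \<le> \<phi> x" and \<phi>_le: "\<phi> x \<le> 1"
begin

abbreviation "cell q \<equiv> {x. \<phi> x \<le> of_rat q}"

lemma cell_measurable [measurable]: "{x. \<phi> x \<le> r} \<in> sets N"
  using measurable_sets[OF \<phi>_measurable, of "{..r}"] by (simp add: vimage_def space_UNIV)

lemma measure_eqI_cells:
  assumes "sets M1 = sets N" "sets M2 = sets N" "finite_measure M1"
    and eq: "\<And>q::rat. emeasure M1 (cell q) = emeasure M2 (cell q)"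
  shows "M1 = M2"
proof -
  have m: "\<phi> \<in> borel_measurable M1" "\<phi> \<in> borel_measurable M2"
    using assms by (simp_all cong: measurable_cong_sets)
  have "distr M1 borel \<phi> = distr M2 borel \<phi>"
  proof (rule borel_measure_eqI_rat)
    show "finite_measure (distr M1 borel \<phi>)" using assms m by (intro finite_measure.finite_measure_distr)
    have sp: "space M1 = UNIV" "space M2 = UNIV"
      using assms sets_eq_imp_space_eq space_UNIV by metis+
    show "emeasure (distr M1 borel \<phi>) {..of_rat q} = emeasure (distr M2 borel \<phi>) {..of_rat q}" for q
      using eq[of q] m by (simp add: emeasure_distr vimage_def sp)
  qed auto
  then have "distr (distr M1 borel \<phi>) N \<psi> = distr (distr M2 borel \<phi>) N \<psi>" by simp
  then have "distr M1 N (\<lambda>x. x) = distr M2 N (\<lambda>x. x)"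
    using m by (simp add: distr_distr comp_def \<psi>_\<phi>)
  then show ?thesis
    using assms by (simp add: distr_id2)
qed

text \<open>The conditional law given the invariant \<open>\<sigma>\<close>-algebra is built from the distribution functions
  of the code \<open>\<phi>\<close>, which are monotone limits of harmonic functions.\<close>

theorem ergodic_decomposition:
  assumes inv: "inv_meas \<nu>" and prob: "prob_space \<nu>"
  obtains Q where "Q \<in> N \<rightarrow>\<^sub>M prob_algebra N"
    "\<And>\<mu>. inv_meas \<mu> \<Longrightarrow> absolutely_continuous \<nu> \<mu> \<Longrightarrow> invariant_under N Q \<mu>"
    "AE x in \<nu>. inv_meas (Q x)"
    "AE x in \<nu>. \<forall>\<mu>. prob_space \<mu> \<and> inv_meas \<mu> \<and> absolutely_continuous (Q x) \<mu> \<longrightarrow> \<mu> = Q x"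
proof -
  interpret prob_space \<nu> by fact
  note m = inv_measD[OF inv]
  have ac_refl: "absolutely_continuous \<nu> \<nu>" by (simp add: absolutely_continuous_def)
  have AE_ac: "AE x in \<mu>. P x" if "absolutely_continuous \<nu> \<mu>" "inv_meas \<mu>" "AE x in \<nu>. P x" for \<mu> P
    using absolutely_continuous_AE[OF _ that(1,3)] inv_measD(1)[OF that(2)] m(1) by simp
  define f where "f q = indicat_real (cell q)" for q
  have f: "f q \<in> borel_measurable N" "0 \<le> f q x" "f q x \<le> 1" "\<bar>f q x\<bar> \<le> 1" for q x
    unfolding f_def by (auto split: split_indicator intro!: borel_measurable_indicator)
  define P where "P q c g \<longleftrightarrow> (\<forall>j. c j \<in> borel_measurable N) \<and> (\<forall>j x. 0 \<le> c j x) \<and> (\<forall>j x. c j x \<le> 1) \<and>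
    g \<in> borel_measurable N \<and> (\<forall>x. 0 \<le> g x) \<and> (\<forall>x. g x \<le> 1) \<and>
    (AE x in \<nu>. (\<lambda>j. c j x) \<longlonglongrightarrow> g x) \<and>
    (\<forall>\<mu> j. inv_meas \<mu> \<longrightarrow> (\<integral>x. c j x \<partial>\<mu>) = (\<integral>x. f q x \<partial>\<mu>)) \<and>
    (AE x in \<nu>. kint K g x = g x)" for q :: rat and c :: "nat \<Rightarrow> 'a \<Rightarrow> real" and g
  have "\<exists>c g. P q c g" for q
    unfolding P_def by (rule mean_ergodic[OF inv prob f(1-3)[of q]]) blast
  then obtain c g where P: "\<And>q. P q (c q) (g q)" by metis
  have c: "c q j \<in> borel_measurable N" "0 \<le> c q j x" "c q j x \<le> 1"
    and g: "g q \<in> borel_measurable N" "0 \<le> g q x" "g q x \<le> 1" for q j x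
    using P[of q] unfolding P_def by auto
  have cg: "AE x in \<nu>. (\<lambda>j. c q j x) \<longlonglongrightarrow> g q x"
    and cf: "\<And>\<mu> j. inv_meas \<mu> \<Longrightarrow> (\<integral>x. c q j x \<partial>\<mu>) = (\<integral>x. f q x \<partial>\<mu>)"
    and gK: "AE x in \<nu>. kint K (g q) x = g q x" for q
    using P[of q] unfolding P_def by auto
  have g_abs: "\<bar>g q x\<bar> \<le> 1" "\<bar>c q j x\<bar> \<le> 1" for q j x
    using g(2,3)[of q x] c(2,3)[of q j x] by auto
  have hg: "harmonic \<nu> (g q)" for q
    by (rule harmonicI[OF g(1) g_abs(1) gK])
  have gf_lim: "(\<integral>x. f q x \<partial>\<mu>) = (\<integral>x. h x \<partial>\<mu>)"
    if "inv_meas \<mu>" "AE x in \<mu>. (\<lambda>j. c q j x) \<longlonglongrightarrow> h x" "h \<in> borel_measurable N" for q \<mu> h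
  proof -
    interpret \<mu>: finite_measure \<mu> using inv_measD that by auto
    have mm: "c q j \<in> borel_measurable \<mu>" "h \<in> borel_measurable \<mu>" for j
      using c(1) that inv_measD(1)[OF that(1)] by (simp_all cong: measurable_cong_sets)
    have "(\<lambda>j. \<integral>x. c q j x \<partial>\<mu>) \<longlonglongrightarrow> (\<integral>x. h x \<partial>\<mu>)"
      by (rule integral_dominated_convergence[where w="\<lambda>_. 1"]) (use mm that g_abs in auto)
    then show ?thesis using that by (simp add: cf LIMSEQ_const_iff)
  qed
  have gf: "(\<integral>x. f q x \<partial>\<mu>) = (\<integral>x. g q x \<partial>\<mu>)"
    if "inv_meas \<mu>" "absolutely_continuous \<nu> \<mu>" for q \<mu>
    by (rule gf_lim[OF that(1) AE_ac[OF that(2,1) cg] g(1)])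
  have int: "integrable \<mu> (f q)" "integrable \<mu> (g q)" if "inv_meas \<mu>" for \<mu> q
    by (rule integrable_inv[OF that f(1) f(4)] integrable_inv[OF that g(1) g_abs(1)])+
  \<comment> \<open>The limits \<open>g q\<close> are only determined up to null sets. Each order
    relation among the indicators \<open>f q\<close> passes to integrals against all test measures,
    hence to the harmonic limits almost surely.\<close>
  have mono: "AE x in \<nu>. \<forall>q q'. q \<le> q' \<longrightarrow> g q x \<le> g q' x"
  proof -
    have "AE x in \<nu>. q \<le> q' \<longrightarrow> g q x - g q' x \<le> 0" for q q'
    proof (cases "q \<le> q'")
      case True
      have "AE x in \<nu>. g q x - g q' x \<le> 0"
      proof (rule harmonic_nonpos[OF inv harmonic_diff[OF hg hg]])
        fix \<mu> assume \<mu>: "inv_meas \<mu>" "absolutely_continuous \<nu> \<mu>"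
        have "(\<integral>x. f q x \<partial>\<mu>) \<le> (\<integral>x. f q' x \<partial>\<mu>)"
        proof (rule integral_mono[OF int(1) int(1)])
          have "(of_rat q :: real) \<le> of_rat q'" using True by (simp add: of_rat_less_eq)
          then show "f q x \<le> f q' x" for x
            by (auto simp: f_def split: split_indicator)
        qed (rule \<mu>)+
        then show "(\<integral>x. g q x - g q' x \<partial>\<mu>) \<le> 0" using int[OF \<mu>(1)] by (simp add: gf[OF \<mu>])
      qed
      then show ?thesis by eventually_elim simp
    qed simp
    then have "AE x in \<nu>. \<forall>q q'. q \<le> q' \<longrightarrow> g q x - g q' x \<le> 0"
      by (simp add: AE_all_countable)
    then show ?thesis by eventually_elim auto
  qed
  have lo: "AE x in \<nu>. \<forall>q. q < 0 \<longrightarrow> g q x = 0"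
  proof -
    have "AE x in \<nu>. q < 0 \<longrightarrow> g q x = 0" for q
    proof (cases "q < 0")
      case True
      then have "\<not> \<phi> x \<le> of_rat q" for x
        using \<phi>_ge[of x] of_rat_less_0_iff[of q, where 'a=real] by linarith
      then have "f q = (\<lambda>_. 0)" by (auto simp: f_def fun_eq_iff)
      then have "AE x in \<nu>. g q x = 0"
        using gf[of _ q] by (intro harmonic_zero[OF inv hg]) simp
      then show ?thesis by eventually_elim simp
    qed simp
    then show ?thesis by (simp add: AE_all_countable)
  qed
  have hi: "AE x in \<nu>. \<forall>q. 1 \<le> q \<longrightarrow> g q x = 1"
  proof -
    have "AE x in \<nu>. 1 \<le> q \<longrightarrow> g q x = 1" for q
    proof (cases "1 \<le> q")
      case True
      then have "\<phi> x \<le> of_rat q" for x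
        using \<phi>_le[of x] one_le_of_rat_iff[of q, where 'a=real] by linarith
      then have f1: "f q = (\<lambda>_. 1)" by (auto simp: f_def fun_eq_iff)
      have "AE x in \<nu>. g q x - 1 = 0"
      proof (rule harmonic_zero[OF inv harmonic_diff[OF hg harmonic_const]])
        fix \<mu> assume \<mu>: "inv_meas \<mu>" "absolutely_continuous \<nu> \<mu>"
        interpret \<mu>: finite_measure \<mu> using inv_measD \<mu> by auto
        show "(\<integral>x. g q x - 1 \<partial>\<mu>) = 0" using gf[OF \<mu>, of q] int[OF \<mu>(1), of q] by (simp add: f1)
      qed
      then show ?thesis by eventually_elim simp
    qed simp
    then show ?thesis by (simp add: AE_all_countable)
  qed
  define good where "good x \<longleftrightarrow> (\<forall>q q'. q \<le> q' \<longrightarrow> g q x \<le> g q' x) \<and>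
     (\<forall>q. q < 0 \<longrightarrow> g q x = 0) \<and> (\<forall>q. 1 \<le> q \<longrightarrow> g q x = 1)" for x
  have good_AE: "AE x in \<nu>. good x"
    using mono lo hi by eventually_elim (auto simp: good_def)
  have good_m: "Measurable.pred N good"
    unfolding good_def using g(1) by measurable
  \<comment> \<open>Off the good set the values are those of the point mass at 0, so that every
    point carries a genuine distribution function.\<close>
  define G where "G q x = (if good x then g q x else of_bool (0 \<le> q))" for q x
  have G: "G q \<in> borel_measurable N" for q
    unfolding G_def using g(1) good_m by measurable
  have G_mono: "q \<le> q' \<Longrightarrow> G q x \<le> G q' x" for q q' x
    by (auto simp: G_def good_def)
  have G_lo: "q < 0 \<Longrightarrow> G q x = 0" and G_hi: "1 \<le> q \<Longrightarrow> G q x = 1" for q x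
    by (auto simp: G_def good_def)
  have G01: "0 \<le> G q x" "G q x \<le> 1" "\<bar>G q x\<bar> \<le> 1" for q x
    using g(2,3)[of q x] by (auto simp: G_def)
  have Gg: "AE x in \<nu>. G q x = g q x" for q
    using good_AE by eventually_elim (simp add: G_def)
  have hG: "harmonic \<nu> (G q)" for q
    by (rule harmonic_cong[OF inv hg G G01(3) Gg])
  \<comment> \<open>Limits from the right turn a monotone function on the rationals into a
    right-continuous one on the reals.\<close>
  define F where "F x r = (INF q\<in>{q::rat. r < of_rat q}. G q x)" for x and r :: real
  have bb: "bdd_below ((\<lambda>q. G q x) ` A)" for x A
    using G01 by (auto intro!: bdd_belowI[where m=0])
  have ne: "{q::rat. r < of_rat q} \<noteq> {}" for r :: real
    using of_rat_dense[of r "r + 1"] by auto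
  have F_le: "F x r \<le> G q x" if "r < of_rat q" for x r q
    unfolding F_def using that by (intro cINF_lower bb) auto
  have F_ge: "y \<le> F x r" if "\<And>q. r < of_rat q \<Longrightarrow> y \<le> G q x" for x r y
    unfolding F_def using that by (intro cINF_greatest ne) auto
  have F_less: "\<exists>q. r < of_rat q \<and> G q x < y" if "F x r < y" for x r y
    using that F_ge[of r y x] by (meson not_le)
  have F01: "0 \<le> F x r" "F x r \<le> 1" for x r
  proof -
    show "0 \<le> F x r" using G01 by (intro F_ge)
    obtain q where "r < of_rat q" using ne by auto
    then show "F x r \<le> 1" using F_le G01(2) order_trans by blast
  qed
  have F_mono: "F x r \<le> F x s" if "r \<le> s" for x r s
    using that by (intro F_ge F_le) linarith
  have F_lo: "F x r = 0" if r0: "r < 0" for x r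
  proof -
    obtain q where "r < of_rat q" "of_rat q < (0::real)" using of_rat_dense[OF r0] by auto
    then show ?thesis using F_le[of r q x] F01[of x r] G_lo[of q x] by simp
  qed
  have F_hi: "F x r = 1" if "1 \<le> r" for x r
  proof (intro antisym F01 F_ge)
    fix q :: rat assume "r < of_rat q"
    then have "1 \<le> (of_rat q :: real)" using that by linarith
    then show "1 \<le> G q x" by (simp add: G_hi)
  qed
  have F_rc: "continuous (at_right a) (F x)" for x a
  proof (subst continuous_at_right_real_increasing[OF F_mono], assumption, intro allI impI)
    fix e :: real assume "e > 0"
    then obtain q where q: "a < of_rat q" "G q x < F x a + e" using F_less[of x a "F x a + e"] by auto
    obtain d where d: "a < a + d" "a + d < of_rat q" using dense[OF q(1)] by (metis add_diff_cancel_left' add.commute diff_add_cancel)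
    show "\<exists>d>0. F x (a + d) - F x a < e"
      using F_le[OF d(2), of x] q d by (intro exI[of _ d]) auto
  qed
  have F_bot: "(F x \<longlongrightarrow> 0) at_bot" for x
    by (rule tendsto_eventually) (use F_lo eventually_at_bot_dense in blast)
  have F_top: "(F x \<longlongrightarrow> 1) at_top" for x
    by (rule tendsto_eventually) (use F_hi eventually_at_top_linorder in blast)
  \<comment> \<open>A sequence of rationals decreasing to \<open>r\<close> exhibits
    \<open>F x r\<close> as a sequential limit of harmonic functions, to which dominated convergence
    applies.\<close>
  have "\<exists>s. \<forall>n. r < of_rat (s n) \<and> of_rat (s n) < r + 1 / real (Suc n)" for r :: real
    by (intro choice allI) (use of_rat_dense[of r] in auto)
  then obtain s where s: "\<And>r n. r < of_rat (s r n)" "\<And>(r::real) n. of_rat (s r n) < r + 1 / real (Suc n)"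
    by metis
  have s_lim: "(\<lambda>n. of_rat (s r n)) \<longlonglongrightarrow> r" for r
  proof (rule tendsto_sandwich)
    show "\<forall>\<^sub>F n in sequentially. r \<le> of_rat (s r n)" by (intro always_eventually allI less_imp_le s)
    show "\<forall>\<^sub>F n in sequentially. of_rat (s r n) \<le> r + 1 / real (Suc n)" by (intro always_eventually allI less_imp_le s)
    show "(\<lambda>n. r + 1 / real (Suc n)) \<longlonglongrightarrow> r"
      using LIMSEQ_inverse_real_of_nat_add[of r] by (simp add: inverse_eq_divide)
  qed simp
  have s_ev: "\<forall>\<^sub>F n in sequentially. of_rat (s r n) < t" if "r < t" for r t :: real
    using order_tendstoD(2)[OF s_lim that] .
  have F_lim: "(\<lambda>n. G (s r n) x) \<longlonglongrightarrow> F x r" for r x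
  proof (rule order_tendstoI)
    show "\<forall>\<^sub>F n in sequentially. a < G (s r n) x" if "a < F x r" for a
      by (intro always_eventually allI less_le_trans[OF that F_le[OF s(1)]])
    fix a assume "F x r < a"
    then obtain q where q: "r < of_rat q" "G q x < a" using F_less by blast
    show "\<forall>\<^sub>F n in sequentially. G (s r n) x < a"
      using s_ev[OF q(1)]
    proof eventually_elim
      case (elim n)
      then have "s r n \<le> q" by (simp add: of_rat_less)
      then show ?case using G_mono[of "s r n" q x] q by simp
    qed
  qed
  have hF: "harmonic \<nu> (\<lambda>x. F x r)" for r
    by (rule harmonic_limit[OF hG G01(3) F_lim])
  have Fm: "(\<lambda>x. F x r) \<in> borel_measurable N" for r
    by (rule harmonicD(1)[OF hF])
  define R where "R x = interval_measure (F x)" for x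
  have R_prob: "prob_space (R x)" for x
    unfolding R_def
    using real_distribution_interval_measure[OF F_mono F_rc F_bot F_top] by (simp add: real_distribution_def)
  have R_sets[simp]: "sets (R x) = sets borel" for x by (simp add: R_def)
  have R_F: "emeasure (R x) {..r} = ennreal (F x r)" for x r
    unfolding R_def by (rule emeasure_interval_measure_Iic[OF F_mono F_rc F_bot])
  have R_m: "R \<in> N \<rightarrow>\<^sub>M prob_algebra borel"
  proof (rule measurable_prob_algebra_generated)
    show "sets borel = sigma_sets UNIV (range (\<lambda>r::real. {..r}))"
      by (subst borel_eq_atMost) simp
    show "Int_stable (range (\<lambda>r::real. {..r}))" by (auto simp: Int_stable_def)
    show "(\<lambda>a. emeasure (R a) A) \<in> borel_measurable N" if "A \<in> range (\<lambda>r::real. {..r})" for A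
      using that Fm by (auto simp: R_F)
  qed (use R_prob in auto)
  then have R_m'[measurable]: "R \<in> N \<rightarrow>\<^sub>M subprob_algebra borel" by (rule measurable_prob_algebraD)
  define Q where "Q x = distr (R x) N \<psi>" for x
  have Q_m: "Q \<in> N \<rightarrow>\<^sub>M prob_algebra N"
    unfolding Q_def using R_m by measurable
  interpret Q: markov_kernel N Q
    by standard (use space_UNIV Q_m in auto)
  have distr_bind_Q: "\<mu> \<bind> Q = distr (\<mu> \<bind> R) N \<psi>" if "sets \<mu> = sets N" for \<mu>
  proof -
    have "space \<mu> \<noteq> {}" using sets_eq_imp_space_eq[OF that] space_UNIV by simp
    moreover have "R \<in> \<mu> \<rightarrow>\<^sub>M subprob_algebra borel" using R_m' that by (simp cong: measurable_cong_sets)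
    ultimately show ?thesis unfolding Q_def by (subst distr_bind) auto
  qed
  have bind_R: "emeasure (\<mu> \<bind> R) A = (\<integral>\<^sup>+x. emeasure (R x) A \<partial>\<mu>)" "sets (\<mu> \<bind> R) = sets borel"
    if "sets \<mu> = sets N" "A \<in> sets borel" for \<mu> A
  proof -
    have "space \<mu> \<noteq> {}" using sets_eq_imp_space_eq[OF that(1)] space_UNIV by simp
    moreover have "R \<in> \<mu> \<rightarrow>\<^sub>M subprob_algebra borel" using R_m' that by (simp cong: measurable_cong_sets)
    ultimately show "emeasure (\<mu> \<bind> R) A = (\<integral>\<^sup>+x. emeasure (R x) A \<partial>\<mu>)" "sets (\<mu> \<bind> R) = sets borel"
      using that by (auto intro!: emeasure_bind sets_bind[where N=borel])
  qed
  \<comment> \<open>The code has the same distribution function under \<mu> and under the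
    \<mu>-mixture of the \<open>R x\<close>: the two agree for \<open>G\<close> by construction and
    the limit from the right preserves this. Decoding gives invariance under
    \<open>Q\<close>.\<close>
  have S1: "Q.inv_meas \<mu>" if \<mu>: "inv_meas \<mu>" "absolutely_continuous \<nu> \<mu>" for \<mu>
  proof -
    note mm = inv_measD[OF \<mu>(1)]
    interpret \<mu>: finite_measure \<mu> by fact
    have \<phi>m: "\<phi> \<in> borel_measurable \<mu>" using mm by (simp cong: measurable_cong_sets)
    have "distr \<mu> borel \<phi> = \<mu> \<bind> R"
    proof (rule borel_measure_eqI_rat)
      show "finite_measure (distr \<mu> borel \<phi>)" using \<phi>m by (rule \<mu>.finite_measure_distr)
      show "sets (\<mu> \<bind> R) = sets borel" by (rule bind_R(2)[of _ UNIV]) (use mm in auto)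
      fix q :: rat
      let ?r = "of_rat q :: real"
      have Fm': "(\<lambda>x. F x ?r) \<in> borel_measurable \<mu>" "\<And>q. G q \<in> borel_measurable \<mu>"
        "\<And>q. f q \<in> borel_measurable \<mu>" "cell q \<in> sets \<mu>"
        using Fm G mm f by (simp_all cong: measurable_cong_sets)
      have "(\<lambda>n. \<integral>x. G (s ?r n) x \<partial>\<mu>) \<longlonglongrightarrow> (\<integral>x. F x ?r \<partial>\<mu>)"
        by (rule integral_dominated_convergence[where w="\<lambda>_. 1"]) (use Fm' F_lim G01 in auto)
      moreover have "(\<integral>x. G q x \<partial>\<mu>) = (\<integral>x. f q x \<partial>\<mu>)" for q
        unfolding gf[OF \<mu>] using AE_ac[OF \<mu>(2,1) Gg] Fm' g(1) mm
        by (intro integral_cong_AE) (simp_all cong: measurable_cong_sets)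
      moreover have "(\<lambda>n. \<integral>x. f (s ?r n) x \<partial>\<mu>) \<longlonglongrightarrow> (\<integral>x. f q x \<partial>\<mu>)"
      proof (rule integral_dominated_convergence[where w="\<lambda>_. 1"])
        show "AE x in \<mu>. (\<lambda>n. f (s ?r n) x) \<longlonglongrightarrow> f q x"
        proof (intro AE_I2)
          fix x
          have "\<forall>\<^sub>F n in sequentially. f (s ?r n) x = f q x"
          proof (cases "\<phi> x \<le> ?r")
            case True
            then have "\<phi> x \<le> of_rat (s ?r n)" for n using s(1)[of ?r n] by linarith
            then show ?thesis using True by (simp add: f_def)
          next
            case False
            then have "\<forall>\<^sub>F n in sequentially. of_rat (s ?r n) < \<phi> x" by (intro s_ev) simp
            then show ?thesis by eventually_elim (use False in \<open>simp add: f_def\<close>)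
          qed
          then show "(\<lambda>n. f (s ?r n) x) \<longlonglongrightarrow> f q x" by (rule tendsto_eventually)
        qed
      qed (use Fm' f in auto)
      ultimately have "(\<integral>x. F x ?r \<partial>\<mu>) = (\<integral>x. f q x \<partial>\<mu>)"
        using LIMSEQ_unique by simp
      then have "(\<integral>x. F x ?r \<partial>\<mu>) = measure \<mu> (cell q)"
        using Fm' by (simp add: f_def)
      moreover have "(\<integral>\<^sup>+x. ennreal (F x ?r) \<partial>\<mu>) = ennreal (\<integral>x. F x ?r \<partial>\<mu>)"
        using F01 Fm' by (intro nn_integral_eq_integral \<mu>.integrable_const_bound[where B=1]) auto
      ultimately show "emeasure (distr \<mu> borel \<phi>) {..?r} = emeasure (\<mu> \<bind> R) {..?r}"
        using \<phi>m mm by (simp add: bind_R R_F emeasure_distr \<mu>.emeasure_eq_measure vimage_def)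
    qed simp
    then have "\<mu> \<bind> Q = distr (distr \<mu> borel \<phi>) N \<psi>" using distr_bind_Q mm by simp
    also have "\<dots> = distr \<mu> N (\<lambda>x. x)" using \<phi>m by (simp add: distr_distr comp_def \<psi>_\<phi>)
    also have "\<dots> = \<mu>" using mm by (simp add: distr_id2)
    finally have bq: "\<mu> \<bind> Q = \<mu>" .
    have "emeasure \<mu> B = (\<integral>\<^sup>+x. emeasure (Q x) B \<partial>\<mu>)" if "B \<in> sets N" for B
    proof -
      have "Q \<in> \<mu> \<rightarrow>\<^sub>M subprob_algebra N" using Q.kernel_subprob mm by (simp cong: measurable_cong_sets)
      then have "emeasure (\<mu> \<bind> Q) B = (\<integral>\<^sup>+x. emeasure (Q x) B \<partial>\<mu>)"
        using mm that by (intro emeasure_bind) auto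
      then show ?thesis using bq by simp
    qed
    then show ?thesis using mm by (simp add: invariant_under_def)
  qed
  \<comment> \<open>Harmonicity of the distribution functions at all rationals, restated for the
    measures: one step of the dynamics does not change the conditional law.\<close>
  have KQ: "AE x in \<nu>. K x \<bind> Q = Q x"
  proof -
    have "AE x in \<nu>. \<forall>q. kint K (\<lambda>x. F x (of_rat q)) x = F x (of_rat q)"
      using harmonicD(2)[OF hF] by (simp add: AE_all_countable)
    then show ?thesis
    proof eventually_elim
      case (elim x)
      have "K x \<bind> R = R x"
      proof (rule borel_measure_eqI_rat)
        interpret Kx: prob_space "K x" by (rule prob_space_kernel)
        have Fk: "(\<lambda>x. F x r) \<in> borel_measurable (K x)" for r
          using Fm by (simp cong: measurable_cong_sets)
        show "sets (K x \<bind> R) = sets borel" by (rule bind_R(2)[of _ UNIV]) auto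
        have Rk: "R \<in> K x \<rightarrow>\<^sub>M prob_algebra borel" using R_m by (simp cong: measurable_cong_sets)
        have "prob_space (K x \<bind> R)"
          by (rule Kx.prob_space_bind[OF _ measurable_prob_algebraD[OF Rk]]) (simp add: R_prob)
        then show "finite_measure (K x \<bind> R)" by (simp add: prob_space_def)
        fix q :: rat
        have "emeasure (K x \<bind> R) {..of_rat q} = (\<integral>\<^sup>+y. ennreal (F y (of_rat q)) \<partial>K x)"
          by (simp add: bind_R R_F)
        also have "\<dots> = ennreal (kint K (\<lambda>x. F x (of_rat q)) x)"
          unfolding kint_def using F01 Fk by (intro nn_integral_eq_integral Kx.integrable_const_bound[where B=1]) auto
        finally show "emeasure (K x \<bind> R) {..of_rat q} = emeasure (R x) {..of_rat q}"
          using elim by (simp add: R_F)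
      qed simp
      then show ?case using distr_bind_Q[of "K x"] by (simp add: Q_def)
    qed
  qed
  have hQ: "harmonic \<nu> (kint Q h)" if h: "h \<in> borel_measurable N" "\<And>x. 0 \<le> h x" "\<And>x. h x \<le> 1" for h
  proof (rule harmonicI)
    have b: "\<bar>h x\<bar> \<le> 1" for x using h(2,3)[of x] by simp
    show "kint Q h \<in> borel_measurable N" by (rule Q.kint_measurable[OF h(1)])
    show "\<bar>kint Q h x\<bar> \<le> 1" for x by (rule Q.kint_bounded[OF h(1) b])
    show "AE x in \<nu>. kint K (kint Q h) x = kint Q h x"
      using KQ
    proof eventually_elim
      case (elim x)
      have "(\<integral>y. h y \<partial>(K x \<bind> Q)) = (\<integral>y. kint Q h y \<partial>K x)"
        by (rule Q.integral_bind_kernel[OF _ h]) simp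
      then show ?case using elim by (simp add: kint_def)
    qed
  qed
  \<comment> \<open>\<open>kint Q h\<close> is the conditional expectation of \<open>h\<close> given
    the invariant sets, characterised as the harmonic function, unique up to null sets, with the
    same integrals as \<open>h\<close> against all test measures.\<close>
  have hQ0: "AE x in \<nu>. kint Q h x = k x"
    if h: "h \<in> borel_measurable N" "\<And>x. 0 \<le> h x" "\<And>x. h x \<le> 1" and k: "harmonic \<nu> k"
      and eq: "\<And>\<mu>. inv_meas \<mu> \<Longrightarrow> absolutely_continuous \<nu> \<mu> \<Longrightarrow> (\<integral>x. h x \<partial>\<mu>) = (\<integral>x. k x \<partial>\<mu>)" for h k
  proof -
    have b: "\<bar>h x\<bar> \<le> 1" for x using h(2,3)[of x] by simp
    have "AE x in \<nu>. kint Q h x - k x = 0"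
    proof (rule harmonic_zero[OF inv harmonic_diff[OF hQ[OF h] k]])
      fix \<mu> assume \<mu>: "inv_meas \<mu>" "absolutely_continuous \<nu> \<mu>"
      obtain B where "\<And>x. \<bar>k x\<bar> \<le> B" using harmonicD(3)[OF k] by metis
      then have "integrable \<mu> k" by (rule integrable_inv[OF \<mu>(1) harmonicD(1)[OF k]])
      moreover have "integrable \<mu> (kint Q h)"
        by (rule integrable_inv[OF \<mu>(1) Q.kint_measurable[OF h(1)] Q.kint_bounded[OF h(1) b]])
      moreover have "(\<integral>x. kint Q h x \<partial>\<mu>) = (\<integral>x. h x \<partial>\<mu>)"
        by (rule Q.integral_kint_nonneg[OF S1[OF \<mu>] h])
      ultimately show "(\<integral>x. kint Q h x - k x \<partial>\<mu>) = 0" using eq[OF \<mu>] by simp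
    qed
    then show ?thesis by eventually_elim simp
  qed
  \<comment> \<open>\<open>kint K (f q)\<close> and \<open>f q\<close> have equal integrals under
    every invariant measure, so their conditional expectations agree; for all rational
    \<open>q\<close> together this says that \<open>Q x\<close> is stationary.\<close>
  have stat: "AE x in \<nu>. inv_meas (Q x)"
  proof -
    have kf: "kint K (f q) \<in> borel_measurable N" "0 \<le> kint K (f q) x" "kint K (f q) x \<le> 1" for q x
    proof -
      show "kint K (f q) \<in> borel_measurable N" by (rule kint_measurable[OF f(1)])
      show "0 \<le> kint K (f q) x" by (simp add: kint_def f(2))
      show "kint K (f q) x \<le> 1" using kint_bounded[OF f(1) f(4), of q x] by simp
    qed
    have "AE x in \<nu>. kint Q (kint K (f q)) x = kint Q (f q) x" for q
    proof (rule hQ0[OF kf hQ[OF f(1-3)]])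
      fix \<mu> assume \<mu>: "inv_meas \<mu>" "absolutely_continuous \<nu> \<mu>"
      show "(\<integral>x. kint K (f q) x \<partial>\<mu>) = (\<integral>x. kint Q (f q) x \<partial>\<mu>)"
        using Q.integral_kint_nonneg[OF S1[OF \<mu>] f(1-3)] integral_kint_nonneg[OF \<mu>(1) f(1-3)] by simp
    qed
    then have "AE x in \<nu>. \<forall>q. kint Q (kint K (f q)) x = kint Q (f q) x"
      by (simp add: AE_all_countable)
    then show ?thesis
    proof eventually_elim
      case (elim x)
      interpret Qx: prob_space "Q x" by (rule Q.prob_space_kernel)
      have Kq: "K \<in> Q x \<rightarrow>\<^sub>M subprob_algebra N" using kernel_subprob by (simp cong: measurable_cong_sets)
      have sK: "sets (Q x \<bind> K) = sets N" by (rule sets_bind) auto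
      have "Q x \<bind> K = Q x"
      proof (rule measure_eqI_cells[OF sK])
        have "prob_space (Q x \<bind> K)"
          by (rule Qx.prob_space_bind[OF _ Kq]) (simp add: prob_space_kernel)
        then interpret QK: prob_space "Q x \<bind> K" .
        show "finite_measure (Q x \<bind> K)" by unfold_locales
        fix q :: rat
        have c: "cell q \<in> sets N" by simp
        have "measure (Q x \<bind> K) (cell q) = (\<integral>y. f q y \<partial>(Q x \<bind> K))"
          using sK c by (simp add: f_def)
        also have "\<dots> = kint Q (kint K (f q)) x"
          unfolding kint_def[of Q] by (rule integral_bind_kernel[OF _ f(1-3)]) simp
        also have "\<dots> = measure (Q x) (cell q)"
          using elim c by (simp add: kint_def f_def)
        finally show "emeasure (Q x \<bind> K) (cell q) = emeasure (Q x) (cell q)"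
          by (simp add: Qx.emeasure_eq_measure QK.emeasure_eq_measure)
      qed simp
      moreover have "emeasure (Q x \<bind> K) B = (\<integral>\<^sup>+y. emeasure (K y) B \<partial>Q x)" if "B \<in> sets N" for B
        using that by (intro emeasure_bind[OF _ Kq]) auto
      ultimately show ?case
        by (auto simp: invariant_under_def Qx.finite_measure_axioms)
    qed
  qed
  \<comment> \<open>Under \<open>Q x\<close> the function \<open>g q\<close> has mean
    \<open>g q x\<close> and second moment \<open>(g q x)^2\<close>, hence variance zero.\<close>
  have const: "AE x in \<nu>. \<forall>q. AE y in Q x. g q y = g q x"
  proof -
    have "AE x in \<nu>. AE y in Q x. g q y = g q x" for q
    proof -
      have sq: "(\<lambda>x. (g q x)\<^sup>2) \<in> borel_measurable N" "0 \<le> (g q x)\<^sup>2" "(g q x)\<^sup>2 \<le> 1" "\<bar>(g q x)\<^sup>2\<bar> \<le> 1" for x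
        using g(1-3) by (auto simp: power_le_one)
      have "AE x in \<nu>. kint Q (g q) x = g q x" by (rule hQ0[OF g(1-3) hg]) simp
      moreover have "AE x in \<nu>. kint Q (\<lambda>x. (g q x)\<^sup>2) x = (g q x)\<^sup>2"
        by (rule hQ0[OF sq(1-3) harmonic_square[OF inv hg]]) simp
      ultimately show ?thesis
      proof eventually_elim
        case (elim x)
        interpret Qx: prob_space "Q x" by (rule Q.prob_space_kernel)
        have i: "integrable (Q x) (g q)" "integrable (Q x) (\<lambda>y. (g q y)\<^sup>2)"
          by (rule Q.integrable_kernel[OF g(1) g_abs(1)] Q.integrable_kernel[OF sq(1) sq(4)])+
        have "(\<integral>y. (g q y - g q x)\<^sup>2 \<partial>Q x) = 0"
          using Qx.variance_eq[OF i] elim by (simp add: kint_def)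
        moreover have "integrable (Q x) (\<lambda>y. (g q y - g q x)\<^sup>2)"
          unfolding power2_diff using i by auto
        ultimately have "AE y in Q x. (g q y - g q x)\<^sup>2 = 0"
          by (subst integral_nonneg_eq_0_iff_AE[symmetric]) auto
        then show ?case by eventually_elim simp
      qed
    qed
    then show ?thesis by (simp add: AE_all_countable)
  qed
  have "AE x in \<nu>. \<forall>q. AE y in Q x. (\<lambda>j. c q j y) \<longlonglongrightarrow> g q y"
    using Q.AE_kernel[OF S1[OF inv ac_refl] cg] by (simp add: AE_all_countable)
  then have erg: "AE x in \<nu>. \<forall>\<mu>. prob_space \<mu> \<and> inv_meas \<mu> \<and> absolutely_continuous (Q x) \<mu> \<longrightarrow> \<mu> = Q x"
    using const stat
  proof eventually_elim
    case (elim x)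
    \<comment> \<open>The hull elements \<open>c q j\<close> keep the integral of \<open>f q\<close>
      under every invariant measure and converge \<mu>-almost surely to the constant
      \<open>g q x\<close>. This determines the distribution function of the code under
      \<mu>.\<close>
    have L: "emeasure \<mu> (cell q) = ennreal (g q x)"
      if \<mu>: "prob_space \<mu>" "inv_meas \<mu>" "absolutely_continuous (Q x) \<mu>" for \<mu> q
    proof -
      interpret \<mu>: prob_space \<mu> by fact
      note mm = inv_measD[OF \<mu>(2)]
      have "AE y in Q x. (\<lambda>j. c q j y) \<longlonglongrightarrow> g q x"
        using elim(1,2)[THEN spec, of q] by eventually_elim simp
      then have "AE y in \<mu>. (\<lambda>j. c q j y) \<longlonglongrightarrow> g q x"
        using absolutely_continuous_AE[OF _ \<mu>(3)] mm by simp
      then have "(\<integral>y. f q y \<partial>\<mu>) = (\<integral>y. g q x \<partial>\<mu>)" by (intro gf_lim[OF \<mu>(2)]) auto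
      then have "measure \<mu> (cell q) = g q x" using mm \<mu>.prob_space by (simp add: f_def)
      then show ?thesis by (simp add: \<mu>.emeasure_eq_measure)
    qed
    show ?case
    proof (intro allI impI, elim conjE)
      fix \<mu> assume \<mu>: "prob_space \<mu>" "inv_meas \<mu>" "absolutely_continuous (Q x) \<mu>"
      show "\<mu> = Q x"
      proof (rule measure_eqI_cells)
        have "absolutely_continuous (Q x) (Q x)" by (simp add: absolutely_continuous_def)
        then show "emeasure \<mu> (cell q) = emeasure (Q x) (cell q)" for q
          using L[OF \<mu>] L[OF Q.prob_space_kernel elim(3)] by simp
      qed (use inv_measD[OF \<mu>(2)] in auto)
    qed
  qed
  show ?thesis by (rule that[OF Q_m S1 stat erg])
qed

end

section \<open>Coding configurations; translations\<close>

text \<open>Digits 0 and 2 in base three avoid ambiguous expansions, so the first digit is recovered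
  by comparison with 1/2.\<close>

definition cantor :: "(nat \<Rightarrow> bool) \<Rightarrow> real" where
  "cantor b = (\<Sum>k. of_bool (b k) * (2 / 3 ^ Suc k))"

definition cantor_shift :: "real \<Rightarrow> real" where
  "cantor_shift y = 3 * y - 2 * of_bool (1 / 2 \<le> y)"

lemma cantor_summable: "summable (\<lambda>k. of_bool (b k) * (2 / 3 ^ Suc k) :: real)"
proof (rule summable_comparison_test'[where N=0])
  show "summable (\<lambda>k. (2 / 3) * (1 / 3) ^ k :: real)" by (intro summable_mult summable_geometric) simp
qed (auto simp: power_divide)

lemma cantor_bounds: "0 \<le> cantor b" "cantor b \<le> 1"
proof -
  show "0 \<le> cantor b" unfolding cantor_def by (intro suminf_nonneg cantor_summable) auto
  have s: "(\<lambda>k. (2 / 3) * (1 / 3) ^ k :: real) sums ((2 / 3) * (1 / (1 - 1 / 3)))"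
    by (intro sums_mult geometric_sums) simp
  have "cantor b \<le> (\<Sum>k. (2 / 3) * (1 / 3) ^ k)"
    unfolding cantor_def using sums_summable[OF s]
    by (intro suminf_le cantor_summable) (auto simp: power_divide)
  then show "cantor b \<le> 1" using sums_unique[OF s] by simp
qed

lemma cantor_Suc: "cantor b = of_bool (b 0) * 2 / 3 + cantor (\<lambda>k. b (Suc k)) / 3"
proof -
  have "cantor b = of_bool (b 0) * 2 / 3 + (\<Sum>k. of_bool (b (Suc k)) * (2 / 3 ^ Suc (Suc k)))"
    unfolding cantor_def using suminf_split_head[OF cantor_summable[of b]] by simp
  also have "(\<Sum>k. of_bool (b (Suc k)) * (2 / 3 ^ Suc (Suc k))) = (\<Sum>k. of_bool (b (Suc k)) * (2 / 3 ^ Suc k) / 3 :: real)"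
    by simp
  also have "\<dots> = cantor (\<lambda>k. b (Suc k)) / 3"
    unfolding cantor_def using suminf_divide[OF cantor_summable[of "\<lambda>k. b (Suc k)"], of 3] by simp
  finally show ?thesis .
qed

lemma cantor_digit: "1 / 2 \<le> cantor b \<longleftrightarrow> b 0"
  using cantor_bounds[of "\<lambda>k. b (Suc k)"] by (subst cantor_Suc) auto

lemma cantor_shift: "cantor_shift (cantor b) = cantor (\<lambda>k. b (Suc k))"
  unfolding cantor_shift_def cantor_digit by (subst cantor_Suc) auto

lemma cantor_shift_pow: "(cantor_shift ^^ k) (cantor b) = cantor (\<lambda>l. b (l + k))"
  by (induction k) (auto simp: cantor_shift)

lemma cantor_decode: "1 / 2 \<le> (cantor_shift ^^ k) (cantor b) \<longleftrightarrow> b k"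
  unfolding cantor_shift_pow using cantor_digit[of "\<lambda>l. b (l + k)"] by simp

lemma cantor_shift_pow_measurable [measurable]: "cantor_shift ^^ k \<in> borel_measurable borel"
proof (induction k)
  case (Suc k)
  have [measurable]: "cantor_shift \<in> borel_measurable borel"
    unfolding cantor_shift_def by measurable
  show ?case using Suc by (simp add: measurable_comp)
qed (simp add: id_def)

text \<open>Each stack is written in unary, over all pairs of site and height in one enumeration;
  decoding looks for the first height whose digit is zero.\<close>

definition config_code :: "config \<Rightarrow> real" where
  "config_code \<eta> = cantor (\<lambda>k. case from_nat k :: int \<times> nat of (i, j) \<Rightarrow> j < \<eta> i)"

definition config_decode :: "real \<Rightarrow> config" where
  "config_decode y i = (LEAST j. \<not> 1 / 2 \<le> (cantor_shift ^^ to_nat (i, j)) y)"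

lemma measurable_coordinate: "(\<lambda>\<eta>::int \<Rightarrow> 'a::topological_space. \<eta> i) \<in> borel \<rightarrow>\<^sub>M borel"
  by (rule measurable_product_coordinates)

lemma measurable_coordinate_count [measurable (raw)]: "(\<lambda>\<eta>::config. \<eta> i) \<in> borel \<rightarrow>\<^sub>M count_space UNIV"
  by (subst measurable_cong_sets[OF refl sets_borel_eq_count_space[symmetric]]) (rule measurable_coordinate)

lemma config_decode_code: "config_decode (config_code \<eta>) = \<eta>"
proof
  fix i
  have "config_decode (config_code \<eta>) i = (LEAST j. \<not> j < \<eta> i)"
    unfolding config_decode_def config_code_def cantor_decode by simp
  also have "\<dots> = \<eta> i" by (rule Least_equality) auto
  finally show "config_decode (config_code \<eta>) i = \<eta> i" .
qed

lemma config_code_measurable [measurable]: "config_code \<in> borel_measurable borel"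
proof -
  have [measurable]: "Measurable.pred borel (\<lambda>\<eta>::config. case from_nat k :: int \<times> nat of (i, j) \<Rightarrow> j < \<eta> i)" for k
    by (cases "from_nat k :: int \<times> nat") simp
  show ?thesis unfolding config_code_def cantor_def by measurable
qed

lemma config_decode_measurable [measurable]: "config_decode \<in> borel \<rightarrow>\<^sub>M borel"
proof (rule measurable_coordinatewise_then_product)
  fix i :: int
  have "Measurable.pred borel (\<lambda>y. \<not> 1 / 2 \<le> (cantor_shift ^^ to_nat (i, j)) y)" for j :: nat
  proof -
    have "{y \<in> space borel. \<not> 1 / 2 \<le> (cantor_shift ^^ to_nat (i, j)) y} =
        (cantor_shift ^^ to_nat (i, j)) -` (- {1 / 2..}) \<inter> space borel"
      by auto
    then show ?thesis
      unfolding pred_def using measurable_sets[OF cantor_shift_pow_measurable, of "- {1 / 2..}" "to_nat (i, j)"]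
      by simp
  qed
  then have "(\<lambda>y. config_decode y i) \<in> borel \<rightarrow>\<^sub>M count_space UNIV"
    unfolding config_decode_def by (rule measurable_Least)
  then show "(\<lambda>y. config_decode y i) \<in> borel_measurable borel"
    by (subst measurable_cong_sets[OF refl sets_borel_eq_count_space])
qed

lemma coded_kernel_config:
  assumes "K \<in> borel \<rightarrow>\<^sub>M prob_algebra borel"
  shows "coded_kernel borel K config_code config_decode"
proof
  show "0 \<le> config_code x" "config_code x \<le> 1" for x
    unfolding config_code_def by (rule cantor_bounds)+
qed (rule assms config_code_measurable config_decode_measurable config_decode_code space_borel)+

section \<open>Translations and their push-forwards\<close>

definition untranslate :: "(int \<Rightarrow> 'a) \<Rightarrow> int \<Rightarrow> 'a" where
  "untranslate \<eta> = (\<lambda>i. \<eta> (i + 1))"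

lemma untranslate_translate [simp]: "untranslate (translate \<eta>) = \<eta>" "translate (untranslate \<eta>) = \<eta>"
  by (auto simp: untranslate_def translate_def)

lemma translate_pow: "(translate ^^ k) \<eta> i = \<eta> (i - int k)"
  by (induction k arbitrary: i) (auto simp: translate_def algebra_simps)

lemma translate_measurable [measurable]:
  "translate \<in> (borel :: (int \<Rightarrow> 'a::second_countable_topology) measure) \<rightarrow>\<^sub>M borel"
  by (rule measurable_coordinatewise_then_product) (simp add: translate_def)

lemma untranslate_measurable [measurable]:
  "untranslate \<in> (borel :: (int \<Rightarrow> 'a::second_countable_topology) measure) \<rightarrow>\<^sub>M borel"
  by (rule measurable_coordinatewise_then_product) (simp add: untranslate_def)

lemma translate_pow_measurable [measurable]:
  "translate ^^ n \<in> (borel :: (int \<Rightarrow> 'a::second_countable_topology) measure) \<rightarrow>\<^sub>M borel"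
proof (induction n)
  case 0
  show ?case by (simp add: id_def)
next
  case (Suc n)
  show ?case unfolding funpow.simps by (rule measurable_comp[OF Suc translate_measurable])
qed

lemma push_translate_pow:
  fixes M :: "(int \<Rightarrow> 'a::second_countable_topology) measure"
  assumes "sets M = sets borel"
  shows "(push_translate ^^ n) M = distr M borel (translate ^^ n)"
proof (induction n)
  case 0
  then show ?case using distr_id2[OF assms[symmetric]] by (simp add: id_def)
next
  case (Suc n)
  have "translate ^^ n \<in> M \<rightarrow>\<^sub>M borel"
    by (subst measurable_cong_sets[OF assms refl]) (rule translate_pow_measurable)
  then have "distr (distr M borel (translate ^^ n)) borel translate = distr M borel (translate ^^ Suc n)"
    by (subst distr_distr) (auto simp: comp_def)
  moreover have "(push_translate ^^ Suc n) M = push_translate (distr M borel (translate ^^ n))"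
    by (simp add: Suc)
  ultimately show ?case
    using push_translate_def[of "distr M borel (translate ^^ n)"] by metis
qed

section \<open>Measure-preserving maps as deterministic kernels\<close>

lemma invariant_under_return:
  assumes T: "T \<in> N \<rightarrow>\<^sub>M N"
  shows "invariant_under N (\<lambda>x. return N (T x)) M \<longleftrightarrow>
    sets M = sets N \<and> finite_measure M \<and> distr M N T = M"
proof -
  have "(\<forall>B\<in>sets N. emeasure M B = (\<integral>\<^sup>+x. emeasure (return N (T x)) B \<partial>M)) \<longleftrightarrow> distr M N T = M"
    if s: "sets M = sets N"
  proof -
    have T': "T \<in> M \<rightarrow>\<^sub>M N" using T s by (simp cong: measurable_cong_sets)
    have "(\<integral>\<^sup>+x. emeasure (return N (T x)) B \<partial>M) = emeasure (distr M N T) B" if "B \<in> sets N" for B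
      using that T' by (simp add: emeasure_return nn_integral_distr[symmetric])
    then show ?thesis using s by (auto intro!: measure_eqI simp: )
  qed
  then show ?thesis by (auto simp: invariant_under_def)
qed

lemma markov_kernel_return:
  assumes "space N = UNIV" "T \<in> N \<rightarrow>\<^sub>M N"
  shows "markov_kernel N (\<lambda>x. return N (T x))"
proof
  show "(\<lambda>x. return N (T x)) \<in> N \<rightarrow>\<^sub>M prob_algebra N"
    by (rule measurable_compose[OF assms(2) measurable_return_prob_space])
qed (rule assms)

lemma kint_return:
  assumes "space N = UNIV" "h \<in> borel_measurable N"
  shows "kint (\<lambda>x. return N (T x)) h x = h (T x)"
  unfolding kint_def by (rule integral_return) (use assms in auto)

section \<open>Mixtures of invariant measures and their remainders\<close>

lemma nn_integral_sum_measure: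
  fixes a :: "'i \<Rightarrow> ennreal"
  assumes I: "finite I" and s: "sets \<mu> = sets N" "\<And>i. i \<in> I \<Longrightarrow> sets (\<nu> i) = sets N"
    and p: "\<And>i. i \<in> I \<Longrightarrow> prob_space (\<nu> i)" and ne: "space N \<noteq> {}"
    and eq: "\<And>C. C \<in> sets N \<Longrightarrow> emeasure \<mu> C = (\<Sum>i\<in>I. a i * emeasure (\<nu> i) C)"
    and h: "h \<in> borel_measurable N"
  shows "(\<integral>\<^sup>+x. h x \<partial>\<mu>) = (\<Sum>i\<in>I. a i * (\<integral>\<^sup>+x. h x \<partial>\<nu> i))"
proof (cases "I = {}")
  case True
  then have "AE x in \<mu>. False"
    using eq[OF sets.top] s sets_eq_imp_space_eq[OF s(1)] by (intro AE_I[of _ _ "space \<mu>"]) auto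
  then have "(\<integral>\<^sup>+x. h x \<partial>\<mu>) = (\<integral>\<^sup>+x. 0 \<partial>\<mu>)" by (intro nn_integral_cong_AE) auto
  then show ?thesis using True by simp
next
  case False
  let ?P = "point_measure I a"
  have \<nu>: "\<nu> \<in> ?P \<rightarrow>\<^sub>M subprob_algebra N"
    using p s by (auto simp: measurable_def sets_point_measure space_point_measure space_subprob_algebra
        intro: prob_space_imp_subprob_space)
  \<comment> \<open>A finite mixture is the bind of a weighted point measure on the index set, which
    reduces linearity in the measure to the integral of a bind.\<close>
  have "\<mu> = ?P \<bind> \<nu>"
  proof (rule measure_eqI)
    have "sets (?P \<bind> \<nu>) = sets N"
      using False s by (intro sets_bind) (auto simp: space_point_measure)
    then show "sets \<mu> = sets (?P \<bind> \<nu>)" using s by simp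
    fix C assume "C \<in> sets \<mu>"
    then show "emeasure \<mu> C = emeasure (?P \<bind> \<nu>) C"
      using False s I eq \<nu> by (subst emeasure_bind) (auto simp: space_point_measure nn_integral_point_measure_finite)
  qed
  then show ?thesis
    using nn_integral_bind[OF h \<nu>] I by (simp add: nn_integral_point_measure_finite)
qed

lemma (in markov_kernel) inv_meas_sum:
  fixes a :: "'i \<Rightarrow> ennreal"
  assumes I: "finite I" and s: "sets \<mu> = sets N" "finite_measure \<mu>"
    and \<nu>: "\<And>i. i \<in> I \<Longrightarrow> prob_space (\<nu> i)" "\<And>i. i \<in> I \<Longrightarrow> inv_meas (\<nu> i)"
    and eq: "\<And>C. C \<in> sets N \<Longrightarrow> emeasure \<mu> C = (\<Sum>i\<in>I. a i * emeasure (\<nu> i) C)"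
  shows "inv_meas \<mu>"
  unfolding invariant_under_def
proof (intro conjI s ballI)
  fix B assume B: "B \<in> sets N"
  have "(\<integral>\<^sup>+x. emeasure (K x) B \<partial>\<mu>) = (\<Sum>i\<in>I. a i * (\<integral>\<^sup>+x. emeasure (K x) B \<partial>\<nu> i))"
    using inv_measD(1)[OF \<nu>(2)] \<nu>(1) space_UNIV
    by (intro nn_integral_sum_measure[OF I s(1) _ _ _ eq] measurable_emeasure_kernel[OF kernel_subprob B]) auto
  also have "\<dots> = emeasure \<mu> B"
    using inv_measD(4)[OF \<nu>(2) B] by (simp add: eq[OF B])
  finally show "emeasure \<mu> B = (\<integral>\<^sup>+x. emeasure (K x) B \<partial>\<mu>)" by simp
qed

text \<open>Domination makes the difference of \<open>M\<close> and \<open>c\<close> times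
  \<open>M'\<close> a positive measure of mass \<open>1 - c\<close>; \<open>M2\<close> is its
  normalisation.\<close>

lemma prob_space_complement:
  assumes M: "prob_space M" "sets M = sets N" and M': "prob_space M'" "sets M' = sets N"
    and c: "0 < c" "c < 1" and le: "\<And>B. B \<in> sets N \<Longrightarrow> c * measure M' B \<le> measure M B"
  obtains M2 where "prob_space M2" "sets M2 = sets N"
    "\<And>B. B \<in> sets N \<Longrightarrow> measure M B = c * measure M' B + (1 - c) * measure M2 B"
    "\<And>B. B \<in> sets N \<Longrightarrow> emeasure M2 B = ennreal (1 / (1 - c)) * (emeasure M B - ennreal c * emeasure M' B)"
proof -
  interpret M: prob_space M by fact
  interpret M': prob_space M' by fact
  let ?M' = "scale_measure (ennreal c) M'"
  define D where "D = diff_measure M ?M'"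
  have sp: "space M' = space M" using M M' sets_eq_imp_space_eq by metis
  have D: "emeasure D B = emeasure M B - ennreal c * emeasure M' B" if "B \<in> sets N" for B
  proof -
    have "emeasure ?M' A \<le> emeasure M A" if "A \<in> sets M" for A
      using le[of A] that M M' c
      by (simp add: M.emeasure_eq_measure M'.emeasure_eq_measure ennreal_mult[symmetric])
    moreover have "finite_measure ?M'"
      by (rule finite_measureI) (simp add: M'.emeasure_eq_measure ennreal_mult_eq_top_iff)
    ultimately show ?thesis
      unfolding D_def using that M M' M.finite_measure_axioms
      by (subst emeasure_diff_measure) auto
  qed
  have D': "emeasure D B = ennreal (measure M B - c * measure M' B)" if "B \<in> sets N" for B
    using that c le[OF that] by (simp add: D M.emeasure_eq_measure M'.emeasure_eq_measure ennreal_mult[symmetric] ennreal_minus)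
  define M2 where "M2 = scale_measure (ennreal (1 / (1 - c))) D"
  have s2: "sets M2 = sets N" by (simp add: M2_def D_def M)
  have e2: "emeasure M2 B = ennreal ((measure M B - c * measure M' B) / (1 - c))" if "B \<in> sets N" for B
    using D'[OF that] c le[OF that] by (simp add: M2_def ennreal_mult[symmetric])
  have top: "space M2 \<in> sets N" "space M2 = space M" using s2 M sets_eq_imp_space_eq[of M2 M] by auto
  have p2: "prob_space M2"
  proof
    show "emeasure M2 (space M2) = 1"
      using e2[OF top(1)] top c sp M.prob_space M'.prob_space by simp
  qed
  interpret M2: prob_space M2 by fact
  show ?thesis
  proof (rule that[OF p2 s2])
    fix B assume B: "B \<in> sets N"
    have "measure M2 B = (measure M B - c * measure M' B) / (1 - c)"
      using e2[OF B] le[OF B] c by (simp add: M2.emeasure_eq_measure)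
    then show "measure M B = c * measure M' B + (1 - c) * measure M2 B" using c by (simp add: field_simps)
    show "emeasure M2 B = ennreal (1 / (1 - c)) * (emeasure M B - ennreal c * emeasure M' B)"
      using D[OF B] by (simp add: M2_def)
  qed
qed

text \<open>Stationarity is linear: the finite contribution of \<open>M'\<close> cancels on both
  sides of the equation for \<open>M\<close>.\<close>

lemma (in markov_kernel) inv_meas_complement:
  assumes M: "inv_meas M" "prob_space M" and M': "inv_meas M'" "prob_space M'" and M2: "prob_space M2" "sets M2 = sets N"
    and c: "0 < c" "c < 1" and eq: "\<And>B. B \<in> sets N \<Longrightarrow> measure M B = c * measure M' B + (1 - c) * measure M2 B"
  shows "inv_meas M2"
  unfolding invariant_under_def
proof (intro conjI M2 ballI)
  interpret M: prob_space M by fact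
  interpret M': prob_space M' by fact
  interpret M2: prob_space M2 by fact
  show "finite_measure M2" by unfold_locales
  fix B assume B: "B \<in> sets N"
  let ?a = "\<lambda>b. ennreal (if b then c else 1 - c)" and ?\<nu> = "\<lambda>b. if b then M' else M2"
  have e: "emeasure M C = (\<Sum>b\<in>UNIV. ?a b * emeasure (?\<nu> b) C)" if "C \<in> sets N" for C
    using eq[OF that] c by (simp add: UNIV_bool M.emeasure_eq_measure M'.emeasure_eq_measure M2.emeasure_eq_measure
        ennreal_mult[symmetric] add.commute flip: ennreal_plus)
  have "(\<integral>\<^sup>+x. emeasure (K x) B \<partial>M) = (\<Sum>b\<in>UNIV. ?a b * (\<integral>\<^sup>+x. emeasure (K x) B \<partial>?\<nu> b))"
    using inv_measD(1)[OF M(1)] inv_measD(1)[OF M'(1)] M'(2) M2 space_UNIV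
    by (intro nn_integral_sum_measure[where N=N] measurable_emeasure_kernel[OF kernel_subprob B] e) auto
  then have "emeasure M B = ennreal (1 - c) * (\<integral>\<^sup>+x. emeasure (K x) B \<partial>M2) + ennreal c * emeasure M' B"
    using inv_measD(4)[OF M(1) B] inv_measD(4)[OF M'(1) B] by (simp add: UNIV_bool)
  then have "ennreal (1 - c) * emeasure M2 B + ennreal c * emeasure M' B =
      ennreal (1 - c) * (\<integral>\<^sup>+x. emeasure (K x) B \<partial>M2) + ennreal c * emeasure M' B"
    using e[OF B] by (simp add: UNIV_bool)
  moreover have "ennreal c * emeasure M' B \<noteq> top"
    by (simp add: M'.emeasure_eq_measure ennreal_mult_eq_top_iff)
  ultimately have "ennreal (1 - c) * emeasure M2 B = ennreal (1 - c) * (\<integral>\<^sup>+x. emeasure (K x) B \<partial>M2)"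
    by (simp add: ennreal_add_left_cancel add.commute)
  then show "emeasure M2 B = (\<integral>\<^sup>+x. emeasure (K x) B \<partial>M2)"
    using c by (simp add: ennreal_mult_cancel_left)
qed

section \<open>Parities are conserved\<close>

definition even_part :: "config \<Rightarrow> config" where
  "even_part \<eta> = (\<lambda>i. 2 * (\<eta> i div 2))"

definition odd_sites :: "config \<Rightarrow> spins" where
  "odd_sites \<eta> = (\<lambda>i. odd (\<eta> i))"

lemma combine_parts [simp]: "combine (even_part \<eta>, odd_sites \<eta>) = \<eta>"
  by (auto simp: combine_def even_part_def odd_sites_def fun_eq_iff)

lemma even_part_combine: "(\<And>i. even (\<eta> i)) \<Longrightarrow> even_part (combine (\<eta>, \<sigma>)) = \<eta>"
  and odd_sites_combine: "(\<And>i. even (\<eta> i)) \<Longrightarrow> odd_sites (combine (\<eta>, \<sigma>)) = \<sigma>"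
  by (auto simp: combine_def even_part_def odd_sites_def fun_eq_iff elim!: evenE)

lemma even_part_translate: "even_part (translate \<eta>) = translate (even_part \<eta>)"
  and odd_sites_translate: "odd_sites (translate \<eta>) = translate (odd_sites \<eta>)"
  by (auto simp: even_part_def odd_sites_def translate_def)

lemma short_even: "short (2 * (n div 2)) \<longleftrightarrow> short n"
  unfolding short_def by presburger

lemma even_part_Xstar: "even_part \<eta> \<in> Xstar_even \<longleftrightarrow> \<eta> \<in> Xstar"
  by (auto simp: Xstar_even_def Xstar_def even_part_def short_even)

lemma translate_Xstar: "translate \<eta> \<in> Xstar \<longleftrightarrow> \<eta> \<in> Xstar"
proof
  assume h: "translate \<eta> \<in> Xstar"
  show "\<eta> \<in> Xstar"
    unfolding Xstar_def
  proof (intro CollectI allI)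
    fix i
    show "\<not> (short (\<eta> i) \<and> short (\<eta> (i + 1)))"
      using h[unfolded Xstar_def, THEN CollectD, THEN spec, of "i + 1"] by (simp add: translate_def add.commute)
  qed
next
  assume h: "\<eta> \<in> Xstar"
  show "translate \<eta> \<in> Xstar"
    unfolding Xstar_def
  proof (intro CollectI allI)
    fix i
    show "\<not> (short (translate \<eta> i) \<and> short (translate \<eta> (i + 1)))"
      using h[unfolded Xstar_def, THEN CollectD, THEN spec, of "i - 1"] by (simp add: translate_def)
  qed
qed

lemma translate_Xstar_even: "translate \<eta> \<in> Xstar_even \<longleftrightarrow> \<eta> \<in> Xstar_even"
proof -
  have "(\<forall>i. even (translate \<eta> i)) \<longleftrightarrow> (\<forall>i. even (\<eta> i))"
    unfolding translate_def by (metis add_diff_cancel_right')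
  then show ?thesis by (auto simp: Xstar_even_def translate_Xstar)
qed

lemma ssm_flux_even_part: "ssm_flux (even_part \<eta>) b k = ssm_flux \<eta> b k"
  by (simp add: ssm_flux_def even_part_def short_even)

lemma ssm_flux_Xstar: "\<eta> \<in> Xstar \<Longrightarrow> ssm_flux \<eta> b k = 1 \<or> ssm_flux \<eta> b k = - 1"
  by (auto simp: ssm_flux_def Xstar_def)

text \<open>On \<open>Xstar\<close> every flux is 1 or -1, so a stack changes by an even number. The
  flux depends on the stacks only through being short, and rounding down to an even number does not
  alter that.\<close>

lemma
  assumes "\<eta> \<in> Xstar"
  shows even_part_ssm_step: "even_part (ssm_step \<eta> b) = ssm_step (even_part \<eta>) b"
    and odd_sites_ssm_step: "odd_sites (ssm_step \<eta> b) = odd_sites \<eta>"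
proof -
  have s: "\<exists>d. int (ssm_step \<eta> b i) = int (\<eta> i) + 2 * d \<and>
      int (ssm_step (even_part \<eta>) b i) = int (even_part \<eta> i) + 2 * d" for i
    using ssm_flux_Xstar[OF assms, of b "i - 1"] ssm_flux_Xstar[OF assms, of b i]
    unfolding int_ssm_step ssm_flux_even_part
    by (elim disjE) (auto intro: exI[of _ 0] exI[of _ 1] exI[of _ "-1"])
  show "even_part (ssm_step \<eta> b) = ssm_step (even_part \<eta>) b"
  proof
    fix i
    obtain d where d: "int (ssm_step \<eta> b i) = int (\<eta> i) + 2 * d"
      "int (ssm_step (even_part \<eta>) b i) = int (even_part \<eta> i) + 2 * d" using s by blast
    have "int (even_part (ssm_step \<eta> b) i) = 2 * ((int (\<eta> i) + 2 * d) div 2)"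
      by (simp add: even_part_def zdiv_int d(1))
    also have "\<dots> = int (even_part \<eta> i) + 2 * d" by (simp add: even_part_def zdiv_int)
    finally show "even_part (ssm_step \<eta> b) i = ssm_step (even_part \<eta>) b i" using d(2) by simp
  qed
  show "odd_sites (ssm_step \<eta> b) = odd_sites \<eta>"
  proof
    fix i
    obtain d where d: "int (ssm_step \<eta> b i) = int (\<eta> i) + 2 * d" using s by blast
    have "even (int (ssm_step \<eta> b i)) \<longleftrightarrow> even (int (\<eta> i))" unfolding d by simp
    then show "odd_sites (ssm_step \<eta> b) i = odd_sites \<eta> i" by (simp add: odd_sites_def)
  qed
qed

lemma ssm_step_translate: "ssm_step (translate \<eta>) (translate b) = translate (ssm_step \<eta> b)"
  by (auto simp: ssm_step_def ssm_flux_def translate_def fun_eq_iff)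

section \<open>Measurability of the splitting into even part and parities\<close>

lemma even_part_measurable [measurable]: "even_part \<in> borel \<rightarrow>\<^sub>M borel"
proof (rule measurable_coordinatewise_then_product)
  fix i :: int
  have "(\<lambda>n. 2 * (n div 2) :: nat) \<in> count_space UNIV \<rightarrow>\<^sub>M borel" by simp
  from measurable_compose[OF measurable_coordinate_count this]
  show "(\<lambda>\<eta>. even_part \<eta> i) \<in> borel_measurable borel" by (simp add: even_part_def)
qed

lemma odd_sites_measurable [measurable]: "odd_sites \<in> borel \<rightarrow>\<^sub>M borel"
proof (rule measurable_coordinatewise_then_product)
  fix i :: int
  have "(\<lambda>n :: nat. odd n) \<in> count_space UNIV \<rightarrow>\<^sub>M borel" by simp
  from measurable_compose[OF measurable_coordinate_count this]
  show "(\<lambda>\<eta>. odd_sites \<eta> i) \<in> borel_measurable borel" by (simp add: odd_sites_def)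
qed

lemma combine_measurable [measurable]: "combine \<in> borel \<Otimes>\<^sub>M borel \<rightarrow>\<^sub>M borel"
proof (rule measurable_coordinatewise_then_product)
  fix i :: int
  have 1: "(\<lambda>p::config \<times> spins. fst p i) \<in> borel_measurable (borel \<Otimes>\<^sub>M borel)"
    by (rule measurable_compose[OF measurable_fst measurable_coordinate])
  have "(\<lambda>p::config \<times> spins. snd p i) \<in> borel_measurable (borel \<Otimes>\<^sub>M borel)"
    by (rule measurable_compose[OF measurable_snd measurable_coordinate])
  then have 2: "(\<lambda>p::config \<times> spins. of_bool (snd p i) :: nat) \<in> borel_measurable (borel \<Otimes>\<^sub>M borel)"
    by (rule measurable_compose) (simp add: borel_measurable_continuous_onI)
  show "(\<lambda>p. combine p i) \<in> borel_measurable (borel \<Otimes>\<^sub>M borel)"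
    using borel_measurable_add[OF 1 2] by (simp add: combine_def case_prod_beta)
qed

lemma Xstar_measurable [measurable]: "Xstar \<in> sets borel" "Xstar_even \<in> sets borel"
proof -
  have [measurable]: "Measurable.pred borel (\<lambda>\<eta>::config. short (\<eta> i))" "Measurable.pred borel (\<lambda>\<eta>::config. even (\<eta> i))" for i
    by (rule measurable_compose[OF measurable_coordinate_count], simp)+
  have "Measurable.pred borel (\<lambda>\<eta>::config. \<forall>i. \<not> (short (\<eta> i) \<and> short (\<eta> (i + 1))))"
    by (intro pred_intros_countable pred_intros_logic) fact+
  then show 1: "Xstar \<in> sets borel" by (simp add: Xstar_def pred_def)
  have "Measurable.pred borel (\<lambda>\<eta>::config. \<forall>i. even (\<eta> i))" by measurable
  then have "{\<eta>::config. \<forall>i. even (\<eta> i)} \<in> sets borel" by (simp add: pred_def)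
  with 1 have "Xstar \<inter> {\<eta>. \<forall>i. even (\<eta> i)} \<in> sets borel" by (rule sets.Int)
  then show "Xstar_even \<in> sets borel" by (simp add: Xstar_even_def Int_def)
qed

section \<open>The coin field and the transition kernel\<close>

lemma prob_space_coins: "prob_space coins"
  unfolding coins_def by (intro prob_space_PiM) unfold_locales

lemma sets_coins: "sets coins = sets borel"
proof -
  have "sets coins = sets (PiM UNIV (\<lambda>_::int. borel :: bool measure))"
    unfolding coins_def by (rule sets_PiM_cong) (auto simp: sets_borel_eq_count_space)
  then show ?thesis using sets_PiM_equal_borel by metis
qed

lemma space_coins: "space coins = UNIV"
  using sets_eq_imp_space_eq[OF sets_coins] by simp

lemma coins_translate: "distr coins borel translate = coins"
proof -
  have "distr (Pi\<^sub>M UNIV (\<lambda>_::int. measure_pmf (bernoulli_pmf (1 / 2)))) (\<Pi>\<^sub>M i\<in>UNIV. measure_pmf (bernoulli_pmf (1 / 2)))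
      (\<lambda>\<omega>. \<lambda>n\<in>UNIV. \<omega> (n - 1)) = (\<Pi>\<^sub>M i\<in>UNIV. measure_pmf (bernoulli_pmf (1 / 2)))"
    by (rule distr_PiM_reindex) (auto intro: measure_pmf.prob_space_axioms)
  then have "distr coins coins translate = coins"
    by (simp add: coins_def translate_def[abs_def] restrict_UNIV)
  moreover have "distr coins borel translate = distr coins coins translate"
    by (rule distr_cong) (simp_all add: sets_coins)
  ultimately show ?thesis by simp
qed

lemma ssm_step_measurable: "(\<lambda>p. ssm_step (fst p) (snd p)) \<in> borel \<Otimes>\<^sub>M borel \<rightarrow>\<^sub>M borel"
proof (rule measurable_coordinatewise_then_product)
  fix i :: int
  let ?B = "(borel :: config measure) \<Otimes>\<^sub>M (borel :: spins measure)"
  have c: "(\<lambda>p. fst p k) \<in> ?B \<rightarrow>\<^sub>M count_space UNIV" for k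
    by (rule measurable_compose[OF measurable_fst measurable_coordinate_count])
  have sh[measurable]: "Measurable.pred ?B (\<lambda>p. short (fst p k))" for k
    by (rule measurable_compose[OF c]) simp
  have "(\<lambda>p. snd p k) \<in> ?B \<rightarrow>\<^sub>M borel" for k
    by (rule measurable_compose[OF measurable_snd measurable_coordinate])
  then have b[measurable]: "Measurable.pred ?B (\<lambda>p. snd p k)" for k
    by (subst measurable_cong_sets[OF refl sets_borel_eq_count_space[symmetric]])
  have [measurable]: "(\<lambda>p. ssm_flux (fst p) (snd p) k) \<in> ?B \<rightarrow>\<^sub>M count_space UNIV" for k
    unfolding ssm_flux_def by measurable
  note [measurable] = c
  have "(\<lambda>p. ssm_step (fst p) (snd p) i) \<in> ?B \<rightarrow>\<^sub>M count_space UNIV"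
    unfolding ssm_step_def by measurable
  then show "(\<lambda>p. ssm_step (fst p) (snd p) i) \<in> borel_measurable ?B"
    by (subst measurable_cong_sets[OF refl sets_borel_eq_count_space])
qed

lemma ssm_step_measurable2: "ssm_step \<eta> \<in> borel \<rightarrow>\<^sub>M borel"
  using measurable_compose[OF measurable_Pair1'[of \<eta>] ssm_step_measurable] by simp

lemma ssm_kernel_measurable [measurable]: "ssm_kernel \<in> borel \<rightarrow>\<^sub>M prob_algebra borel"
proof -
  have "(\<lambda>\<eta>. distr coins borel (ssm_step \<eta>)) \<in> borel \<rightarrow>\<^sub>M prob_algebra borel"
  proof (rule measurable_distr_prob_space2)
    show "(\<lambda>_. coins) \<in> borel \<rightarrow>\<^sub>M prob_algebra borel"
      using prob_space_coins sets_coins by (intro measurable_const) (simp add: space_prob_algebra)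
    show "(\<lambda>(x, y). ssm_step x y) \<in> borel \<Otimes>\<^sub>M borel \<rightarrow>\<^sub>M borel"
      using ssm_step_measurable by (simp add: case_prod_beta')
  qed
  then show ?thesis by (simp add: ssm_kernel_def[abs_def])
qed

interpretation ssm: coded_kernel "borel :: config measure" ssm_kernel config_code config_decode
  by (rule coded_kernel_config[OF ssm_kernel_measurable])

lemma emeasure_ssm_kernel:
  "C \<in> sets borel \<Longrightarrow> emeasure (ssm_kernel \<eta>) C = emeasure coins {b. ssm_step \<eta> b \<in> C}"
  using ssm_step_measurable2 sets_coins
  by (simp add: ssm_kernel_def emeasure_distr space_coins vimage_def cong: measurable_cong_sets)

text \<open>The coins are independent and identically distributed, so a translation of the
  configuration may be accompanied by one of the coins.\<close>

lemma ssm_kernel_translate: "ssm_kernel (translate \<eta>) = distr (ssm_kernel \<eta>) borel translate"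
proof -
  have m: "ssm_step \<eta> \<in> coins \<rightarrow>\<^sub>M borel" "translate \<in> coins \<rightarrow>\<^sub>M borel" for \<eta>
    using ssm_step_measurable2 translate_measurable sets_coins by (simp_all cong: measurable_cong_sets)
  have "ssm_kernel (translate \<eta>) = distr (distr coins borel translate) borel (ssm_step (translate \<eta>))"
    by (simp add: coins_translate ssm_kernel_def)
  also have "\<dots> = distr coins borel (ssm_step (translate \<eta>) \<circ> translate)"
    by (rule distr_distr[OF ssm_step_measurable2 m(2)])
  also have "ssm_step (translate \<eta>) \<circ> translate = translate \<circ> ssm_step \<eta>"
    by (auto simp: ssm_step_translate)
  also have "distr coins borel \<dots> = distr (ssm_kernel \<eta>) borel translate"
    unfolding ssm_kernel_def by (rule distr_distr[OF translate_measurable m(1), symmetric])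
  finally show ?thesis .
qed

lemma ssm_stationary_iff:
  assumes "prob_space M" "sets M = sets borel"
  shows "ssm_stationary M \<longleftrightarrow> ssm.inv_meas M"
proof
  assume h: "ssm_stationary M"
  have K: "ssm_kernel \<in> M \<rightarrow>\<^sub>M subprob_algebra borel"
    using ssm.kernel_subprob assms by (simp cong: measurable_cong_sets)
  have "emeasure M B = (\<integral>\<^sup>+x. emeasure (ssm_kernel x) B \<partial>M)" if "B \<in> sets borel" for B
    using emeasure_bind[OF _ K that] h assms(1) by (simp add: ssm_stationary_def prob_space.not_empty)
  then show "ssm.inv_meas M" using assms by (simp add: invariant_under_def prob_space_def)
next
  assume "ssm.inv_meas M"
  then show "ssm_stationary M" unfolding ssm_stationary_def by (rule ssm.inv_meas_bind)
qed

abbreviation "shift_kernel \<equiv> (\<lambda>\<eta>::config. return borel (translate \<eta>))"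

interpretation shift: markov_kernel "borel :: config measure" shift_kernel
  by (rule markov_kernel_return) auto

lemma transl_inv_iff:
  fixes M :: "config measure"
  assumes "prob_space M" "sets M = sets borel"
  shows "transl_inv M \<longleftrightarrow> shift.inv_meas M"
  using assms by (simp add: invariant_under_return[OF translate_measurable] transl_inv_def push_translate_def prob_space_def)

section \<open>Rectangles and fibres over parity events\<close>

definition rect :: "config set \<Rightarrow> spins set \<Rightarrow> config set" where
  "rect C B = {\<eta>. even_part \<eta> \<in> C \<and> odd_sites \<eta> \<in> B}"

lemma rect_measurable [measurable (raw)]:
  "C \<in> sets borel \<Longrightarrow> B \<in> sets borel \<Longrightarrow> rect C B \<in> sets borel"
  using sets.Int[OF measurable_sets[OF even_part_measurable, of C] measurable_sets[OF odd_sites_measurable, of B]]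
  by (simp add: rect_def vimage_def Int_def)

text \<open>Passing to the pair of even part and parities loses nothing, since
  \<open>combine\<close> recovers the configuration; on the product space the rectangles form a
  generator stable under intersection.\<close>

lemma measure_eqI_rect:
  assumes s: "sets M1 = sets borel" "sets M2 = sets borel" and fin: "finite_measure M1"
    and eq: "\<And>C B. C \<in> sets borel \<Longrightarrow> B \<in> sets borel \<Longrightarrow> emeasure M1 (rect C B) = emeasure M2 (rect C B)"
  shows "M1 = M2"
proof -
  let ?S = "\<lambda>\<eta>. (even_part \<eta>, odd_sites \<eta>)"
  let ?P = "(borel :: config measure) \<Otimes>\<^sub>M (borel :: spins measure)"
  have S: "?S \<in> borel \<rightarrow>\<^sub>M ?P" by measurable
  have S': "?S \<in> M1 \<rightarrow>\<^sub>M ?P" "?S \<in> M2 \<rightarrow>\<^sub>M ?P" using S s by (simp_all cong: measurable_cong_sets)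
  have sp: "space M1 = UNIV" "space M2 = UNIV" using sets_eq_imp_space_eq[OF s(1)] sets_eq_imp_space_eq[OF s(2)] by simp_all
  have "distr M1 ?P ?S = distr M2 ?P ?S"
  proof (rule measure_eqI_generator_eq[where A="\<lambda>_. UNIV" and \<Omega>=UNIV])
    let ?E = "{a \<times> b |a b. a \<in> sets (borel :: config measure) \<and> b \<in> sets (borel :: spins measure)}"
    show "Int_stable ?E" by (rule Int_stable_pair_measure_generator)
    show "sets (distr M1 ?P ?S) = sigma_sets UNIV ?E" "sets (distr M2 ?P ?S) = sigma_sets UNIV ?E"
      by (simp_all add: sets_pair_measure)
    show "emeasure (distr M1 ?P ?S) X = emeasure (distr M2 ?P ?S) X" if "X \<in> ?E" for X
    proof -
      obtain C B where X: "X = C \<times> B" and CB: "C \<in> sets borel" "B \<in> sets borel" using \<open>X \<in> ?E\<close> by auto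
      have "?S -` X = rect C B" by (auto simp: X rect_def)
      then show ?thesis using eq[OF CB] S' CB X sp by (simp add: emeasure_distr)
    qed
    have "UNIV \<times> UNIV \<in> ?E"
      using sets.top[of "borel :: config measure"] sets.top[of "borel :: spins measure"]
      by (intro CollectI exI[of _ UNIV] conjI refl) simp_all
    then show "range (\<lambda>_::nat. UNIV) \<subseteq> ?E" by auto
    show "emeasure (distr M1 ?P ?S) UNIV \<noteq> \<infinity>"
      using finite_measure.emeasure_finite[OF finite_measure.finite_measure_distr[OF fin S'(1)]] by simp
  qed auto
  then have "distr (distr M1 ?P ?S) borel combine = distr (distr M2 ?P ?S) borel combine" by simp
  then have "distr M1 borel (\<lambda>x. x) = distr M2 borel (\<lambda>x. x)"
    using S' by (simp add: distr_distr comp_def)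
  then show ?thesis using s by (simp add: distr_id2)
qed

text \<open>An unnormalised conditional law of the even part given a parity event. Working with all
  events \<open>B\<close> instead of single parity configurations avoids disintegration and division
  by zero.\<close>

definition fibre :: "config measure \<Rightarrow> spins set \<Rightarrow> config measure" where
  "fibre M B = distr (density M (indicator (odd_sites -` B))) borel even_part"

lemma odd_sites_vimage [measurable (raw)]: "B \<in> sets borel \<Longrightarrow> odd_sites -` B \<in> sets borel"
  using measurable_sets[OF odd_sites_measurable, of B] by simp

lemma even_part_vimage [measurable (raw)]: "B \<in> sets borel \<Longrightarrow> even_part -` B \<in> sets borel"
  using measurable_sets[OF even_part_measurable, of B] by simp

lemma nn_integral_fibre:
  assumes s: "sets M = sets borel" and B: "B \<in> sets borel" and h: "h \<in> borel_measurable borel"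
  shows "(\<integral>\<^sup>+x. h x \<partial>fibre M B) = (\<integral>\<^sup>+x. h (even_part x) * indicator B (odd_sites x) \<partial>M)"
proof -
  have m: "even_part \<in> density M (indicator (odd_sites -` B)) \<rightarrow>\<^sub>M borel"
    "odd_sites -` B \<in> sets M" "(\<lambda>x. h (even_part x)) \<in> borel_measurable M"
    using s B measurable_compose[OF even_part_measurable h] even_part_measurable
    by (simp_all add: odd_sites_vimage cong: measurable_cong_sets)
  show ?thesis unfolding fibre_def using m h
    by (simp add: nn_integral_distr nn_integral_density indicator_vimage mult.commute comp_def)
qed

lemma sets_fibre [simp]: "sets (fibre M B) = sets borel"
  by (simp add: fibre_def)

lemma emeasure_fibre:
  assumes s: "sets M = sets borel" and B: "B \<in> sets borel" and C: "C \<in> sets borel"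
  shows "emeasure (fibre M B) C = emeasure M (rect C B)"
proof -
  have "emeasure (fibre M B) C = (\<integral>\<^sup>+x. indicator C x \<partial>fibre M B)" using C by simp
  also have "\<dots> = (\<integral>\<^sup>+x. indicator (rect C B) x \<partial>M)"
    unfolding nn_integral_fibre[OF s B borel_measurable_indicator[OF C]]
    by (intro nn_integral_cong) (auto simp: rect_def split: split_indicator)
  finally show ?thesis using rect_measurable[OF C B] s by simp
qed

lemma finite_measure_fibre:
  assumes "finite_measure M" and s: "sets M = sets borel" and B: "B \<in> sets borel"
  shows "finite_measure (fibre M B)"
proof (rule finite_measureI)
  have "space (fibre M B) = UNIV" by (simp add: fibre_def)
  then have "emeasure (fibre M B) (space (fibre M B)) = emeasure M (rect UNIV B)"
    using emeasure_fibre[OF s B, of UNIV] by simp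
  then show "emeasure (fibre M B) (space (fibre M B)) \<noteq> \<infinity>"
    using finite_measure.emeasure_finite[OF assms(1)] by simp
qed

lemma ssm_kernel_rect:
  assumes "\<eta> \<in> Xstar" and C: "C \<in> sets borel" and B: "B \<in> sets borel"
  shows "emeasure (ssm_kernel \<eta>) (rect C B) = emeasure (ssm_kernel (even_part \<eta>)) C * indicator B (odd_sites \<eta>)"
  using C B by (simp add: emeasure_ssm_kernel rect_measurable rect_def even_part_ssm_step[OF assms(1)]
      odd_sites_ssm_step[OF assms(1)] split: split_indicator)

lemma nn_integral_kernel_rect:
  assumes s: "sets M = sets borel" and X: "AE \<eta> in M. \<eta> \<in> Xstar"
    and C: "C \<in> sets borel" and B: "B \<in> sets borel"
  shows "(\<integral>\<^sup>+x. emeasure (ssm_kernel x) (rect C B) \<partial>M) = (\<integral>\<^sup>+x. emeasure (ssm_kernel x) C \<partial>fibre M B)"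
  unfolding nn_integral_fibre[OF s B measurable_emeasure_kernel[OF ssm.kernel_subprob C]]
  by (rule nn_integral_cong_AE) (use X in \<open>eventually_elim, simp add: ssm_kernel_rect C B\<close>)

text \<open>The parities of the stacks are conserved, so stationarity can be tested on each event that
  depends on the parities only.\<close>

lemma inv_meas_iff_fibre:
  assumes s: "sets M = sets borel" and fin: "finite_measure M" and X: "AE \<eta> in M. \<eta> \<in> Xstar"
  shows "ssm.inv_meas M \<longleftrightarrow> (\<forall>B\<in>sets borel. ssm.inv_meas (fibre M B))"
proof (intro iffI ballI)
  fix B :: "spins set" assume M: "ssm.inv_meas M" and B: "B \<in> sets borel"
  show "ssm.inv_meas (fibre M B)"
    unfolding invariant_under_def
  proof (intro conjI ballI)
    show "finite_measure (fibre M B)" by (rule finite_measure_fibre[OF fin s B])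
    show "emeasure (fibre M B) C = (\<integral>\<^sup>+x. emeasure (ssm_kernel x) C \<partial>fibre M B)" if C: "C \<in> sets borel" for C
      using ssm.inv_measD(4)[OF M rect_measurable[OF C B]] nn_integral_kernel_rect[OF s X C B]
      by (simp add: emeasure_fibre[OF s B C])
  qed simp
next
  assume h: "\<forall>B\<in>sets borel. ssm.inv_meas (fibre M B)"
  have K: "ssm_kernel \<in> M \<rightarrow>\<^sub>M subprob_algebra borel"
    using ssm.kernel_subprob s by (simp cong: measurable_cong_sets)
  have ne: "space M \<noteq> {}" using sets_eq_imp_space_eq[OF s] by simp
  have sK: "sets (M \<bind> ssm_kernel) = sets borel" using ne by (intro sets_bind) auto
  have eqK: "emeasure (M \<bind> ssm_kernel) A = (\<integral>\<^sup>+x. emeasure (ssm_kernel x) A \<partial>M)" if "A \<in> sets borel" for A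
    by (rule emeasure_bind[OF ne K that])
  have "M = M \<bind> ssm_kernel"
  proof (rule measure_eqI_rect[OF s sK fin])
    fix C :: "config set" and B :: "spins set" assume C: "C \<in> sets borel" and B: "B \<in> sets borel"
    show "emeasure M (rect C B) = emeasure (M \<bind> ssm_kernel) (rect C B)"
      using h B ssm.inv_measD(4)[OF _ C, of "fibre M B"]
      by (simp add: eqK rect_measurable C nn_integral_kernel_rect[OF s X C B] emeasure_fibre[OF s B C])
  qed
  then show "ssm.inv_meas M" using eqK s fin by (simp add: invariant_under_def)
qed

section \<open>Cyclic atoms of an ergodic shift\<close>

definition zshift :: "int \<Rightarrow> (int \<Rightarrow> 'a) \<Rightarrow> int \<Rightarrow> 'a" where
  "zshift k \<eta> = (\<lambda>i. \<eta> (i - k))"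

text \<open>The image of \<open>B\<close> under the shift by \<open>k\<close>, written as a preimage
  so that measurability is immediate.\<close>

definition zimg :: "int \<Rightarrow> (int \<Rightarrow> 'a) set \<Rightarrow> (int \<Rightarrow> 'a) set" where
  "zimg k B = zshift (- k) -` B"

lemma zshift_add: "zshift k (zshift l \<eta>) = zshift (k + l) \<eta>"
  by (auto simp: zshift_def algebra_simps)

lemma zshift_0 [simp]: "zshift 0 = id"
  by (auto simp: zshift_def)

lemma zimg_add: "zimg k (zimg l B) = zimg (k + l) B"
  by (auto simp: zimg_def zshift_add add.commute)

lemma zimg_0 [simp]: "zimg 0 B = B"
  by (simp add: zimg_def)

lemma zimg_iff: "\<eta> \<in> zimg k B \<longleftrightarrow> zshift (- k) \<eta> \<in> B"
  by (simp add: zimg_def)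

lemma zimg_UN: "zimg k (\<Union>i\<in>I. F i) = (\<Union>i\<in>I. zimg k (F i))"
  by (auto simp: zimg_iff)

lemma translate_pow_eq_zshift: "translate ^^ n = zshift (int n)"
  by (intro ext) (simp add: zshift_def translate_pow)

lemma translate_eq_zshift: "translate = zshift 1"
  by (auto simp: zshift_def translate_def)

lemma image_translate: "translate ` B = zimg 1 B"
proof (rule set_eqI)
  fix x :: "int \<Rightarrow> 'a"
  have "x = translate (zshift (-1) x)" by (simp add: translate_eq_zshift zshift_add)
  moreover have "zshift (-1) (translate y) = y" for y :: "int \<Rightarrow> 'a"
    by (simp add: translate_eq_zshift zshift_add)
  ultimately show "x \<in> translate ` B \<longleftrightarrow> x \<in> zimg 1 B" by (auto simp: zimg_iff)
qed

lemma vimage_translate_pow: "(translate ^^ n) -` B = zimg (- int n) B"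
  by (auto simp: zimg_iff translate_pow_eq_zshift)

lemma vimage_translate: "translate -` B = zimg (- 1) B"
  using vimage_translate_pow[of 1 B] by simp

lemma zimg_eq_minus: "zimg k B = B \<longleftrightarrow> zimg (- k) B = B"
proof -
  have "zimg (- k) (zimg k B) = B" "zimg k (zimg (- k) B) = B" by (simp_all add: zimg_add)
  then show ?thesis by metis
qed

lemma zshift_measurable [measurable]:
  "zshift k \<in> (borel :: (int \<Rightarrow> 'a::second_countable_topology) measure) \<rightarrow>\<^sub>M borel"
  by (rule measurable_coordinatewise_then_product) (simp add: zshift_def)

lemma zimg_measurable [measurable (raw)]:
  "B \<in> sets (borel :: (int \<Rightarrow> 'a::second_countable_topology) measure) \<Longrightarrow> zimg k B \<in> sets borel"
  unfolding zimg_def using measurable_sets[OF zshift_measurable, of B "- k"] by simp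

lemma partition_family_zimg:
  assumes "partition_family lam m A" "k < m"
  shows "zimg (int i) (A k) = A ((k + i) mod m)"
proof (induction i)
  case (Suc i)
  have "zimg (int (Suc i)) (A k) = translate ` zimg (int i) (A k)"
    by (simp add: image_translate zimg_add)
  also have "\<dots> = A (((k + i) mod m + 1) mod m)"
  proof -
    have "(k + i) mod m < m" using assms by simp
    then show ?thesis using assms(1) by (simp only: partition_family_def Suc)
  qed
  finally show ?case by (simp add: mod_simps)
qed (use assms in simp)

text \<open>Used both for the law of the parities and for the even marginal, hence the general
  alphabet.\<close>

locale shift_invariant = prob_space lam
  for lam :: "(int \<Rightarrow> 'a::second_countable_topology) measure" +
  assumes sets_lam: "sets lam = sets borel"
    and lam_translate: "distr lam borel translate = lam"
begin

lemma space_lam [simp]: "space lam = UNIV"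
  using sets_eq_imp_space_eq[OF sets_lam] by simp

lemma lam_measurable: "zshift k \<in> lam \<rightarrow>\<^sub>M borel"
  by (subst measurable_cong_sets[OF sets_lam refl]) (rule zshift_measurable)

lemma distr_zshift: "distr lam borel (zshift k) = lam"
proof -
  have nat: "distr lam borel (zshift (int n)) = lam" for n
  proof (induction n)
    case 0
    show ?case using distr_id2[OF sets_lam[symmetric]] by (simp add: id_def)
  next
    case (Suc n)
    have "distr (distr lam borel (zshift (int n))) borel (zshift 1) = distr lam borel (zshift 1 \<circ> zshift (int n))"
      by (rule distr_distr[OF zshift_measurable lam_measurable])
    moreover have "zshift 1 \<circ> zshift (int n) = (zshift (int (Suc n)) :: (int \<Rightarrow> 'a) \<Rightarrow> _)"
      by (auto simp: zshift_add)
    ultimately show ?case using Suc lam_translate by (simp add: translate_eq_zshift)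
  qed
  show ?thesis
  proof (cases "k \<ge> 0")
    case True
    then show ?thesis using nat[of "nat k"] by simp
  next
    case False
    then have "distr lam borel (zshift (- k)) = lam" using nat[of "nat (- k)"] by simp
    then have "distr lam borel (zshift k) = distr (distr lam borel (zshift (- k))) borel (zshift k)" by simp
    also have "\<dots> = distr lam borel (zshift k \<circ> zshift (- k))"
      by (rule distr_distr[OF zshift_measurable lam_measurable])
    also have "zshift k \<circ> zshift (- k) = (\<lambda>x::int \<Rightarrow> 'a. x)"
      by (auto simp: zshift_add)
    finally show ?thesis using distr_id2[OF sets_lam[symmetric]] by simp
  qed
qed

lemma measure_zimg: "B \<in> sets borel \<Longrightarrow> measure lam (zimg k B) = measure lam B"
  using measure_distr[OF lam_measurable, of B "- k"] distr_zshift[of "- k"] by (simp add: zimg_def)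

lemma AE_not_inI: "C \<in> sets borel \<Longrightarrow> measure lam C = 0 \<Longrightarrow> AE \<sigma> in lam. \<sigma> \<notin> C"
  by (intro AE_not_in) (simp add: null_sets_def emeasure_eq_measure sets_lam)

lemma AE_zshift:
  assumes "AE \<sigma> in lam. P \<sigma>"
  shows "AE \<sigma> in lam. P (zshift k \<sigma>)"
proof -
  have "AE \<sigma> in distr lam borel (zshift k). P \<sigma>" using assms by (subst distr_zshift)
  then show ?thesis by (rule AE_distrD[OF lam_measurable])
qed

end

lemma ergodic_shift_invariant: "ergodic lam \<Longrightarrow> shift_invariant lam"
  unfolding shift_invariant_def shift_invariant_axioms_def
  by (auto simp: ergodic_def states_on_def transl_inv_def push_translate_def)

lemma ergodic_zero_one:
  assumes "ergodic lam" "B \<in> sets borel" "zimg 1 B = B"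
  shows "measure lam B = 0 \<or> measure lam B = 1"
  using assms zimg_eq_minus[of 1 B] by (auto simp: ergodic_def vimage_translate)

text \<open>By ergodicity a set that is invariant under the \<open>n\<close>-th power of the shift has measure zero or at
  least \<open>1 / n\<close>, so one of nearly minimal positive measure is an atom.\<close>

lemma cyclic_atoms:
  fixes lam :: "spins measure"
  assumes erg: "ergodic lam" and n: "n > 0"
  obtains m q A where "n = q * m" "m > 0" "q > 0" "partition_family lam m A"
    "\<And>C k. C \<in> sets borel \<Longrightarrow> (translate ^^ n) -` C = C \<Longrightarrow> k < m \<Longrightarrow>
      (AE \<sigma> in lam. \<sigma> \<in> A k \<longrightarrow> \<sigma> \<in> C) \<or> (AE \<sigma> in lam. \<sigma> \<in> A k \<longrightarrow> \<sigma> \<notin> C)"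
proof -
  interpret shift_invariant lam by (rule ergodic_shift_invariant[OF erg])
  note s = sets_lam
  define Inv where "Inv B \<longleftrightarrow> B \<in> sets borel \<and> zimg (int n) B = B" for B :: "spins set"
  have Inv_Int: "Inv (B \<inter> C)" "Inv (B - C)" if "Inv B" "Inv C" for B C
    using that by (auto simp: Inv_def zimg_def)
  have Inv_zimg: "Inv (zimg k B)" if "Inv B" for k B
  proof -
    have "zimg (int n) (zimg k B) = zimg k (zimg (int n) B)" by (simp add: zimg_add add.commute)
    then show ?thesis using that by (auto simp: Inv_def zimg_measurable)
  qed
  \<comment> \<open>The union of \<open>n\<close> successive translates of \<open>B\<close> is shift
    invariant and not null, so it has measure one; the translates share the measure of
    \<open>B\<close>.\<close>
  have lower: "1 / real n \<le> measure lam B" if B: "Inv B" "measure lam B > 0" for B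
  proof -
    have Bm: "zimg k B \<in> sets lam" "B \<in> sets borel" for k using B s by (auto simp: Inv_def zimg_measurable)
    let ?U = "\<Union>i\<in>{..<n}. zimg (int i) B"
    have U: "?U \<in> sets borel" using B by (auto simp: Inv_def zimg_measurable)
    have "zimg 1 ?U = (\<Union>i\<in>{..<n}. zimg (int (Suc i)) B)"
      by (simp add: zimg_UN zimg_add)
    also have "\<dots> = (\<Union>i\<in>{0<..n}. zimg (int i) B)"
    proof -
      have e: "Suc ` {..<n} = {0<..n}" by (simp add: lessThan_atLeast0 image_Suc_atLeastLessThan) auto
      have "(\<Union>i\<in>{..<n}. zimg (int (Suc i)) B) = (\<Union>i\<in>Suc ` {..<n}. zimg (int i) B)" by (simp only: image_image)
      then show ?thesis by (simp only: e)
    qed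
    also have "\<dots> = ?U"
    proof (rule set_eqI)
      fix x
      have "zimg (int n) B = zimg (int 0) B" using B by (simp add: Inv_def)
      moreover have "i \<in> {0<..n} \<longleftrightarrow> i = n \<or> (0 < i \<and> i < n)" "i \<in> {..<n} \<longleftrightarrow> i = 0 \<or> (0 < i \<and> i < n)" for i
        using n by auto
      ultimately show "x \<in> (\<Union>i\<in>{0<..n}. zimg (int i) B) \<longleftrightarrow> x \<in> ?U" by (simp only: UN_iff) metis
    qed
    finally have "measure lam ?U = 0 \<or> measure lam ?U = 1" by (rule ergodic_zero_one[OF erg U])
    moreover have "measure lam B \<le> measure lam ?U"
      using n U s Bm by (intro finite_measure_mono) (auto intro!: bexI[of _ 0])
    ultimately have "measure lam ?U = 1" using B by simp
    moreover have "measure lam ?U \<le> (\<Sum>i<n. measure lam (zimg (int i) B))"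
      using Bm by (intro finite_measure_subadditive_finite) auto
    ultimately show ?thesis using Bm n by (simp add: measure_zimg field_simps)
  qed
  define S where "S = {measure lam B |B. Inv B \<and> measure lam B > 0}"
  have "Inv UNIV" by (simp add: Inv_def zimg_def)
  then have Sne: "S \<noteq> {}" using prob_space by (auto simp: S_def)
  have Sb: "bdd_below S" using lower by (auto simp: S_def intro!: bdd_belowI[where m="1 / real n"])
  have S_ge: "1 / real n \<le> Inf S" using lower by (intro cInf_greatest[OF Sne]) (auto simp: S_def)
  \<comment> \<open>Within \<open>1 / n\<close> of the infimum: splitting \<open>B0\<close> into two
    invariant pieces of positive measure would require at least \<open>Inf S\<close> for one and
    \<open>1 / n\<close> for the other.\<close>
  obtain B0 where B0: "Inv B0" "measure lam B0 > 0" "measure lam B0 < Inf S + 1 / real n"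
    using cInf_lessD[OF Sne, of "Inf S + 1 / real n"] n by (auto simp: S_def)
  have B0m: "B0 \<in> sets borel" "B0 \<in> sets lam" using B0 s by (auto simp: Inv_def)
  have atom: "measure lam (B0 \<inter> C) = 0 \<or> measure lam (B0 - C) = 0" if C: "Inv C" for C
  proof (rule ccontr)
    assume "\<not> ?thesis"
    then have p: "measure lam (B0 \<inter> C) > 0" "measure lam (B0 - C) > 0" by (auto simp: less_le)
    have "Inf S \<le> measure lam (B0 \<inter> C)"
      using p Inv_Int[OF B0(1) C] by (intro cInf_lower[OF _ Sb]) (auto simp: S_def)
    moreover have "1 / real n \<le> measure lam (B0 - C)" using lower[OF _ p(2)] Inv_Int[OF B0(1) C] by simp
    moreover have "measure lam B0 = measure lam (B0 \<inter> C) + measure lam (B0 - C)"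
      using C s B0m by (subst finite_measure_Union[symmetric]) (auto simp: Inv_def Int_Diff_Un)
    ultimately show False using B0(3) by linarith
  qed
  \<comment> \<open>The shifts that return \<open>B0\<close> to itself modulo null sets form a
    subgroup of the integers containing \<open>n\<close>; its positive generator \<open>m\<close>
    will be the number of cells.\<close>
  define e where "e k \<longleftrightarrow> (AE \<sigma> in lam. \<sigma> \<in> B0 \<longleftrightarrow> zshift (- k) \<sigma> \<in> B0)" for k
  have e_add: "e (k + l)" if "e k" "e l" for k l
    using that(1) AE_zshift[OF that(2)[unfolded e_def], of "- k"] unfolding e_def
    by eventually_elim (simp add: zshift_add algebra_simps)
  have e_minus: "e (- k)" if "e k" for k
    using AE_zshift[OF that[unfolded e_def], of k] unfolding e_def
    by eventually_elim (simp add: zshift_add)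
  have e_mult: "e (k * int l)" if "e k" for k l
  proof (induction l)
    case (Suc l)
    then show ?case using e_add[OF that Suc] by (simp add: algebra_simps)
  qed (simp add: e_def)
  have e_n: "e (int n)"
  proof -
    have "\<sigma> \<in> B0 \<longleftrightarrow> zshift (- int n) \<sigma> \<in> B0" for \<sigma> using B0(1) by (auto simp: Inv_def simp flip: zimg_iff)
    then show ?thesis by (simp add: e_def)
  qed
  \<comment> \<open>A translate of an atom coincides with it or is disjoint from it modulo null
    sets: what the translate leaves out of \<open>B0\<close> is null, and the two sets have equal
    measure.\<close>
  have e_pos: "e k" if "measure lam (B0 \<inter> zimg k B0) > 0" for k
  proof -
    have "measure lam (B0 - zimg k B0) = 0" using atom[OF Inv_zimg[OF B0(1)], of k] that by simp
    moreover have "measure lam (zimg k B0 - B0) = measure lam (B0 - zimg k B0)"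
      using B0m s finite_measure_Diff'[of B0 "zimg k B0"] finite_measure_Diff'[of "zimg k B0" B0] measure_zimg[OF B0m(1), of k]
      by (simp add: zimg_measurable Int_commute)
    ultimately have "AE \<sigma> in lam. \<sigma> \<notin> B0 - zimg k B0" "AE \<sigma> in lam. \<sigma> \<notin> zimg k B0 - B0"
      using B0m by (intro AE_not_inI sets.Diff zimg_measurable; simp)+
    then show ?thesis unfolding e_def by eventually_elim (auto simp: zimg_iff)
  qed
  have pos_e: "measure lam (B0 \<inter> zimg k B0) > 0" if "e k" for k
  proof -
    have "measure lam (B0 \<inter> zimg k B0) = measure lam B0"
      using that B0m s unfolding e_def by (intro finite_measure_eq_AE) (auto simp: zimg_iff zimg_measurable)
    then show ?thesis using B0 by simp
  qed
  define m where "m = (LEAST i. 0 < i \<and> e (int i))"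
  have m: "0 < m" "e (int m)" using LeastI[of "\<lambda>i. 0 < i \<and> e (int i)" n] n e_n by (auto simp: m_def)
  have m_least: "\<not> e (int i)" if "0 < i" "i < m" for i
    using not_less_Least[of i "\<lambda>i. 0 < i \<and> e (int i)"] that by (auto simp: m_def)
  have "n mod m = 0"
  proof (rule ccontr)
    assume "n mod m \<noteq> 0"
    moreover have "int (n mod m) = int n + - (int m * int (n div m))"
    proof -
      have "int (n mod m) + int m * int (n div m) = int n"
        using arg_cong[OF mod_mult_div_eq[of n m], of int] by (simp only: of_nat_add of_nat_mult)
      then show ?thesis by simp
    qed
    then have "e (int (n mod m))" using e_add[OF e_n e_minus[OF e_mult[OF m(2)]]] by simp
    ultimately show False using m_least[of "n mod m"] m by simp
  qed
  then obtain q where q: "n = q * m" by (auto simp: mod_eq_0_iff_dvd dvd_def mult.commute)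
  then have q0: "q > 0" using n by simp
  \<comment> \<open>A partition requires the cells to be permuted exactly, not just modulo null
    sets. Intersecting over one period yields a version of \<open>B0\<close> fixed by the shift by
    \<open>m\<close>.\<close>
  define B1 where "B1 = (\<Inter>l<q. zimg (int m * int l) B0)"
  have B1m: "B1 \<in> sets borel" unfolding B1_def using q0 B0m by (intro sets.countable_INT'') (auto simp: zimg_measurable)
  have B1_fix: "zimg (int m) B1 = B1"
  proof (rule set_eqI)
    fix x
    have 1: "zimg (int m * int q) B0 = zimg (int m * int 0) B0" using B0(1) q by (simp add: Inv_def mult.commute)
    have "x \<in> zimg (int m) B1 \<longleftrightarrow> (\<forall>l<q. x \<in> zimg (int m * int (Suc l)) B0)"
      by (auto simp: B1_def zimg_iff zshift_add algebra_simps)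
    also have "\<dots> \<longleftrightarrow> (\<forall>l<q. x \<in> zimg (int m * int l) B0)"
    proof
      assume h: "\<forall>l<q. x \<in> zimg (int m * int (Suc l)) B0"
      have "x \<in> zimg (int m * int l) B0" if "l < q" for l
      proof (cases l)
        case 0
        then show ?thesis using h[rule_format, of "q - 1"] q0 1 by simp
      next
        case (Suc l')
        then show ?thesis using h[rule_format, of l'] that by simp
      qed
      then show "\<forall>l<q. x \<in> zimg (int m * int l) B0" by blast
    next
      assume h: "\<forall>l<q. x \<in> zimg (int m * int l) B0"
      have "x \<in> zimg (int m * int (Suc l)) B0" if "l < q" for l
      proof (cases "Suc l = q")
        case True
        then show ?thesis using h[rule_format, of 0] q0 1 by simp
      next
        case False
        then show ?thesis using h[rule_format, of "Suc l"] that by simp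
      qed
      then show "\<forall>l<q. x \<in> zimg (int m * int (Suc l)) B0" by blast
    qed
    finally show "x \<in> zimg (int m) B1 \<longleftrightarrow> x \<in> B1" by (auto simp: B1_def)
  qed
  have B1_B0: "AE \<sigma> in lam. \<sigma> \<in> B1 \<longleftrightarrow> \<sigma> \<in> B0"
  proof -
    have "AE \<sigma> in lam. \<forall>l. \<sigma> \<in> B0 \<longleftrightarrow> zshift (- (int m * int l)) \<sigma> \<in> B0"
      using e_mult[OF m(2)] by (simp add: AE_all_countable e_def)
    then show ?thesis by eventually_elim (use q0 in \<open>auto simp: B1_def zimg_iff\<close>)
  qed
  define A where "A k = zimg (int k) B1" for k
  have Am: "A k \<in> sets borel" for k by (simp add: A_def B1m zimg_measurable)
  have A_shift: "translate ` A k = A ((k + 1) mod m)" if "k < m" for k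
  proof (cases "k + 1 = m")
    case True
    then show ?thesis using B1_fix by (simp add: A_def image_translate zimg_add add.commute)
      (metis True add.commute of_nat_Suc Suc_eq_plus1)
  next
    case False
    then show ?thesis using that by (simp add: A_def image_translate zimg_add add.commute)
  qed
  have A_AE: "AE \<sigma> in lam. \<sigma> \<in> A k \<longleftrightarrow> zshift (- int k) \<sigma> \<in> B0" for k
    using AE_zshift[OF B1_B0, of "- int k"] by eventually_elim (simp add: A_def zimg_iff)
  have disj: "AE \<sigma> in lam. \<sigma> \<notin> A i \<inter> A j" if "i < j" "j < m" for i j
  proof -
    have "\<not> e (int (j - i))" using m_least[of "j - i"] that by simp
    then have "measure lam (B0 \<inter> zimg (int (j - i)) B0) = 0"
      using e_pos[of "int (j - i)"] by (auto simp: less_le)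
    then have "AE \<sigma> in lam. \<sigma> \<notin> B0 \<inter> zimg (int (j - i)) B0"
      using B0m by (intro AE_not_inI sets.Int zimg_measurable)
    from AE_zshift[OF this, of "- int i"] A_AE[of i] A_AE[of j]
    show ?thesis
    proof eventually_elim
      case (elim \<sigma>)
      have "zshift (- int (j - i)) (zshift (- int i) \<sigma>) = zshift (- int j) \<sigma>"
        using that by (simp add: zshift_add)
      then show ?case using elim by (auto simp: zimg_iff)
    qed
  qed
  \<comment> \<open>The union of the cells is shift invariant and contains a set of positive
    measure, so ergodicity makes it full.\<close>
  have cover: "AE \<sigma> in lam. \<sigma> \<in> (\<Union>i<m. A i)"
  proof -
    have U: "(\<Union>i<m. A i) \<in> sets borel" using Am by auto
    have "zimg 1 (\<Union>i<m. A i) = (\<Union>i<m. translate ` A i)"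
      by (auto simp: image_translate zimg_iff)
    also have "\<dots> = (\<Union>i<m. A ((i + 1) mod m))" using A_shift by simp
    also have "\<dots> = (\<Union>i<m. A i)"
    proof -
      have e: "(\<lambda>i. (i + 1) mod m) ` {..<m} = {..<m}"
      proof (intro equalityI subsetI)
        fix j assume "j \<in> {..<m}"
        then have "j = (\<lambda>i. (i + 1) mod m) ((j + m - 1) mod m)" "(j + m - 1) mod m \<in> {..<m}"
          using m(1) by (auto simp: mod_simps)
        then show "j \<in> (\<lambda>i. (i + 1) mod m) ` {..<m}" by blast
      qed (use m in auto)
      have "(\<Union>i<m. A ((i + 1) mod m)) = (\<Union>i\<in>(\<lambda>i. (i + 1) mod m) ` {..<m}. A i)" by (simp only: image_image)
      then show ?thesis by (simp only: e)
    qed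
    finally have "measure lam (\<Union>i<m. A i) = 0 \<or> measure lam (\<Union>i<m. A i) = 1" by (rule ergodic_zero_one[OF erg U])
    moreover have "measure lam B0 = measure lam B1"
      using B1_B0 B0m B1m s by (intro finite_measure_eq_AE) auto
    moreover have "measure lam B1 \<le> measure lam (\<Union>i<m. A i)"
      using U s m by (intro finite_measure_mono) (auto intro!: bexI[of _ 0] simp: A_def)
    ultimately have "measure lam (\<Union>i<m. A i) = 1" using B0 by simp
    then show ?thesis using AE_in_set_eq_1[of "\<Union>i<m. A i"] U s by (simp add: emeasure_eq_measure)
  qed
  show ?thesis
  proof (rule that[OF q m(1) q0])
    show "partition_family lam m A"
      unfolding partition_family_def using Am cover disj A_shift by blast
    fix C :: "spins set" and k assume C: "C \<in> sets borel" "(translate ^^ n) -` C = C" "k < m"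
    then have "Inv C" using zimg_eq_minus[of "int n" C] by (simp add: Inv_def vimage_translate_pow)
    then have Ck: "Inv (zimg (- int k) C)" by (rule Inv_zimg)
    have mm: "B0 \<inter> zimg (- int k) C \<in> sets borel" "B0 - zimg (- int k) C \<in> sets borel"
      using B0m C(1) by (intro sets.Int sets.Diff zimg_measurable; simp)+
    from atom[OF Ck] have "(AE \<sigma> in lam. \<sigma> \<notin> B0 \<inter> zimg (- int k) C) \<or> (AE \<sigma> in lam. \<sigma> \<notin> B0 - zimg (- int k) C)"
      using AE_not_inI[OF mm(1)] AE_not_inI[OF mm(2)] by blast
    then show "(AE \<sigma> in lam. \<sigma> \<in> A k \<longrightarrow> \<sigma> \<in> C) \<or> (AE \<sigma> in lam. \<sigma> \<in> A k \<longrightarrow> \<sigma> \<notin> C)"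
    proof
      assume "AE \<sigma> in lam. \<sigma> \<notin> B0 \<inter> zimg (- int k) C"
      from AE_zshift[OF this, of "- int k"] A_AE[of k]
      have "AE \<sigma> in lam. \<sigma> \<in> A k \<longrightarrow> \<sigma> \<notin> C" by eventually_elim (auto simp: zimg_iff zshift_add)
      then show ?thesis ..
    next
      assume "AE \<sigma> in lam. \<sigma> \<notin> B0 - zimg (- int k) C"
      from AE_zshift[OF this, of "- int k"] A_AE[of k]
      have "AE \<sigma> in lam. \<sigma> \<in> A k \<longrightarrow> \<sigma> \<in> C" by eventually_elim (auto simp: zimg_iff zshift_add)
      then show ?thesis ..
    qed
  qed
qed

text \<open>An invariant measure carried by an atom of the invariant \<open>\<sigma>\<close>-algebra is a multiple of the
  restriction of \<open>lam\<close>: the ergodic limit of an indicator is constant on the atom.\<close>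

lemma invariant_on_atom:
  fixes lam w :: "'a measure" and N T
  assumes N: "space N = UNIV" and T: "T \<in> N \<rightarrow>\<^sub>M N"
    and lam: "prob_space lam" "sets lam = sets N" "distr lam N T = lam"
    and w: "finite_measure w" "sets w = sets N" "distr w N T = w" "absolutely_continuous lam w"
    and A: "A \<in> sets N" "T -` A = A" "AE \<sigma> in w. \<sigma> \<in> A"
    and atom: "\<And>C. C \<in> sets N \<Longrightarrow> T -` C = C \<Longrightarrow>
      (AE \<sigma> in lam. \<sigma> \<in> A \<longrightarrow> \<sigma> \<in> C) \<or> (AE \<sigma> in lam. \<sigma> \<in> A \<longrightarrow> \<sigma> \<notin> C)"
    and B: "B \<in> sets N"
  shows "measure w B * measure lam A = measure w UNIV * measure lam (B \<inter> A)"
proof (cases "measure lam A = 0")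
  case True
  interpret lam: prob_space lam by fact
  interpret w: finite_measure w by fact
  have "measure lam (B \<inter> A) \<le> measure lam A" using A B lam(2) by (intro lam.finite_measure_mono) auto
  then have "measure lam (B \<inter> A) = 0" using True by (simp add: antisym)
  then show ?thesis using True by simp
next
  case False
  interpret lam: prob_space lam by fact
  interpret w: finite_measure w by fact
  let ?K = "\<lambda>x. return N (T x)"
  interpret M: markov_kernel N ?K by (rule markov_kernel_return[OF N T])
  have inv: "M.inv_meas lam" "M.inv_meas w"
    using lam w by (simp_all add: invariant_under_return[OF T] lam.finite_measure_axioms)
  let ?f = "indicat_real B"
  have f: "?f \<in> borel_measurable N" "0 \<le> ?f x" "?f x \<le> 1" for x
    using B by (auto split: split_indicator)
  obtain c g where c: "\<And>j. c j \<in> borel_measurable N" "\<And>j x. 0 \<le> c j x" "\<And>j x. c j x \<le> 1"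
    and g: "g \<in> borel_measurable N" "\<And>x. 0 \<le> g x" "\<And>x. g x \<le> 1"
    and cg: "AE x in lam. (\<lambda>j. c j x) \<longlonglongrightarrow> g x"
    and cf: "\<And>\<mu> j. M.inv_meas \<mu> \<Longrightarrow> (\<integral>x. c j x \<partial>\<mu>) = (\<integral>x. ?f x \<partial>\<mu>)"
    and gK: "AE x in lam. kint ?K g x = g x"
    by (rule M.mean_ergodic[OF inv(1) lam(1) f]) blast
  have gT: "AE x in lam. g (T x) = g x" using gK by (simp add: kint_return[OF N g(1)])
  have Tl: "T \<in> lam \<rightarrow>\<^sub>M N" using T lam(2) by (simp cong: measurable_cong_sets)
  have AE_T: "AE x in lam. P (T x)" if "AE x in lam. P x" for P
    using AE_distrD[OF Tl, of P, unfolded lam(3)] that by blast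
  have "AE x in lam. g ((T ^^ j) x) = g x" for j
  proof (induction j)
    case (Suc j)
    show ?case using AE_T[OF Suc] gT by eventually_elim (simp add: funpow_swap1)
  qed simp
  then have gTj: "AE x in lam. \<forall>j. g ((T ^^ j) x) = g x" by (simp add: AE_all_countable)
  have Tj: "T ^^ j \<in> N \<rightarrow>\<^sub>M N" for j
  proof (induction j)
    case 0
    show ?case by (simp add: id_def)
  next
    case (Suc j)
    show ?case unfolding funpow.simps by (rule measurable_comp[OF Suc T])
  qed
  have dich: "(AE x in lam. x \<in> A \<longrightarrow> r < g x) \<or> (AE x in lam. x \<in> A \<longrightarrow> \<not> r < g x)" for r
  proof -
    \<comment> \<open>An exactly \<open>T\<close>-invariant version of \<open>{g > r}\<close>: a
      condition on all late iterates is not affected by one further application of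
      \<open>T\<close>.\<close>
    define C where "C = {x. \<exists>k. \<forall>j\<ge>k. r < g ((T ^^ j) x)}"
    have "Measurable.pred N (\<lambda>x. r < g ((T ^^ j) x))" for j
      using measurable_compose[OF Tj g(1), of j] by measurable
    then have "Measurable.pred N (\<lambda>x. \<exists>k. \<forall>j. k \<le> j \<longrightarrow> r < g ((T ^^ j) x))"
      by (intro pred_intros_countable pred_intros_logic) auto
    then have Cm: "C \<in> sets N" by (simp add: pred_def N C_def)
    have CT: "T -` C = C"
    proof (rule set_eqI)
      fix x
      have "T x \<in> C \<longleftrightarrow> (\<exists>k. \<forall>j\<ge>k. r < g ((T ^^ Suc j) x))" by (simp add: C_def funpow_swap1)
      also have "\<dots> \<longleftrightarrow> x \<in> C"
        unfolding C_def mem_Collect_eq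
        using eventually_sequentially_Suc[of "\<lambda>j. r < g ((T ^^ j) x)"]
        by (simp only: eventually_sequentially)
      finally show "x \<in> T -` C \<longleftrightarrow> x \<in> C" by simp
    qed
    have "AE x in lam. x \<in> C \<longleftrightarrow> r < g x" using gTj by eventually_elim (auto simp: C_def)
    note CR = this
    from atom[OF Cm CT] show ?thesis
    proof
      assume "AE x in lam. x \<in> A \<longrightarrow> x \<in> C"
      then have "AE x in lam. x \<in> A \<longrightarrow> r < g x" using CR by eventually_elim auto
      then show ?thesis ..
    next
      assume "AE x in lam. x \<in> A \<longrightarrow> x \<notin> C"
      then have "AE x in lam. x \<in> A \<longrightarrow> \<not> r < g x" using CR by eventually_elim auto
      then show ?thesis ..
    qed
  qed
  \<comment> \<open>By the dichotomy \<open>g\<close> is almost surely constant on the atom; its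
    value \<open>a\<close> is the supremum of the levels in \<open>R\<close>.\<close>
  define R where "R = {r. AE x in lam. x \<in> A \<longrightarrow> r < g x}"
  have "r < 1" if "r \<in> R" for r
  proof (rule ccontr)
    assume "\<not> r < 1"
    then have "AE x in lam. x \<notin> A" using that g(3) unfolding R_def
      by (auto elim!: eventually_mono) (meson less_le_trans linorder_not_less)
    then have "measure lam A = measure lam {}" using A lam(2) by (intro lam.finite_measure_eq_AE) auto
    then show False using False by simp
  qed
  then have Rb: "bdd_above R" by (auto intro!: bdd_aboveI[where M=1] less_imp_le)
  have "- 1 < g x" for x using g(2)[of x] by linarith
  then have Rne: "R \<noteq> {}" by (auto simp: R_def intro!: exI[of _ "-1"])
  define a where "a = Sup R"
  have lo: "AE x in lam. x \<in> A \<longrightarrow> r < g x" if "r < a" for r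
  proof -
    obtain s where s: "s \<in> R" "r < s" using less_cSupD[OF Rne] \<open>r < a\<close> by (auto simp: a_def)
    have "AE x in lam. x \<in> A \<longrightarrow> s < g x" using s by (simp add: R_def)
    then show ?thesis by eventually_elim (use s in auto)
  qed
  have hi: "AE x in lam. x \<in> A \<longrightarrow> \<not> r < g x" if "a < r" for r
  proof -
    have "r \<notin> R" using cSup_upper[OF _ Rb, of r] that by (auto simp: a_def)
    then show ?thesis using dich[of r] by (simp add: R_def)
  qed
  have "AE x in lam. \<forall>q::rat. (of_rat q < a \<longrightarrow> x \<in> A \<longrightarrow> of_rat q < g x) \<and> (a < of_rat q \<longrightarrow> x \<in> A \<longrightarrow> \<not> of_rat q < g x)"
    unfolding AE_all_countable
  proof
    fix q :: rat
    consider "of_rat q < a" | "a < of_rat q" | "of_rat q = a" by linarith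
    then show "AE x in lam. (of_rat q < a \<longrightarrow> x \<in> A \<longrightarrow> of_rat q < g x) \<and> (a < of_rat q \<longrightarrow> x \<in> A \<longrightarrow> \<not> of_rat q < g x)"
      by cases (use lo hi in \<open>auto elim!: eventually_mono\<close>)
  qed
  then have ga: "AE x in lam. x \<in> A \<longrightarrow> g x = a"
  proof eventually_elim
    case (elim x)
    show ?case
    proof
      assume x: "x \<in> A"
      show "g x = a"
      proof (rule ccontr)
        assume "g x \<noteq> a"
        then consider q where "g x < of_rat q" "of_rat q < a" | q where "a < of_rat q" "of_rat q < g x"
          using of_rat_dense[of "g x" a] of_rat_dense[of a "g x"] by (metis linorder_neqE_linordered_idom)
        then show False by cases (use elim x in \<open>force+\<close>)
      qed
    qed
  qed
  \<comment> \<open>Any invariant measure on the atom gives \<open>B\<close> the proportion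
    \<open>a\<close> of its mass. Applied to \<open>w\<close> and to the restriction of
    \<open>lam\<close>, this eliminates the unknown \<open>a\<close>.\<close>
  have key: "measure \<mu> B = a * measure \<mu> UNIV"
    if \<mu>: "M.inv_meas \<mu>" "absolutely_continuous lam \<mu>" "AE x in \<mu>. x \<in> A" for \<mu>
  proof -
    note mm = M.inv_measD[OF \<mu>(1)]
    interpret \<mu>: finite_measure \<mu> by fact
    have "AE x in lam. x \<in> A \<longrightarrow> (\<lambda>j. c j x) \<longlonglongrightarrow> a" using cg ga by eventually_elim auto
    then have "AE x in \<mu>. x \<in> A \<longrightarrow> (\<lambda>j. c j x) \<longlonglongrightarrow> a"
      using absolutely_continuous_AE[OF _ \<mu>(2)] mm lam(2) by simp
    then have lim: "AE x in \<mu>. (\<lambda>j. c j x) \<longlonglongrightarrow> a" using \<mu>(3) by eventually_elim auto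
    have "(\<lambda>j. \<integral>x. c j x \<partial>\<mu>) \<longlonglongrightarrow> (\<integral>x. a \<partial>\<mu>)"
    proof (rule integral_dominated_convergence[where w="\<lambda>_. 1"])
      show "c j \<in> borel_measurable \<mu>" for j using c(1) mm by (simp cong: measurable_cong_sets)
      show "AE x in \<mu>. norm (c j x) \<le> 1" for j using c(2,3) by simp
    qed (use lim in auto)
    then have "(\<integral>x. ?f x \<partial>\<mu>) = (\<integral>x. a \<partial>\<mu>)" using \<mu>(1) by (simp add: cf LIMSEQ_const_iff)
    then show ?thesis using B mm by simp
  qed
  have wB: "measure w B = a * measure w UNIV" by (rule key[OF inv(2) w(4) A(3)])
  let ?\<mu> = "density lam (indicator A)"
  have Al: "A \<in> sets lam" using A lam(2) by simp
  have "M.inv_meas ?\<mu>"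
  proof (rule M.inv_meas_restrict[OF inv(1) A(1)])
    have "indicator A (T x) = (indicator A x :: ennreal)" for x using A(2) by (auto split: split_indicator)
    then show "AE x in lam. emeasure (return N (T x)) A = indicator A x" using A(1) by simp
  qed
  moreover have "absolutely_continuous lam ?\<mu>" using Al by (intro absolutely_continuousI_density) auto
  moreover have "AE x in ?\<mu>. x \<in> A" using Al by (simp add: AE_density) (auto intro!: AE_I2 split: split_indicator_asm)
  ultimately have "measure ?\<mu> B = a * measure ?\<mu> UNIV" by (rule key)
  moreover have "measure ?\<mu> C = measure lam (C \<inter> A)" if "C \<in> sets N" for C
    using that lam(2) Al by (simp add: measure_def emeasure_density indicator_inter_arith[symmetric] Int_commute)
  ultimately have "measure lam (B \<inter> A) = a * measure lam A"
    using B sets.top[of N] N by simp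
  then show ?thesis using wB by simp
qed

section \<open>Extremal states and density\<close>

lemma AE_complement:
  assumes M: "prob_space M" "sets M = sets N" and M2: "prob_space M2" "sets M2 = sets N"
    and d: "0 \<le> d" "d < (1::real)"
    and eq: "\<And>B. B \<in> sets N \<Longrightarrow> measure M B = d * measure M' B + (1 - d) * measure M2 B"
    and P: "AE x in M. P x"
  shows "AE x in M2. P x"
proof -
  interpret M: prob_space M by fact
  interpret M2: prob_space M2 by fact
  obtain Z where Z: "{x \<in> space M. \<not> P x} \<subseteq> Z" "emeasure M Z = 0" "Z \<in> sets M"
    using P by (rule AE_E)
  have ZN: "Z \<in> sets N" using Z M by simp
  have "measure M Z = 0" using Z by (simp add: measure_def)
  moreover have "0 \<le> d * measure M' Z" "0 \<le> (1 - d) * measure M2 Z" using d by simp_all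
  ultimately have "(1 - d) * measure M2 Z = 0" using eq[OF ZN] by linarith
  then have "measure M2 Z = 0" using d by simp
  then have "Z \<in> null_sets M2" using ZN M2 by (simp add: null_sets_def M2.emeasure_eq_measure)
  then show ?thesis
    by (rule AE_I') (use Z sets_eq_imp_space_eq[of M2 M] M M2 in auto)
qed

text \<open>Domination writes \<open>M\<close> as a proper mixture of \<open>M'\<close> and a
  normalised remainder. Once the remainder is known to lie in the class, extremality identifies both
  parts with \<open>M\<close>.\<close>

lemma extremal_dominated:
  assumes M: "M \<in> extremal_states C" and M': "M' \<in> C"
    and C: "\<And>M. M \<in> C \<Longrightarrow> prob_space M \<and> sets M = sets borel"
    and c: "0 < c" "\<And>B. B \<in> sets borel \<Longrightarrow> c * measure M' B \<le> measure M B"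
    and compl: "\<And>M2 d. prob_space M2 \<Longrightarrow> sets M2 = sets borel \<Longrightarrow> 0 < d \<Longrightarrow> d < 1 \<Longrightarrow>
      (\<And>B. B \<in> sets borel \<Longrightarrow> measure M B = d * measure M' B + (1 - d) * measure M2 B) \<Longrightarrow> M2 \<in> C"
  shows "M' = M"
proof -
  have MC: "M \<in> C" using M by (simp add: extremal_states_def)
  \<comment> \<open>Lowered to at most 1/2 so that a remainder of positive mass is left.\<close>
  define d where "d = min c (1 / 2)"
  have d: "0 < d" "d < 1" "d \<le> c" using c(1) by (auto simp: d_def)
  have "d * measure M' B \<le> measure M B" if "B \<in> sets borel" for B
    using c(2)[OF that] mult_right_mono[OF d(3), of "measure M' B"] by simp
  then obtain M2 where M2: "prob_space M2" "sets M2 = sets borel"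
    "\<And>B. B \<in> sets borel \<Longrightarrow> measure M B = d * measure M' B + (1 - d) * measure M2 B"
    using prob_space_complement[of M borel M' d] C[OF MC] C[OF M'] d by metis
  have "M2 \<in> C" by (rule compl[OF M2(1,2) d(1,2) M2(3)])
  then show ?thesis using M M' d M2(3) unfolding extremal_states_def by blast
qed

lemma TIS_iff: "M \<in> TIS \<longleftrightarrow> prob_space M \<and> sets M = sets borel \<and> (AE x in M. x \<in> Xstar) \<and>
    shift.inv_meas M \<and> ssm.inv_meas M"
  using transl_inv_iff ssm_stationary_iff by (auto simp: TIS_def states_on_def)

lemma N_states_iff: "M \<in> N_states \<rho> \<longleftrightarrow> prob_space M \<and> sets M = sets borel \<and>
    (AE x in M. x \<in> Xstar_even) \<and> ssm.inv_meas M \<and> has_density M \<rho>"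
  using ssm_stationary_iff by (auto simp: N_states_def states_on_def)

lemma ETIS_dominated:
  assumes M: "M \<in> ETIS" and M': "M' \<in> TIS" and c: "0 < c" "\<And>B. B \<in> sets borel \<Longrightarrow> c * measure M' B \<le> measure M B"
  shows "M' = M"
proof (rule extremal_dominated[OF M[unfolded ETIS_def] M' _ c])
  fix M2 d assume M2: "prob_space M2" "sets M2 = sets borel" "0 < d" "d < 1"
    and eq: "\<And>B. B \<in> sets borel \<Longrightarrow> measure M B = d * measure M' B + (1 - d) * measure M2 B"
  have "M \<in> TIS" using M by (simp add: ETIS_def extremal_states_def)
  then show "M2 \<in> TIS"
    using M' M2 shift.inv_meas_complement[OF _ _ _ _ M2 eq] ssm.inv_meas_complement[OF _ _ _ _ M2 eq]
      AE_complement[OF _ _ M2(1,2) less_imp_le[OF M2(3)] M2(4) eq]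
    by (auto simp: TIS_iff)
qed (auto simp: TIS_iff)

lemma N_extremal_dominated:
  assumes M: "M \<in> N_extremal \<rho>" and M': "M' \<in> N_states \<rho>"
    and c: "0 < c" "\<And>B. B \<in> sets borel \<Longrightarrow> c * measure M' B \<le> measure M B"
  shows "M' = M"
proof (rule extremal_dominated[OF M[unfolded N_extremal_def] M' _ c])
  fix M2 d assume M2: "prob_space M2" "sets M2 = sets borel" "0 < d" "d < 1"
    and eq: "\<And>B. B \<in> sets borel \<Longrightarrow> measure M B = d * measure M' B + (1 - d) * measure M2 B"
  have "M \<in> N_states \<rho>" using M by (simp add: N_extremal_def extremal_states_def)
  then show "M2 \<in> N_states \<rho>"
    using M' M2 ssm.inv_meas_complement[OF _ _ _ _ M2 eq]
      AE_complement[OF _ _ M2(1,2) less_imp_le[OF M2(3)] M2(4) eq]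
    by (auto simp: N_states_iff has_density_def)
qed (auto simp: N_states_iff)

section \<open>Densities are unchanged by translation\<close>

lemma shifted_average:
  fixes a b :: "nat \<Rightarrow> real"
  assumes ab: "\<And>N. a (Suc N) = b N + c"
  shows "(\<lambda>N. a N / real N) \<longlonglongrightarrow> \<rho> \<longleftrightarrow> (\<lambda>N. b N / real N) \<longlonglongrightarrow> \<rho>"
proof -
  have l1: "(\<lambda>N. real N / real (Suc N)) \<longlonglongrightarrow> 1" using LIMSEQ_n_over_Suc_n by (simp add: add.commute)
  have l2: "(\<lambda>N. real (Suc N) / real N) \<longlonglongrightarrow> 1" using LIMSEQ_Suc_n_over_n by (simp add: add.commute)
  have l3: "(\<lambda>N. c / real N) \<longlonglongrightarrow> 0" by (rule lim_const_over_n)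
  have l4: "(\<lambda>N. c / real (Suc N)) \<longlonglongrightarrow> 0" using LIMSEQ_Suc[OF l3] by simp
  have "(\<lambda>N. a (Suc N) / real (Suc N)) \<longlonglongrightarrow> \<rho> \<longleftrightarrow> (\<lambda>N. b N / real N) \<longlonglongrightarrow> \<rho>"
  proof
    assume h: "(\<lambda>N. a (Suc N) / real (Suc N)) \<longlonglongrightarrow> \<rho>"
    have "(\<lambda>N. a (Suc N) / real (Suc N) * (real (Suc N) / real N) - c / real N) \<longlonglongrightarrow> \<rho> * 1 - 0"
      by (intro tendsto_intros h l2 l3)
    moreover have "\<forall>\<^sub>F N in sequentially. a (Suc N) / real (Suc N) * (real (Suc N) / real N) - c / real N = b N / real N"
      using eventually_gt_at_top[of 0]
      by eventually_elim (simp add: ab diff_divide_distrib[symmetric] del: of_nat_Suc)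
    ultimately show "(\<lambda>N. b N / real N) \<longlonglongrightarrow> \<rho>" by (simp add: tendsto_cong)
  next
    assume h: "(\<lambda>N. b N / real N) \<longlonglongrightarrow> \<rho>"
    have "(\<lambda>N. b N / real N * (real N / real (Suc N)) + c / real (Suc N)) \<longlonglongrightarrow> \<rho> * 1 + 0"
      by (intro tendsto_intros h l1 l4)
    moreover have "\<forall>\<^sub>F N in sequentially. b N / real N * (real N / real (Suc N)) + c / real (Suc N) = a (Suc N) / real (Suc N)"
      using eventually_gt_at_top[of 0] by eventually_elim (simp add: ab add_divide_distrib del: of_nat_Suc)
    ultimately show "(\<lambda>N. a (Suc N) / real (Suc N)) \<longlonglongrightarrow> \<rho>" by (simp add: tendsto_cong)
  qed
  then show ?thesis using filterlim_sequentially_Suc[of "\<lambda>N. a N / real N" "nhds \<rho>"] by simp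
qed

definition right_sum :: "config \<Rightarrow> nat \<Rightarrow> real" where
  "right_sum \<eta> N = (\<Sum>k<N. real (\<eta> (int k + 1)))"

definition left_sum :: "config \<Rightarrow> nat \<Rightarrow> real" where
  "left_sum \<eta> N = (\<Sum>k<N. real (\<eta> (- int k - 1)))"

lemma sum_right: "(\<Sum>i\<in>{1..int N}. real (\<eta> i)) = right_sum \<eta> N"
proof (induction N)
  case (Suc N)
  have "{1..int (Suc N)} = insert (int N + 1) {1..int N}" by auto
  then show ?case using Suc by (simp add: right_sum_def)
qed (simp add: right_sum_def)

lemma sum_left: "(\<Sum>i\<in>{- int N..- 1}. real (\<eta> i)) = left_sum \<eta> N"
proof (induction N)
  case (Suc N)
  have "{- int (Suc N)..- 1} = insert (- int N - 1) {- int N..- 1}" by auto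
  then show ?case using Suc by (simp add: left_sum_def)
qed (simp add: left_sum_def)

lemma right_sum_translate: "right_sum (translate \<eta>) (Suc N) = right_sum \<eta> N + real (\<eta> 0)"
  unfolding right_sum_def by (subst sum.lessThan_Suc_shift) (simp add: translate_def add.commute)

lemma left_sum_translate: "left_sum \<eta> (Suc N) = left_sum (translate \<eta>) N + real (\<eta> (- 1))"
  unfolding left_sum_def by (subst sum.lessThan_Suc_shift) (simp add: translate_def add.commute)

definition dens :: "real \<Rightarrow> config \<Rightarrow> bool" where
  "dens \<rho> \<eta> \<longleftrightarrow> (\<lambda>N. right_sum \<eta> N / real N) \<longlonglongrightarrow> \<rho> \<and> (\<lambda>N. left_sum \<eta> N / real N) \<longlonglongrightarrow> \<rho>"

lemma has_density_iff: "has_density M \<rho> \<longleftrightarrow> (AE \<eta> in M. dens \<rho> \<eta>)"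
  by (simp add: has_density_def dens_def sum_right sum_left)

lemma dens_translate: "dens \<rho> (translate \<eta>) \<longleftrightarrow> dens \<rho> \<eta>"
  unfolding dens_def
  using shifted_average[of "right_sum (translate \<eta>)" "right_sum \<eta>", OF right_sum_translate]
    shifted_average[of "left_sum \<eta>" "left_sum (translate \<eta>)", OF left_sum_translate] by simp

section \<open>Translates of stationary and of extremal states\<close>

lemma inv_meas_distr_commute:
  assumes T: "T \<in> borel \<rightarrow>\<^sub>M borel" and K: "\<And>\<eta>. ssm_kernel (T \<eta>) = distr (ssm_kernel \<eta>) borel T"
    and M: "ssm.inv_meas M"
  shows "ssm.inv_meas (distr M borel T)"
  unfolding invariant_under_def
proof (intro conjI ballI)
  note m = ssm.inv_measD[OF M]
  interpret finite_measure M by fact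
  have T': "T \<in> M \<rightarrow>\<^sub>M borel" using T m by (simp cong: measurable_cong_sets)
  have Tk: "T \<in> ssm_kernel \<eta> \<rightarrow>\<^sub>M borel" for \<eta> using T by (simp cong: measurable_cong_sets)
  show "finite_measure (distr M borel T)" by (rule finite_measure_distr[OF T'])
  fix B :: "config set" assume B: "B \<in> sets borel"
  have TB: "T -` B \<in> sets borel" using measurable_sets[OF T B] by simp
  have "emeasure (distr M borel T) B = emeasure M (T -` B)"
    using B T' m by (simp add: emeasure_distr)
  also have "\<dots> = (\<integral>\<^sup>+x. emeasure (ssm_kernel (T x)) B \<partial>M)"
    unfolding m(4)[OF TB] using B Tk by (simp add: K emeasure_distr)
  also have "\<dots> = (\<integral>\<^sup>+x. emeasure (ssm_kernel x) B \<partial>distr M borel T)"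
    by (rule nn_integral_distr[OF T', symmetric]) (simp add: measurable_emeasure_kernel[OF ssm.kernel_subprob B])
  finally show "emeasure (distr M borel T) B = (\<integral>\<^sup>+x. emeasure (ssm_kernel x) B \<partial>distr M borel T)" .
qed simp

lemma ssm_kernel_untranslate: "ssm_kernel (untranslate \<eta>) = distr (ssm_kernel \<eta>) borel untranslate"
proof -
  have m: "translate \<in> ssm_kernel \<eta> \<rightarrow>\<^sub>M borel" for \<eta>
    using translate_measurable by (simp cong: measurable_cong_sets)
  have "distr (ssm_kernel \<eta>) borel untranslate = distr (distr (ssm_kernel (untranslate \<eta>)) borel translate) borel untranslate"
    using ssm_kernel_translate[of "untranslate \<eta>"] by simp
  also have "\<dots> = distr (ssm_kernel (untranslate \<eta>)) borel (\<lambda>x. x)"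
    by (subst distr_distr[OF untranslate_measurable m]) (simp add: comp_def)
  also have "\<dots> = ssm_kernel (untranslate \<eta>)" by (rule distr_id2) simp
  finally show ?thesis by simp
qed

lemma N_states_distr:
  assumes T: "T \<in> borel \<rightarrow>\<^sub>M borel" "\<And>\<eta>. ssm_kernel (T \<eta>) = distr (ssm_kernel \<eta>) borel T"
    and D: "\<And>\<eta>. T \<eta> \<in> Xstar_even \<longleftrightarrow> \<eta> \<in> Xstar_even" "\<And>\<eta>. dens \<rho> (T \<eta>) \<longleftrightarrow> dens \<rho> \<eta>"
    and dm: "{\<eta>. dens \<rho> \<eta>} \<in> sets borel"
    and M: "M \<in> N_states \<rho>"
  shows "distr M borel T \<in> N_states \<rho>"
proof -
  have m: "prob_space M" "sets M = sets borel" "AE x in M. x \<in> Xstar_even" "ssm.inv_meas M" "AE x in M. dens \<rho> x"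
    using M by (auto simp: N_states_iff has_density_iff)
  have T': "T \<in> M \<rightarrow>\<^sub>M borel" using T m by (simp cong: measurable_cong_sets)
  have "AE x in distr M borel T. x \<in> Xstar_even" "AE x in distr M borel T. dens \<rho> x"
    using m(3,5) Xstar_measurable dm by (simp_all add: AE_distr_iff[OF T'] D)
  then show ?thesis
    using prob_space.prob_space_distr[OF m(1) T'] inv_meas_distr_commute[OF T m(4)]
    by (simp add: N_states_iff has_density_iff)
qed

lemma dens_measurable [measurable]: "{\<eta>. dens \<rho> \<eta>} \<in> sets borel"
proof -
  have c: "(\<lambda>\<eta>::config. real (\<eta> i)) \<in> borel_measurable borel" for i
    by (rule measurable_compose[OF measurable_coordinate_count]) simp
  have [measurable]: "(\<lambda>\<eta>. right_sum \<eta> N / real N) \<in> borel_measurable borel" "(\<lambda>\<eta>. left_sum \<eta> N / real N) \<in> borel_measurable borel" for N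
    unfolding right_sum_def left_sum_def by (intro borel_measurable_divide borel_measurable_sum c borel_measurable_const)+
  have "Measurable.pred borel (\<lambda>\<eta>. dens \<rho> \<eta>)" unfolding dens_def by measurable
  then show ?thesis by (simp add: pred_def)
qed

lemma N_states_translate: "M \<in> N_states \<rho> \<Longrightarrow> push_translate M \<in> N_states \<rho>"
  unfolding push_translate_def
  by (rule N_states_distr) (auto simp: ssm_kernel_translate translate_Xstar_even dens_translate dens_measurable)

lemma N_states_untranslate: "M \<in> N_states \<rho> \<Longrightarrow> distr M borel untranslate \<in> N_states \<rho>"
proof (rule N_states_distr)
  show "untranslate \<eta> \<in> Xstar_even \<longleftrightarrow> \<eta> \<in> Xstar_even" for \<eta>
    using translate_Xstar_even[of "untranslate \<eta>"] by simp
  show "dens \<rho> (untranslate \<eta>) \<longleftrightarrow> dens \<rho> \<eta>" for \<eta>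
    using dens_translate[of \<rho> "untranslate \<eta>"] by simp
qed (auto simp: ssm_kernel_untranslate dens_measurable)

lemma push_translate_untranslate:
  fixes M :: "(int \<Rightarrow> 'a::second_countable_topology) measure"
  assumes "sets M = sets borel"
  shows "push_translate (distr M borel untranslate) = M" "distr (push_translate M) borel untranslate = M"
proof -
  have m: "translate \<in> M \<rightarrow>\<^sub>M borel" "untranslate \<in> M \<rightarrow>\<^sub>M borel"
    by (subst measurable_cong_sets[OF assms refl], measurable)+
  show "push_translate (distr M borel untranslate) = M"
    unfolding push_translate_def
    by (subst distr_distr[OF translate_measurable m(2)]) (simp add: comp_def distr_id2[OF assms[symmetric]])
  show "distr (push_translate M) borel untranslate = M"
    unfolding push_translate_def
    by (subst distr_distr[OF untranslate_measurable m(1)]) (simp add: comp_def distr_id2[OF assms[symmetric]])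
qed

lemma push_translate_inj:
  fixes M1 M2 :: "(int \<Rightarrow> 'a::second_countable_topology) measure"
  assumes "sets M1 = sets borel" "sets M2 = sets borel" "push_translate M1 = push_translate M2"
  shows "M1 = M2"
  using push_translate_untranslate(2)[OF assms(1)] push_translate_untranslate(2)[OF assms(2)] assms(3) by metis

text \<open>Translation is an affine bijection of the class: a mixture representing the translated
  state is pulled back by \<open>untranslate\<close> to one representing \<open>M\<close>.\<close>

lemma N_extremal_translate:
  assumes M: "M \<in> N_extremal \<rho>"
  shows "push_translate M \<in> N_extremal \<rho>"
proof -
  have MN: "M \<in> N_states \<rho>" using M by (simp add: N_extremal_def extremal_states_def)
  then have s: "sets M = sets borel" "prob_space M" by (auto simp: N_states_iff)
  have "M1 = push_translate M"
    if h: "M1 \<in> N_states \<rho>" "M2 \<in> N_states \<rho>" "0 < t" "t < (1::real)"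
      "\<And>B. B \<in> sets borel \<Longrightarrow> measure (push_translate M) B = t * measure M1 B + (1 - t) * measure M2 B" for M1 M2 t
  proof -
    have s1: "sets M1 = sets borel" "sets M2 = sets borel" using h by (auto simp: N_states_iff)
    have m: "untranslate \<in> M1 \<rightarrow>\<^sub>M borel" "untranslate \<in> M2 \<rightarrow>\<^sub>M borel" "untranslate \<in> push_translate M \<rightarrow>\<^sub>M borel"
      using s1 by (simp_all add: push_translate_def cong: measurable_cong_sets)
    have "measure M B = t * measure (distr M1 borel untranslate) B + (1 - t) * measure (distr M2 borel untranslate) B"
      if B: "B \<in> sets borel" for B
    proof -
      have uB: "untranslate -` B \<in> sets borel" using measurable_sets[OF untranslate_measurable B] by simp
      have sp: "space M1 = UNIV" "space M2 = UNIV" "space (push_translate M) = UNIV"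
        using sets_eq_imp_space_eq[OF s1(1)] sets_eq_imp_space_eq[OF s1(2)] by (simp_all add: push_translate_def)
      have "measure M B = measure (distr (push_translate M) borel untranslate) B"
        using push_translate_untranslate(2)[OF s(1)] by simp
      also have "\<dots> = measure (push_translate M) (untranslate -` B)"
        using measure_distr[OF m(3) B] sp by simp
      finally show ?thesis
        using h(5)[OF uB] measure_distr[OF m(1) B] measure_distr[OF m(2) B] sp by simp
    qed
    then have "distr M1 borel untranslate = M"
      using M N_states_untranslate[OF h(1)] N_states_untranslate[OF h(2)] h(3,4)
      unfolding N_extremal_def extremal_states_def by blast
    then show ?thesis using push_translate_untranslate(1)[OF s1(1)] by simp
  qed note one = this
  have "M1 = push_translate M \<and> M2 = push_translate M"
    if h: "M1 \<in> N_states \<rho>" "M2 \<in> N_states \<rho>" "0 < t \<and> t < (1::real) \<and>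
      (\<forall>B\<in>sets borel. measure (push_translate M) B = t * measure M1 B + (1 - t) * measure M2 B)" for M1 M2 t
  proof
    show "M1 = push_translate M" by (rule one[OF h(1,2), of t]) (use h(3) in auto)
    show "M2 = push_translate M" by (rule one[OF h(2,1), of "1 - t"]) (use h(3) in auto)
  qed
  then show ?thesis
    using N_states_translate[OF MN] unfolding N_extremal_def extremal_states_def by blast
qed

lemma N_extremal_translate_pow: "M \<in> N_extremal \<rho> \<Longrightarrow> (push_translate ^^ i) M \<in> N_extremal \<rho>"
  by (induction i) (auto intro: N_extremal_translate)

lemma N_extremalD:
  assumes "M \<in> N_extremal \<rho>"
  shows "M \<in> N_states \<rho>" "prob_space M" "sets M = sets borel" "AE x in M. x \<in> Xstar_even" "ssm.inv_meas M"
    "AE x in M. dens \<rho> x" "space M = UNIV"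
  using assms sets_eq_imp_space_eq[of M borel] by (auto simp: N_extremal_def extremal_states_def N_states_iff has_density_iff)

section \<open>Basic states\<close>

lemma partition_familyD:
  assumes "partition_family lam m A"
  shows "\<And>i. i < m \<Longrightarrow> A i \<in> sets borel" "AE \<sigma> in lam. \<exists>i<m. \<sigma> \<in> A i"
    "AE \<sigma> in lam. \<forall>i j. i < m \<longrightarrow> j < m \<longrightarrow> \<sigma> \<in> A i \<longrightarrow> \<sigma> \<in> A j \<longrightarrow> i = j"
proof -
  note p = assms[unfolded partition_family_def]
  show "\<And>i. i < m \<Longrightarrow> A i \<in> sets borel" using p by blast
  show "AE \<sigma> in lam. \<exists>i<m. \<sigma> \<in> A i" using p by auto
  have "AE \<sigma> in lam. i < j \<and> j < m \<longrightarrow> \<sigma> \<notin> A i \<inter> A j" for i j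
    using p by (cases "i < j \<and> j < m") auto
  then have "AE \<sigma> in lam. \<forall>i j. i < j \<and> j < m \<longrightarrow> \<sigma> \<notin> A i \<inter> A j" by (simp add: AE_all_countable)
  then show "AE \<sigma> in lam. \<forall>i j. i < m \<longrightarrow> j < m \<longrightarrow> \<sigma> \<in> A i \<longrightarrow> \<sigma> \<in> A j \<longrightarrow> i = j"
    by eventually_elim (metis IntI linorder_neqE_nat)
qed

text \<open>All cells are translates of one another and have equal measure, so one null cell would
  make the whole partition null.\<close>

lemma partition_family_pos:
  assumes erg: "ergodic lam" and m: "m > 0" and p: "partition_family lam m A" and k: "k < m"
  shows "measure lam (A k) > 0"
proof (rule ccontr)
  interpret shift_invariant lam by (rule ergodic_shift_invariant[OF erg])
  note pD = partition_familyD[OF p]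
  assume "\<not> ?thesis"
  then have "measure lam (A k) = 0" by (simp add: less_le)
  then have z: "measure lam (A ((k + i) mod m)) = 0" for i
    using measure_zimg[OF pD(1)[OF k], of "int i"] by (simp add: partition_family_zimg[OF p k])
  have "measure lam (A j) = 0" if "j < m" for j
  proof -
    have "(k + (j + m - k)) mod m = j" using that k by simp
    then show ?thesis using z[of "j + m - k"] by simp
  qed
  then have "AE \<sigma> in lam. j < m \<longrightarrow> \<sigma> \<notin> A j" for j
    using AE_not_inI[OF pD(1)] by (cases "j < m") auto
  then have "AE \<sigma> in lam. \<forall>j. j < m \<longrightarrow> \<sigma> \<notin> A j" by (simp add: AE_all_countable)
  then have "AE \<sigma> in lam. False" using pD(2) by eventually_elim auto
  then show False by simp
qed

text \<open>\<open>measure_of\<close> takes the intended values only once the set function is known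
  to be countably additive.\<close>

lemma
  assumes \<nu>: "prob_space \<nu>" "sets \<nu> = sets borel" and q: "q > 0"
  shows sets_averaged: "sets (averaged \<nu> m q) = sets borel"
    and emeasure_averaged: "C \<in> sets borel \<Longrightarrow>
      emeasure (averaged \<nu> m q) C = (\<Sum>i<q. emeasure ((push_translate ^^ (i * m)) \<nu>) C) / of_nat q"
    and prob_space_averaged: "prob_space (averaged \<nu> m q)"
proof -
  have s: "sets ((push_translate ^^ k) \<nu>) = sets borel" for k
    by (simp add: push_translate_pow[OF \<nu>(2)])
  show sa: "sets (averaged \<nu> m q) = sets borel"
    unfolding averaged_def using sets.sigma_sets_eq[of "borel :: config measure"] by (simp add: sets_measure_of_conv)
  show e: "emeasure (averaged \<nu> m q) C = (\<Sum>i<q. emeasure ((push_translate ^^ (i * m)) \<nu>) C) / of_nat q"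
    if C: "C \<in> sets borel" for C
  proof (rule emeasure_measure_of[OF averaged_def])
    show "C \<in> sets (averaged \<nu> m q)" using C sa by simp
    show "positive (sets (averaged \<nu> m q)) (\<lambda>B. (\<Sum>i<q. emeasure ((push_translate ^^ (i * m)) \<nu>) B) / of_nat q)"
      by (simp add: positive_def)
    show "countably_additive (sets (averaged \<nu> m q)) (\<lambda>B. (\<Sum>i<q. emeasure ((push_translate ^^ (i * m)) \<nu>) B) / of_nat q)"
    proof (rule countably_additiveI)
      fix A :: "nat \<Rightarrow> config set"
      assume A: "range A \<subseteq> sets (averaged \<nu> m q)" "disjoint_family A"
      have "(\<Sum>n. (\<Sum>i<q. emeasure ((push_translate ^^ (i * m)) \<nu>) (A n)) / of_nat q) =
          (\<Sum>n. (\<Sum>i<q. emeasure ((push_translate ^^ (i * m)) \<nu>) (A n))) / of_nat q"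
        unfolding divide_ennreal_def by (rule ennreal_suminf_multc)
      also have "(\<Sum>n. (\<Sum>i<q. emeasure ((push_translate ^^ (i * m)) \<nu>) (A n))) =
          (\<Sum>i<q. \<Sum>n. emeasure ((push_translate ^^ (i * m)) \<nu>) (A n))"
        by (rule suminf_sum) auto
      also have "\<dots> = (\<Sum>i<q. emeasure ((push_translate ^^ (i * m)) \<nu>) (\<Union>n. A n))"
        using A s sa by (intro sum.cong suminf_emeasure) auto
      finally show "(\<Sum>n. (\<Sum>i<q. emeasure ((push_translate ^^ (i * m)) \<nu>) (A n)) / of_nat q) =
        (\<Sum>i<q. emeasure ((push_translate ^^ (i * m)) \<nu>) (\<Union>n. A n)) / of_nat q" .
    qed
  qed simp
  have p: "prob_space ((push_translate ^^ k) \<nu>)" for k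
  proof -
    have "translate ^^ k \<in> \<nu> \<rightarrow>\<^sub>M borel"
      by (subst measurable_cong_sets[OF \<nu>(2) refl]) (rule translate_pow_measurable)
    then show ?thesis
      unfolding push_translate_pow[OF \<nu>(2)] by (rule prob_space.prob_space_distr[OF \<nu>(1)])
  qed
  have "emeasure ((push_translate ^^ k) \<nu>) UNIV = 1" for k
    using prob_space.emeasure_space_1[OF p[of k]] sets_eq_imp_space_eq[OF s[of k]] by simp
  then have "emeasure (averaged \<nu> m q) UNIV = 1"
    using q by (simp add: e) (simp add: ennreal_of_nat_eq_real_of_nat divide_ennreal)
  then show "prob_space (averaged \<nu> m q)"
    using sets_eq_imp_space_eq[OF sa] by (intro prob_spaceI) simp
qed

text \<open>Writing \<open>j = i * m + k\<close> merges the sum over cells with the average over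
  translates into one sum over a full period.\<close>

lemma sum_mod_div:
  fixes f :: "nat \<Rightarrow> nat \<Rightarrow> 'a::comm_monoid_add"
  assumes "m > 0"
  shows "(\<Sum>j<q * m. f j (j mod m)) = (\<Sum>k<m. \<Sum>i<q. f (i * m + k) k)"
proof -
  have "(\<Sum>j<q * m. f j (j mod m)) = (\<Sum>i<q. \<Sum>j=i * m..<i * m + m. f j (j mod m))"
    by (rule sum.nat_group[symmetric])
  also have "\<dots> = (\<Sum>i<q. \<Sum>k<m. f (i * m + k) k)"
  proof (rule sum.cong[OF refl])
    fix i
    have "(\<Sum>j=i * m..<i * m + m. f j (j mod m)) = (\<Sum>k=0..<m. f (k + i * m) ((k + i * m) mod m))"
      using sum.shift_bounds_nat_ivl[of "\<lambda>j. f j (j mod m)" 0 "i * m" m] by (simp add: add.commute)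
    then show "(\<Sum>j=i * m..<i * m + m. f j (j mod m)) = (\<Sum>k<m. f (i * m + k) k)"
      by (simp add: atLeast0LessThan add.commute)
  qed
  also have "\<dots> = (\<Sum>k<m. \<Sum>i<q. f (i * m + k) k)" by (rule sum.swap)
  finally show ?thesis .
qed

definition basic :: "spins measure \<Rightarrow> config measure \<Rightarrow> nat \<Rightarrow> nat \<Rightarrow> (nat \<Rightarrow> spins set) \<Rightarrow> config measure" where
  "basic lam \<nu> m q A = distr (pre_basic_state lam \<nu> m q A) borel combine"

text \<open>Fixes the density, which \<open>basic_data\<close> only asserts to exist, and thereby
  places all translates of \<nu> in one class \<open>N_extremal \<rho>\<close>.\<close>

locale basic_context =
  fixes lam :: "spins measure" and \<nu> :: "config measure" and m q :: nat and A :: "nat \<Rightarrow> spins set" and \<rho> :: real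
  assumes erg: "ergodic lam" and \<nu>_ext: "\<nu> \<in> N_extremal \<rho>" and m_pos: "m > 0" and q_pos: "q > 0"
    and period: "(push_translate ^^ (q * m)) \<nu> = \<nu>" and part: "partition_family lam m A"
begin

sublocale shift_invariant lam by (rule ergodic_shift_invariant[OF erg])

abbreviation "tr j \<equiv> (push_translate ^^ j) \<nu>"
abbreviation "wt j B \<equiv> ennreal (1 / real q) * emeasure lam (B \<inter> A (j mod m))"
abbreviation "M \<equiv> basic lam \<nu> m q A"

lemma tr: "tr j \<in> N_extremal \<rho>"
  by (rule N_extremal_translate_pow[OF \<nu>_ext])

lemma trD: "prob_space (tr j)" "sets (tr j) = sets borel" "space (tr j) = UNIV" "AE x in tr j. x \<in> Xstar_even"
  "ssm.inv_meas (tr j)" "AE x in tr j. dens \<rho> x"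
  using N_extremalD[OF tr[of j]] by auto

lemma \<nu>D: "prob_space \<nu>" "sets \<nu> = sets borel"
  using N_extremalD[OF \<nu>_ext] by auto

lemmas part_meas = partition_familyD(1)[OF part]

lemma A_mod [measurable]: "A (j mod m) \<in> sets borel" "A (j mod m) \<in> sets lam"
  using part_meas m_pos by (simp_all add: sets_lam)

lemma emeasure_averaged_translate:
  assumes C: "C \<in> sets borel"
  shows "emeasure ((push_translate ^^ k) (averaged \<nu> m q)) C = (\<Sum>i<q. emeasure (tr (i * m + k)) C) / of_nat q"
proof -
  have Tk: "(translate ^^ k) -` C \<in> sets borel" using measurable_sets[OF translate_pow_measurable C] by simp
  have mm: "translate ^^ k \<in> averaged \<nu> m q \<rightarrow>\<^sub>M borel" "translate ^^ k \<in> tr j \<rightarrow>\<^sub>M borel" for j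
    using sets_averaged[OF \<nu>D q_pos] trD(2) translate_pow_measurable by (simp_all cong: measurable_cong_sets)
  have sp: "space (averaged \<nu> m q) = UNIV" using sets_eq_imp_space_eq[OF sets_averaged[OF \<nu>D q_pos]] by simp
  have "emeasure ((push_translate ^^ k) (averaged \<nu> m q)) C = emeasure (averaged \<nu> m q) ((translate ^^ k) -` C)"
    unfolding push_translate_pow[OF sets_averaged[OF \<nu>D q_pos]] using emeasure_distr[OF mm(1) C] sp by simp
  also have "\<dots> = (\<Sum>i<q. emeasure (tr (i * m)) ((translate ^^ k) -` C)) / of_nat q"
    by (rule emeasure_averaged[OF \<nu>D q_pos Tk])
  also have "\<dots> = (\<Sum>i<q. emeasure (tr (i * m + k)) C) / of_nat q"
  proof (intro arg_cong[where f="\<lambda>x. x / of_nat q"] sum.cong refl)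
    fix i
    have "tr (i * m + k) = (push_translate ^^ k) (tr (i * m))" by (simp add: funpow_add add.commute)
    also have "\<dots> = distr (tr (i * m)) borel (translate ^^ k)" by (rule push_translate_pow[OF trD(2)])
    finally show "emeasure (tr (i * m)) ((translate ^^ k) -` C) = emeasure (tr (i * m + k)) C"
      using emeasure_distr[OF mm(2) C, of "i * m"] trD(3) by simp
  qed
  finally show ?thesis .
qed

lemma sets_averaged_translate: "sets ((push_translate ^^ k) (averaged \<nu> m q)) = sets borel"
  by (simp add: push_translate_pow[OF sets_averaged[OF \<nu>D q_pos]])

lemma prob_averaged_translate: "prob_space ((push_translate ^^ k) (averaged \<nu> m q))"
proof -
  have "translate ^^ k \<in> averaged \<nu> m q \<rightarrow>\<^sub>M borel"
    using sets_averaged[OF \<nu>D q_pos] translate_pow_measurable by (simp cong: measurable_cong_sets)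
  then show ?thesis
    unfolding push_translate_pow[OF sets_averaged[OF \<nu>D q_pos]]
    by (rule prob_space.prob_space_distr[OF prob_space_averaged[OF \<nu>D q_pos]])
qed

lemma AE_averaged_translate: "AE x in (push_translate ^^ k) (averaged \<nu> m q). x \<in> Xstar_even"
proof -
  have X: "- Xstar_even \<in> sets borel" using sets.compl_sets[OF Xstar_measurable(2)] by (simp add: Compl_eq_Diff_UNIV)
  have "emeasure (tr j) (- Xstar_even) = 0" for j
    using trD(4)[of j] X trD(2,3)[of j] by (subst (asm) AE_iff_measurable[OF _ refl]) (auto simp: Compl_eq)
  then have "emeasure ((push_translate ^^ k) (averaged \<nu> m q)) (- Xstar_even) = 0"
    by (simp add: emeasure_averaged_translate[OF X])
  then have "AE x in (push_translate ^^ k) (averaged \<nu> m q). x \<notin> - Xstar_even"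
    using X sets_averaged_translate by (intro AE_not_in) (simp add: null_sets_def)
  then show ?thesis by simp
qed

abbreviation "idx \<sigma> \<equiv> (LEAST k. k < m \<and> \<sigma> \<in> A k)"

lemma idx_measurable: "(\<lambda>\<sigma>. idx \<sigma>) \<in> lam \<rightarrow>\<^sub>M count_space UNIV"
proof (rule measurable_Least)
  fix k
  show "Measurable.pred lam (\<lambda>\<sigma>. k < m \<and> \<sigma> \<in> A k)"
    using part_meas[of k] by (cases "k < m") (auto simp: pred_def sets_lam)
qed

lemma fibre_state_measurable: "fibre_state \<nu> m q A \<in> lam \<rightarrow>\<^sub>M prob_algebra borel"
proof -
  have "(\<lambda>\<sigma>. (push_translate ^^ idx \<sigma>) (averaged \<nu> m q)) \<in> lam \<rightarrow>\<^sub>M prob_algebra borel"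
  proof (rule measurable_compose_countable[OF _ idx_measurable])
    show "(\<lambda>\<sigma>. (push_translate ^^ k) (averaged \<nu> m q)) \<in> lam \<rightarrow>\<^sub>M prob_algebra borel" for k
      using prob_averaged_translate[of k] sets_averaged_translate[of k]
      by (intro measurable_const) (simp add: space_prob_algebra)
  qed
  then show ?thesis by (simp add: fibre_state_def[abs_def])
qed

abbreviation "pair_kernel \<equiv> (\<lambda>\<sigma>. distr (fibre_state \<nu> m q A \<sigma>) borel (\<lambda>\<eta>. (\<eta>, \<sigma>)))"

lemma pair_kernel_measurable: "pair_kernel \<in> lam \<rightarrow>\<^sub>M prob_algebra borel"
proof (rule measurable_distr_prob_space2[OF fibre_state_measurable])
  have "(\<lambda>p::spins \<times> config. (snd p, fst p)) \<in> borel \<Otimes>\<^sub>M borel \<rightarrow>\<^sub>M borel \<Otimes>\<^sub>M borel"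
    by measurable
  then show "(\<lambda>(\<sigma>, \<eta>). (\<eta>, \<sigma>)) \<in> lam \<Otimes>\<^sub>M borel \<rightarrow>\<^sub>M (borel :: (config \<times> spins) measure)"
    using sets_lam by (simp add: borel_prod case_prod_beta' cong: measurable_cong_sets sets_pair_measure_cong)
qed

lemma combine_borel: "combine \<in> borel \<rightarrow>\<^sub>M borel"
  using combine_measurable by (simp add: borel_prod)

lemma prob_pre: "prob_space (pre_basic_state lam \<nu> m q A)" and sets_pre: "sets (pre_basic_state lam \<nu> m q A) = sets borel"
proof -
  have k: "pair_kernel \<in> lam \<rightarrow>\<^sub>M subprob_algebra borel"
    by (rule measurable_prob_algebraD[OF pair_kernel_measurable])
  show "prob_space (pre_basic_state lam \<nu> m q A)"
    unfolding pre_basic_state_def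
    using measurable_space[OF pair_kernel_measurable]
    by (intro prob_space_bind[OF _ k] AE_I2) (simp add: space_prob_algebra)
  show "sets (pre_basic_state lam \<nu> m q A) = sets borel"
    unfolding pre_basic_state_def by (rule sets_bind) auto
qed

lemma sets_M: "sets M = sets borel" and space_M: "space M = UNIV" and prob_M: "prob_space M"
proof -
  show "sets M = sets borel" "space M = UNIV" by (simp_all add: basic_def)
  have "combine \<in> pre_basic_state lam \<nu> m q A \<rightarrow>\<^sub>M borel"
    using combine_borel sets_pre by (simp cong: measurable_cong_sets)
  then show "prob_space M" unfolding basic_def by (rule prob_space.prob_space_distr[OF prob_pre])
qed

lemma fibre_state_combine:
  assumes C: "C \<in> sets borel" and B: "B \<in> sets borel"
  shows "emeasure (pair_kernel \<sigma>) (combine -` rect C B) =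
    emeasure ((push_translate ^^ idx \<sigma>) (averaged \<nu> m q)) C * indicator B \<sigma>"
proof -
  let ?F = "fibre_state \<nu> m q A \<sigma>"
  have F: "?F = (push_translate ^^ idx \<sigma>) (averaged \<nu> m q)" by (simp add: fibre_state_def)
  have sF: "sets ?F = sets borel" and spF: "space ?F = UNIV"
    using sets_averaged_translate sets_eq_imp_space_eq[OF sets_averaged_translate] by (simp_all add: F)
  have D: "combine -` rect C B \<in> sets borel"
    using measurable_sets[OF combine_borel rect_measurable[OF C B]] by simp
  have p: "(\<lambda>\<eta>. (\<eta>, \<sigma>)) \<in> ?F \<rightarrow>\<^sub>M borel"
    using sF by (simp add: borel_prod[symmetric] cong: measurable_cong_sets)
  have "emeasure (pair_kernel \<sigma>) (combine -` rect C B) = emeasure ?F {\<eta>. combine (\<eta>, \<sigma>) \<in> rect C B}"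
    using emeasure_distr[OF p D] spF by (simp add: vimage_def)
  also have "\<dots> = emeasure ?F (if \<sigma> \<in> B then C else {})"
  proof (rule emeasure_eq_AE)
    show "AE \<eta> in ?F. \<eta> \<in> {\<eta>. combine (\<eta>, \<sigma>) \<in> rect C B} \<longleftrightarrow> \<eta> \<in> (if \<sigma> \<in> B then C else {})"
      using AE_averaged_translate[of "idx \<sigma>"] unfolding F
      by eventually_elim (simp add: rect_def Xstar_even_def even_part_combine odd_sites_combine)
    show "{\<eta>. combine (\<eta>, \<sigma>) \<in> rect C B} \<in> sets ?F"
      using measurable_sets[OF p D] spF by (simp add: vimage_def)
    show "(if \<sigma> \<in> B then C else {}) \<in> sets ?F" using C sF by simp
  qed
  finally show ?thesis by (simp add: F split: split_indicator)
qed

text \<open>The working form of a basic state: a sum of product measures over one period. Cell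
  \<open>k\<close> selects the translates by \<open>k\<close> plus multiples of \<open>m\<close>,
  each with weight \<open>1 / q\<close>.\<close>

lemma emeasure_rect:
  assumes C: "C \<in> sets borel" and B: "B \<in> sets borel"
  shows "emeasure M (rect C B) = (\<Sum>j<q * m. wt j B * emeasure (tr j) C)"
proof -
  let ?G = "\<lambda>k. emeasure ((push_translate ^^ k) (averaged \<nu> m q)) C"
  have k: "pair_kernel \<in> lam \<rightarrow>\<^sub>M subprob_algebra borel"
    by (rule measurable_prob_algebraD[OF pair_kernel_measurable])
  have D: "combine -` rect C B \<in> sets borel"
    using measurable_sets[OF combine_borel rect_measurable[OF C B]] by simp
  have c: "combine \<in> pre_basic_state lam \<nu> m q A \<rightarrow>\<^sub>M borel"
    using combine_borel sets_pre by (simp cong: measurable_cong_sets)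
  have "emeasure M (rect C B) = emeasure (pre_basic_state lam \<nu> m q A) (combine -` rect C B)"
    unfolding basic_def using emeasure_distr[OF c rect_measurable[OF C B]] sets_eq_imp_space_eq[OF sets_pre] by simp
  also have "\<dots> = (\<integral>\<^sup>+\<sigma>. ?G (idx \<sigma>) * indicator B \<sigma> \<partial>lam)"
    unfolding pre_basic_state_def
    by (subst emeasure_bind[OF _ k D]) (simp_all add: fibre_state_combine[OF C B])
  also have "\<dots> = (\<integral>\<^sup>+\<sigma>. (\<Sum>k<m. ?G k * indicator (B \<inter> A k) \<sigma>) \<partial>lam)"
  proof (rule nn_integral_cong_AE)
    show "AE \<sigma> in lam. ?G (idx \<sigma>) * indicator B \<sigma> = (\<Sum>k<m. ?G k * indicator (B \<inter> A k) \<sigma>)"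
      using partition_familyD(2,3)[OF part]
    proof eventually_elim
      case (elim \<sigma>)
      then obtain k where k: "k < m" "\<sigma> \<in> A k" by blast
      have u: "j = k" if "j < m" "\<sigma> \<in> A j" for j using elim(2) that k by blast
      \<comment> \<open>Almost every parity configuration lies in exactly one cell, so the least
        index is the only one.\<close>
      have "idx \<sigma> = k"
        by (rule Least_equality) (use k in simp, use u in blast)
      moreover have "(\<Sum>j<m. ?G j * indicator (B \<inter> A j) \<sigma>) = (\<Sum>j\<in>{k}. ?G j * indicator (B \<inter> A j) \<sigma>)"
      proof (rule sum.mono_neutral_right)
        show "\<forall>j\<in>{..<m} - {k}. ?G j * indicator (B \<inter> A j) \<sigma> = 0"
        proof
          fix j assume "j \<in> {..<m} - {k}"
          then have "\<sigma> \<notin> A j" using u[of j] by blast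
          then show "?G j * indicator (B \<inter> A j) \<sigma> = 0" by simp
        qed
      qed (use k in auto)
      moreover have "\<dots> = ?G k * indicator B \<sigma>"
        using k by (simp only: sum.insert finite.emptyI empty_iff not_False_eq_True sum.empty add_0_right)
          (simp split: split_indicator)
      ultimately show ?case by (simp only:)
    qed
  qed
  also have "\<dots> = (\<Sum>k<m. ?G k * emeasure lam (B \<inter> A k))"
  proof -
    have BA: "B \<inter> A k \<in> sets lam" if "k < m" for k using part_meas[OF that] B by (simp add: sets_lam sets.Int)
    then show ?thesis
      by (subst nn_integral_sum)
        (auto intro!: borel_measurable_times_ennreal borel_measurable_indicator simp: nn_integral_cmult_indicator)
  qed
  also have "\<dots> = (\<Sum>k<m. \<Sum>i<q. ennreal (1 / real q) * emeasure lam (B \<inter> A k) * emeasure (tr (i * m + k)) C)"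
  proof (rule sum.cong[OF refl])
    fix k
    have "ennreal (1 / real q) = inverse (of_nat q)"
      using q_pos inverse_ennreal[of "real q"] by (simp add: ennreal_of_nat_eq_real_of_nat inverse_eq_divide)
    then show "?G k * emeasure lam (B \<inter> A k) =
        (\<Sum>i<q. ennreal (1 / real q) * emeasure lam (B \<inter> A k) * emeasure (tr (i * m + k)) C)"
      by (simp add: emeasure_averaged_translate[OF C] divide_ennreal_def sum_distrib_left[symmetric] mult_ac)
  qed
  also have "\<dots> = (\<Sum>j<q * m. wt j B * emeasure (tr j) C)"
    using sum_mod_div[OF m_pos, of "\<lambda>j k. ennreal (1 / real q) * emeasure lam (B \<inter> A k) * emeasure (tr j) C" q] by simp
  finally show ?thesis .
qed

lemma emeasure_fibre_M:
  "C \<in> sets borel \<Longrightarrow> B \<in> sets borel \<Longrightarrow> emeasure (fibre M B) C = (\<Sum>j<q * m. wt j B * emeasure (tr j) C)"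
  by (simp add: emeasure_fibre[OF sets_M] emeasure_rect)

lemma AE_fibre_M:
  assumes P: "{x. P x} \<in> sets borel" "\<And>j. AE x in tr j. P x" and B: "B \<in> sets borel"
  shows "AE x in fibre M B. P x"
proof -
  have P': "{x. \<not> P x} \<in> sets borel"
    using sets.compl_sets[OF P(1)] by (simp add: Compl_eq_Diff_UNIV[symmetric] Collect_neg_eq)
  have "emeasure (tr j) {x. \<not> P x} = 0" for j
    using P(2)[of j] P' trD(2,3)[of j] by (subst (asm) AE_iff_measurable[OF _ refl]) auto
  then have "emeasure (fibre M B) {x. \<not> P x} = 0"
    by (simp add: emeasure_fibre_M[OF P' B])
  then have "AE x in fibre M B. x \<notin> {x. \<not> P x}"
    using P' by (intro AE_not_in) (simp add: null_sets_def)
  then show ?thesis by simp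
qed

lemma inv_fibre_M:
  assumes B: "B \<in> sets borel"
  shows "ssm.inv_meas (fibre M B)"
  by (rule ssm.inv_meas_sum[where I="{..<q * m}" and \<nu>=tr and a="\<lambda>j. wt j B"])
    (use prob_M B trD finite_measure_fibre[OF _ sets_M B] emeasure_fibre_M[OF _ B]
      in \<open>simp_all add: prob_space_def\<close>)

lemma fibre_UNIV: "distr M borel even_part = fibre M UNIV"
proof -
  have "density M (indicator UNIV) = M" by (simp add: density_1)
  then show ?thesis by (simp add: fibre_def)
qed

lemma AE_Xstar: "AE x in M. x \<in> Xstar"
proof -
  have "AE x in distr M borel even_part. x \<in> Xstar_even"
    unfolding fibre_UNIV using AE_fibre_M[of "\<lambda>x. x \<in> Xstar_even" UNIV] trD(4) Xstar_measurable by simp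
  moreover have "even_part \<in> M \<rightarrow>\<^sub>M borel" using sets_M even_part_measurable by (simp cong: measurable_cong_sets)
  ultimately have "AE x in M. even_part x \<in> Xstar_even" by (rule AE_distrD[rotated])
  then show ?thesis by (simp add: even_part_Xstar)
qed

lemma marginal_N_states: "fibre M UNIV \<in> N_states \<rho>"
proof -
  have "even_part \<in> M \<rightarrow>\<^sub>M borel" using sets_M even_part_measurable by (simp cong: measurable_cong_sets)
  then have "prob_space (fibre M UNIV)"
    unfolding fibre_UNIV[symmetric] by (rule prob_space.prob_space_distr[OF prob_M])
  then show ?thesis
    using AE_fibre_M[of "\<lambda>x. x \<in> Xstar_even" UNIV] AE_fibre_M[of "dens \<rho>" UNIV] trD(4,6) Xstar_measurable
      dens_measurable inv_fibre_M[of UNIV]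
    by (simp add: N_states_iff has_density_iff)
qed

text \<open>Translation carries the \<open>j\<close>-th product term to the next one, since states
  and cells move together; periodicity closes the cycle.\<close>

lemma distr_translate_M: "distr M borel translate = M"
proof (rule measure_eqI_rect)
  have T: "translate \<in> M \<rightarrow>\<^sub>M borel" using sets_M translate_measurable by (simp cong: measurable_cong_sets)
  show "finite_measure (distr M borel translate)"
    using prob_space.prob_space_distr[OF prob_M T] by (simp add: prob_space_def)
  show "sets M = sets borel" by (rule sets_M)
  fix C :: "config set" and B :: "spins set" assume C: "C \<in> sets borel" and B: "B \<in> sets borel"
  have TC: "translate -` C \<in> sets borel" and TB: "translate -` B \<in> sets borel"
    using measurable_sets[OF translate_measurable C] measurable_sets[OF translate_measurable B] by simp_all
  have "translate -` rect C B = rect (translate -` C) (translate -` B)"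
    by (auto simp: rect_def even_part_translate odd_sites_translate)
  then have "emeasure (distr M borel translate) (rect C B) = emeasure M (rect (translate -` C) (translate -` B))"
    using emeasure_distr[OF T rect_measurable[OF C B]] space_M by simp
  also have "\<dots> = (\<Sum>j<q * m. wt j (translate -` B) * emeasure (tr j) (translate -` C))"
    by (rule emeasure_rect[OF TC TB])
  also have "\<dots> = (\<Sum>j<q * m. wt (Suc j) B * emeasure (tr (Suc j)) C)"
  proof (rule sum.cong[OF refl])
    fix j
    have "translate \<in> tr j \<rightarrow>\<^sub>M borel" using trD(2) translate_measurable by (simp cong: measurable_cong_sets)
    then have 1: "emeasure (tr j) (translate -` C) = emeasure (tr (Suc j)) C"
      using C trD(3) by (simp add: push_translate_def[of "tr j"] emeasure_distr)
    have "zimg 1 (translate -` B \<inter> A (j mod m)) = B \<inter> A (Suc j mod m)"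
    proof -
      have "zimg 1 (translate -` B) = B" by (simp add: vimage_translate zimg_add)
      moreover have "zimg 1 (A (j mod m)) = A (Suc j mod m)"
        using partition_family_zimg[OF part, of "j mod m" 1] m_pos by (simp add: mod_simps)
      ultimately show ?thesis by (auto simp: zimg_def)
    qed
    moreover have "measure lam (zimg 1 (translate -` B \<inter> A (j mod m))) = measure lam (translate -` B \<inter> A (j mod m))"
      using TB A_mod(1) by (intro measure_zimg) auto
    ultimately have "emeasure lam (translate -` B \<inter> A (j mod m)) = emeasure lam (B \<inter> A (Suc j mod m))"
      by (simp add: emeasure_eq_measure)
    then show "wt j (translate -` B) * emeasure (tr j) (translate -` C) = wt (Suc j) B * emeasure (tr (Suc j)) C"
      by (simp only: 1)
  qed
  also have "\<dots> = (\<Sum>j<q * m. wt j B * emeasure (tr j) C)"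
  proof -
    let ?f = "\<lambda>j. wt j B * emeasure (tr j) C"
    obtain n where n: "q * m = Suc n" using m_pos q_pos by (metis mult_is_0 not0_implies_Suc not_gr_zero)
    \<comment> \<open>The wrap-around term: the state returns by \<open>period\<close>, the cell
      because its index is reduced modulo \<open>m\<close>.\<close>
    have e: "?f (Suc n) = ?f 0" unfolding n[symmetric] using period by simp
    have "(\<Sum>j<Suc n. ?f (Suc j)) = (\<Sum>j<n. ?f (Suc j)) + ?f (Suc n)" by (rule sum.lessThan_Suc)
    also have "\<dots> = ?f 0 + (\<Sum>j<n. ?f (Suc j))" unfolding e by (rule add.commute)
    also have "\<dots> = (\<Sum>j<Suc n. ?f j)" by (rule sum.lessThan_Suc_shift[symmetric])
    finally show ?thesis unfolding n .
  qed
  also have "\<dots> = emeasure M (rect C B)" by (rule emeasure_rect[OF C B, symmetric])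
  finally show "emeasure (distr M borel translate) (rect C B) = emeasure M (rect C B)" .
qed simp

lemma M_TIS: "M \<in> TIS"
  unfolding TIS_iff
proof (intro conjI prob_M sets_M AE_Xstar)
  have fin: "finite_measure M" using prob_M by (simp add: prob_space_def)
  show "shift.inv_meas M"
    using sets_M fin distr_translate_M by (simp add: invariant_under_return[OF translate_measurable])
  show "ssm.inv_meas M"
    using inv_fibre_M by (simp add: inv_meas_iff_fibre[OF sets_M fin AE_Xstar])
qed

end

section \<open>Decomposition of states over their parities\<close>

text \<open>Equality of two measures is decided by countably many cells of the code.\<close>

lemma kernel_eq_measurable:
  fixes f g :: "'b \<Rightarrow> config measure"
  assumes "f \<in> N \<rightarrow>\<^sub>M prob_algebra borel" "g \<in> N \<rightarrow>\<^sub>M prob_algebra borel" "space N = UNIV"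
  shows "{x. f x = g x} \<in> sets N"
proof -
  have fg: "sets (f x) = sets borel" "sets (g x) = sets borel" "prob_space (f x)" for x
    using measurable_space[OF assms(1), of x] measurable_space[OF assms(2), of x] assms(3)
    by (simp_all add: space_prob_algebra)
  have m: "(\<lambda>x. emeasure (f x) (ssm.cell q)) \<in> borel_measurable N" "(\<lambda>x. emeasure (g x) (ssm.cell q)) \<in> borel_measurable N" for q
    using measurable_emeasure_kernel[OF measurable_prob_algebraD[OF assms(1)] ssm.cell_measurable]
      measurable_emeasure_kernel[OF measurable_prob_algebraD[OF assms(2)] ssm.cell_measurable] by auto
  have "{x. f x = g x} = (\<Inter>q. {x \<in> space N. emeasure (f x) (ssm.cell q) = emeasure (g x) (ssm.cell q)})"
  proof (intro set_eqI iffI)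
    fix x assume h: "x \<in> (\<Inter>q. {x \<in> space N. emeasure (f x) (ssm.cell q) = emeasure (g x) (ssm.cell q)})"
    have "f x = g x"
      by (rule ssm.measure_eqI_cells[OF fg(1,2)]) (use fg(3)[of x] h in \<open>auto simp: prob_space_def\<close>)
    then show "x \<in> {x. f x = g x}" by simp
  qed (use assms(3) in auto)
  also have "\<dots> \<in> sets N" using m by (intro sets.countable_INT) (auto intro!: borel_measurable_eq)
  finally show ?thesis .
qed

lemma fibre_UNIV_eq: "fibre M UNIV = distr M borel even_part"
  by (simp add: fibre_def density_1)

lemma TIS_D:
  assumes "M \<in> TIS"
  shows "prob_space M" "sets M = sets borel" "space M = UNIV" "AE x in M. x \<in> Xstar"
  "shift.inv_meas M" "ssm.inv_meas M" "distr M borel translate = M" "finite_measure M"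
  using assms sets_eq_imp_space_eq[of M borel]
  by (auto simp: TIS_iff invariant_under_return[OF translate_measurable] prob_space_def)

lemma TIS_measurable:
  assumes "M \<in> TIS"
  shows "even_part \<in> M \<rightarrow>\<^sub>M borel" "odd_sites \<in> M \<rightarrow>\<^sub>M borel" "translate \<in> M \<rightarrow>\<^sub>M borel"
  using TIS_D(2)[OF assms] even_part_measurable odd_sites_measurable translate_measurable
  by (simp_all cong: measurable_cong_sets)

lemma shift_invariant_distr:
  fixes f :: "config \<Rightarrow> int \<Rightarrow> 'b::second_countable_topology"
  assumes M: "M \<in> TIS" and f: "f \<in> borel \<rightarrow>\<^sub>M borel" "\<And>\<eta>. f (translate \<eta>) = translate (f \<eta>)"
  shows "shift_invariant (distr M borel f)"
proof -
  note d = TIS_D[OF M] and m = TIS_measurable[OF M]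
  have fM: "f \<in> M \<rightarrow>\<^sub>M borel" using f(1) d(2) by (simp cong: measurable_cong_sets)
  have "distr (distr M borel f) borel translate = distr M borel (translate \<circ> f)"
    by (rule distr_distr[OF translate_measurable fM])
  also have "translate \<circ> f = f \<circ> translate" by (auto simp: f(2))
  also have "distr M borel \<dots> = distr (distr M borel translate) borel f"
    by (rule distr_distr[OF f(1) m(3), symmetric])
  finally show ?thesis
    using prob_space.prob_space_distr[OF d(1) fM]
    by (simp add: d(7) shift_invariant_def shift_invariant_axioms_def)
qed

lemma shift_invariant_marginals:
  assumes M: "M \<in> TIS"
  shows "shift_invariant (fibre M UNIV)" "shift_invariant (distr M borel odd_sites)"
  unfolding fibre_UNIV_eq
  by (intro shift_invariant_distr[OF M] even_part_measurable odd_sites_measurable even_part_translate odd_sites_translate)+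

text \<open>Translating a coincidence onwards by \<open>n - j\<close> steps would produce a period
  smaller than \<open>n\<close>.\<close>

lemma minimal_period_inj:
  assumes min: "minimal_period \<kappa> n" and ij: "i < n" "j < n" and eq: "(push_translate ^^ i) \<kappa> = (push_translate ^^ j) \<kappa>"
  shows "i = j"
proof -
  have False if "i < j" "j < n" "(push_translate ^^ i) \<kappa> = (push_translate ^^ j) \<kappa>" for i j
  proof -
    have "(push_translate ^^ (n - j + i)) \<kappa> = (push_translate ^^ (n - j)) ((push_translate ^^ i) \<kappa>)" by (simp add: funpow_add)
    also have "\<dots> = (push_translate ^^ (n - j + j)) \<kappa>" unfolding that(3) by (simp add: funpow_add)
    also have "\<dots> = \<kappa>" using that min by (simp add: minimal_period_def)
    finally have "(push_translate ^^ (n - j + i)) \<kappa> = \<kappa>" .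
    moreover have "0 < n - j + i" "n - j + i < n" using that by auto
    ultimately show False using min unfolding minimal_period_def by blast
  qed
  then show ?thesis using ij eq by (metis linorder_neqE_nat)
qed

text \<open>\<open>Q\<close> is the ergodic decomposition of the even marginal of one reference
  state \<open>M0\<close>. Comparing another state with \<open>M0\<close> is possible because it can
  be decomposed with the same \<open>Q\<close>.\<close>

locale decomp =
  fixes \<rho> :: real and M0 :: "config measure" and Q :: "config \<Rightarrow> config measure"
  assumes M0: "M0 \<in> TIS" and marg: "fibre M0 UNIV \<in> N_states \<rho>"
    and Qm [measurable]: "Q \<in> borel \<rightarrow>\<^sub>M prob_algebra borel"
    and Q_inv: "\<And>\<mu>. ssm.inv_meas \<mu> \<Longrightarrow> absolutely_continuous (fibre M0 UNIV) \<mu> \<Longrightarrow> invariant_under borel Q \<mu>"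
    and Q_stat: "AE x in fibre M0 UNIV. ssm.inv_meas (Q x)"
    and Q_erg: "AE x in fibre M0 UNIV. \<forall>\<mu>. prob_space \<mu> \<and> ssm.inv_meas \<mu> \<and> absolutely_continuous (Q x) \<mu> \<longrightarrow> \<mu> = Q x"
    and count: "countable (N_extremal \<rho>)"

lemma decomp_exists:
  assumes "M0 \<in> TIS" "fibre M0 UNIV \<in> N_states \<rho>" "countable (N_extremal \<rho>)"
  obtains Q where "decomp \<rho> M0 Q"
proof -
  have "ssm.inv_meas (fibre M0 UNIV)" "prob_space (fibre M0 UNIV)" using assms(2) by (auto simp: N_states_iff)
  then obtain Q where "Q \<in> borel \<rightarrow>\<^sub>M prob_algebra borel"
    "\<And>\<mu>. ssm.inv_meas \<mu> \<Longrightarrow> absolutely_continuous (fibre M0 UNIV) \<mu> \<Longrightarrow> invariant_under borel Q \<mu>"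
    "AE x in fibre M0 UNIV. ssm.inv_meas (Q x)"
    "AE x in fibre M0 UNIV. \<forall>\<mu>. prob_space \<mu> \<and> ssm.inv_meas \<mu> \<and> absolutely_continuous (Q x) \<mu> \<longrightarrow> \<mu> = Q x"
    by (rule ssm.ergodic_decomposition) blast
  then show ?thesis using that[of Q] assms by (simp add: decomp_def)
qed

context decomp
begin

abbreviation "\<nu>0 \<equiv> fibre M0 UNIV"
text \<open>The configurations generic for \<kappa>. For distinct states these sets are disjoint,
  and an absolutely continuous extremal state is carried by its own.\<close>

abbreviation "E \<kappa> \<equiv> {x. Q x = \<kappa>}"
abbreviation "ac \<mu> \<equiv> absolutely_continuous \<nu>0 \<mu>"

sublocale Q: markov_kernel "borel :: config measure" Q
  by standard (use Qm in auto)

lemmas M0D = TIS_D[OF M0]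

lemma \<nu>0D: "prob_space \<nu>0" "AE x in \<nu>0. x \<in> Xstar_even" "ssm.inv_meas \<nu>0" "AE x in \<nu>0. dens \<rho> x" "space \<nu>0 = UNIV"
  using marg sets_eq_imp_space_eq[OF sets_fibre[of M0 UNIV]] by (auto simp: N_states_iff has_density_iff)

lemma \<nu>0_Q: "Q.inv_meas \<nu>0"
  by (rule Q_inv[OF \<nu>0D(3)]) (simp add: absolutely_continuous_def)

lemma E_measurable [measurable]: "\<kappa> \<in> N_extremal \<rho> \<Longrightarrow> E \<kappa> \<in> sets borel"
  using N_extremalD[of \<kappa> \<rho>]
  by (intro kernel_eq_measurable[OF Qm] measurable_const) (auto simp: space_prob_algebra)

text \<open>Each part of a convex decomposition of \<open>Q x\<close> is absolutely continuous with
  respect to it, and \<open>Q_erg\<close> leaves no such stationary probability measure except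
  \<open>Q x\<close>. Density and evenness pass from the mixture to almost every
  \<open>Q x\<close>.\<close>

lemma Q_extremal: "AE x in \<nu>0. Q x \<in> N_extremal \<rho>"
  using Q_stat Q_erg Q.AE_kernel[OF \<nu>0_Q \<nu>0D(2)] Q.AE_kernel[OF \<nu>0_Q \<nu>0D(4)]
proof eventually_elim
  case (elim x)
  interpret Qx: prob_space "Q x" by (rule Q.prob_space_kernel)
  have "Q x \<in> N_states \<rho>" using elim Qx.prob_space_axioms by (simp add: N_states_iff has_density_iff)
  moreover have one: "M1 = Q x"
    if h: "M1 \<in> N_states \<rho>" "0 < t" "t < (1::real)"
      "\<And>B. B \<in> sets borel \<Longrightarrow> measure (Q x) B = t * measure M1 B + (1 - t) * measure M2 B" for M1 M2 t
  proof -
    have m1: "prob_space M1" "sets M1 = sets borel" "ssm.inv_meas M1" using h(1) by (auto simp: N_states_iff)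
    interpret M1: prob_space M1 by (rule m1)
    have "absolutely_continuous (Q x) M1"
      unfolding absolutely_continuous_def
    proof
      fix Z assume "Z \<in> null_sets (Q x)"
      then have Z: "Z \<in> sets borel" "measure (Q x) Z = 0" by (auto simp: null_sets_def measure_def)
      have "0 \<le> t * measure M1 Z" "0 \<le> (1 - t) * measure M2 Z" using h by simp_all
      then have "t * measure M1 Z = 0" using h(4)[OF Z(1)] Z(2) by linarith
      then show "Z \<in> null_sets M1" using Z h m1 by (simp add: null_sets_def M1.emeasure_eq_measure)
    qed
    then show ?thesis using elim(2) m1 by blast
  qed
  have "M1 = Q x \<and> M2 = Q x"
    if h: "M1 \<in> N_states \<rho>" "M2 \<in> N_states \<rho>" "0 < t \<and> t < (1::real) \<and>
      (\<forall>B\<in>sets borel. measure (Q x) B = t * measure M1 B + (1 - t) * measure M2 B)" for M1 M2 t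
  proof
    show "M1 = Q x" by (rule one[OF h(1), of t M2]) (use h(3) in auto)
    show "M2 = Q x" by (rule one[OF h(2), of "1 - t" M1]) (use h(3) in auto)
  qed
  ultimately show ?case unfolding N_extremal_def extremal_states_def by blast
qed

lemma AE_ac: "ac \<mu> \<Longrightarrow> sets \<mu> = sets borel \<Longrightarrow> AE x in \<nu>0. P x \<Longrightarrow> AE x in \<mu>. P x"
  by (rule absolutely_continuous_AE) auto

text \<open>In the mixture that represents \<mu>, only the points with conditional law \<kappa> are
  kept.\<close>

lemma E_dominates:
  assumes \<mu>: "ssm.inv_meas \<mu>" "ac \<mu>" and \<kappa>: "\<kappa> \<in> N_extremal \<rho>" and C: "C \<in> sets borel"
  shows "emeasure \<mu> (E \<kappa>) * emeasure \<kappa> C \<le> emeasure \<mu> C"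
proof -
  have s: "sets \<mu> = sets borel" using ssm.inv_measD[OF \<mu>(1)] by simp
  have "emeasure \<mu> (E \<kappa>) * emeasure \<kappa> C = (\<integral>\<^sup>+x. emeasure \<kappa> C * indicator (E \<kappa>) x \<partial>\<mu>)"
    using E_measurable[OF \<kappa>] s by (subst nn_integral_cmult_indicator) (auto simp: mult.commute)
  also have "\<dots> \<le> (\<integral>\<^sup>+x. emeasure (Q x) C \<partial>\<mu>)"
    by (rule nn_integral_mono) (auto split: split_indicator)
  also have "\<dots> = emeasure \<mu> C" by (rule Q.inv_measD(4)[OF Q_inv[OF \<mu>] C, symmetric])
  finally show ?thesis .
qed

text \<open>If \<kappa> charged \<open>E j\<close> for another extremal \<open>j\<close>, it would
  dominate a multiple of \<open>j\<close>, against its extremality. Countability excludes all such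
  \<open>j\<close> at once.\<close>

lemma E_full:
  assumes \<kappa>: "\<kappa> \<in> N_extremal \<rho>" "ac \<kappa>"
  shows "AE x in \<kappa>. Q x = \<kappa>"
proof -
  note k = N_extremalD[OF \<kappa>(1)]
  interpret \<kappa>: prob_space \<kappa> by (rule k)
  have "AE x in \<kappa>. j \<noteq> \<kappa> \<longrightarrow> Q x \<noteq> j" if j: "j \<in> N_extremal \<rho>" for j
  proof (cases "j = \<kappa>")
    case False
    interpret j: prob_space j by (rule N_extremalD[OF j])
    have "\<not> measure \<kappa> (E j) > 0"
    proof
      assume p: "measure \<kappa> (E j) > 0"
      have "measure \<kappa> (E j) * measure j B \<le> measure \<kappa> B" if "B \<in> sets borel" for B
        using E_dominates[OF k(5) \<kappa>(2) j that]
        by (simp add: \<kappa>.emeasure_eq_measure j.emeasure_eq_measure ennreal_mult[symmetric])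
      then show False using N_extremal_dominated[OF \<kappa>(1) N_extremalD(1)[OF j] p] False by simp
    qed
    then have "measure \<kappa> (E j) = 0" by (simp add: less_le)
    then have "AE x in \<kappa>. x \<notin> E j"
      using E_measurable[OF j] k by (intro AE_not_in) (simp add: null_sets_def \<kappa>.emeasure_eq_measure)
    then show ?thesis by eventually_elim simp
  qed simp
  then have "AE x in \<kappa>. \<forall>j\<in>N_extremal \<rho>. j \<noteq> \<kappa> \<longrightarrow> Q x \<noteq> j" by (simp add: AE_ball_countable count)
  moreover have "AE x in \<kappa>. Q x \<in> N_extremal \<rho>" by (rule AE_ac[OF \<kappa>(2) k(3) Q_extremal])
  ultimately show ?thesis by eventually_elim blast
qed

lemma ac_of_pos:
  assumes \<kappa>: "\<kappa> \<in> N_extremal \<rho>" and p: "emeasure \<nu>0 (E \<kappa>) > 0"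
  shows "ac \<kappa>"
  unfolding absolutely_continuous_def
proof
  fix Z assume "Z \<in> null_sets \<nu>0"
  then have Z: "Z \<in> sets borel" "emeasure \<nu>0 Z = 0" by (auto simp: null_sets_def)
  have "ac \<nu>0" by (simp add: absolutely_continuous_def)
  from E_dominates[OF \<nu>0D(3) this \<kappa> Z(1)] have "emeasure \<kappa> Z = 0" using Z p by auto
  then show "Z \<in> null_sets \<kappa>" using Z N_extremalD[OF \<kappa>] by (simp add: null_sets_def)
qed

text \<open>A state \<open>j\<close> with \<open>E j\<close> null is a value of \<open>Q\<close> on
  a null set only, and there are countably many of them. The remaining values are charged by the
  marginal, hence absolutely continuous.\<close>

lemma Q_good: "AE x in \<nu>0. Q x \<in> N_extremal \<rho> \<and> ac (Q x)"
proof -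
  have "AE x in \<nu>0. emeasure \<nu>0 (E j) = 0 \<longrightarrow> Q x \<noteq> j" if j: "j \<in> N_extremal \<rho>" for j
  proof (cases "emeasure \<nu>0 (E j) = 0")
    case True
    then have "AE x in \<nu>0. x \<notin> E j"
      using E_measurable[OF j] by (intro AE_not_in) (simp add: null_sets_def)
    then show ?thesis by eventually_elim simp
  qed simp
  then have "AE x in \<nu>0. \<forall>j\<in>N_extremal \<rho>. emeasure \<nu>0 (E j) = 0 \<longrightarrow> Q x \<noteq> j" by (simp add: AE_ball_countable count)
  then show ?thesis using Q_extremal
  proof eventually_elim
    case (elim x)
    then have "emeasure \<nu>0 (E (Q x)) > 0" by (auto simp: zero_less_iff_neq_zero)
    then show ?case using elim ac_of_pos by blast
  qed
qed

lemma exists_charged: "\<exists>\<kappa>\<in>N_extremal \<rho>. emeasure \<nu>0 (E \<kappa>) > 0"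
proof (rule ccontr)
  interpret prob_space \<nu>0 by (rule \<nu>0D)
  assume h: "\<not> ?thesis"
  have "AE x in \<nu>0. Q x \<noteq> j" if j: "j \<in> N_extremal \<rho>" for j
  proof -
    have "AE x in \<nu>0. x \<notin> E j"
      using E_measurable[OF j] h j by (intro AE_not_in) (auto simp: null_sets_def zero_less_iff_neq_zero)
    then show ?thesis by eventually_elim simp
  qed
  then have "AE x in \<nu>0. \<forall>j\<in>N_extremal \<rho>. Q x \<noteq> j" by (simp add: AE_ball_countable count)
  then have "AE x in \<nu>0. False" using Q_extremal by eventually_elim blast
  then show False by simp
qed

lemma \<nu>0_translate: "push_translate \<nu>0 = \<nu>0"
  using shift_invariant.lam_translate[OF shift_invariant_marginals(1)[OF M0]] by (simp add: push_translate_def)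

lemma ac_translate:
  assumes "ac \<kappa>" "sets \<kappa> = sets borel"
  shows "ac (push_translate \<kappa>)"
  unfolding absolutely_continuous_def
proof
  fix Z assume "Z \<in> null_sets \<nu>0"
  then have Z: "Z \<in> sets borel" "emeasure (push_translate \<nu>0) Z = 0" by (auto simp: null_sets_def \<nu>0_translate)
  have t: "translate \<in> \<nu>0 \<rightarrow>\<^sub>M borel" "translate \<in> \<kappa> \<rightarrow>\<^sub>M borel"
    using assms translate_measurable by (simp_all cong: measurable_cong_sets)
  have TZ: "translate -` Z \<in> sets borel" using measurable_sets[OF translate_measurable Z(1)] by simp
  have sp: "space \<kappa> = UNIV" using sets_eq_imp_space_eq[OF assms(2)] by simp
  have "translate -` Z \<in> null_sets \<nu>0"
    using Z TZ \<nu>0D(5) emeasure_distr[OF t(1) Z(1)] by (simp add: null_sets_def push_translate_def)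
  then have "emeasure \<kappa> (translate -` Z) = 0" using assms(1) by (auto simp: absolutely_continuous_def)
  then show "Z \<in> null_sets (push_translate \<kappa>)"
    using Z emeasure_distr[OF t(2) Z(1)] sp by (simp add: null_sets_def push_translate_def)
qed

lemma ac_translate_pow:
  assumes "\<kappa> \<in> N_extremal \<rho>" "ac \<kappa>"
  shows "ac ((push_translate ^^ j) \<kappa>)"
proof (induction j)
  case (Suc j)
  then show ?case
    using ac_translate[OF Suc] N_extremalD(3)[OF N_extremal_translate_pow[OF assms(1), of j]] by simp
qed (use assms in simp)

text \<open>Checked under almost every conditional law \<kappa>: there \<open>Q\<close> has the
  constant value \<kappa>, and under the translate of \<kappa> it has the translated value.\<close>

lemma Q_translate: "AE x in \<nu>0. Q (translate x) = push_translate (Q x)"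
proof (rule Q.AE_of_AE_kernel[OF \<nu>0_Q])
  have "(\<lambda>x. push_translate (Q x)) \<in> borel \<rightarrow>\<^sub>M prob_algebra borel"
    unfolding push_translate_def
    by (rule measurable_compose[OF Qm measurable_distr_prob_space[OF translate_measurable]])
  then show "{x. Q (translate x) = push_translate (Q x)} \<in> sets borel"
    by (intro kernel_eq_measurable measurable_compose[OF translate_measurable Qm]) auto
  show "AE x in \<nu>0. AE y in Q x. Q (translate y) = push_translate (Q y)"
    using Q_good
  proof eventually_elim
    case (elim x)
    let ?\<kappa> = "Q x"
    note k = N_extremalD[OF conjunct1[OF elim]]
    have t: "translate \<in> ?\<kappa> \<rightarrow>\<^sub>M borel"
      using k translate_measurable by (simp cong: measurable_cong_sets)
    have "AE y in push_translate ?\<kappa>. Q y = push_translate ?\<kappa>"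
      using elim by (intro E_full N_extremal_translate ac_translate k(3)) auto
    then have "AE y in ?\<kappa>. Q (translate y) = push_translate ?\<kappa>"
      unfolding push_translate_def[of ?\<kappa>] by (rule AE_distrD[OF t])
    moreover have "AE y in ?\<kappa>. Q y = ?\<kappa>" using elim by (intro E_full) auto
    ultimately show ?case by eventually_elim simp
  qed
qed

text \<open>The states to which the fixed \<open>Q\<close> applies: \<open>M0\<close> itself, and
  the components of \<open>M0\<close> that arise when its extremality is tested.\<close>

definition dominated :: "config measure \<Rightarrow> bool" where
  "dominated M \<longleftrightarrow> M \<in> TIS \<and> ac (fibre M UNIV)"

lemma dominatedD:
  assumes "dominated M"
  shows "prob_space M" "sets M = sets borel" "space M = UNIV" "AE x in M. x \<in> Xstar"
  "ssm.inv_meas M" "distr M borel translate = M" "finite_measure M" "ac (fibre M UNIV)"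
  using assms TIS_D[of M] by (auto simp: dominated_def)

lemma dominated_M0: "dominated M0"
  using M0 by (simp add: dominated_def absolutely_continuous_def)

lemma ac_fibre:
  assumes "dominated M" and B: "B \<in> sets borel"
  shows "ac (fibre M B)"
  unfolding absolutely_continuous_def
proof
  note d = dominatedD[OF assms(1)]
  fix Z assume "Z \<in> null_sets \<nu>0"
  then have Z: "Z \<in> sets borel" "emeasure (fibre M UNIV) Z = 0"
    using d(8) by (auto simp: absolutely_continuous_def null_sets_def)
  have "emeasure (fibre M B) Z \<le> emeasure (fibre M UNIV) Z"
    using emeasure_fibre[OF d(2) B Z(1)] emeasure_fibre[OF d(2) _ Z(1), of UNIV] rect_measurable[OF Z(1), of UNIV] d(2)
    by (auto intro!: emeasure_mono simp: rect_def)
  then show "Z \<in> null_sets (fibre M B)" using Z by (simp add: null_sets_def)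
qed

lemma fibre_inv: "dominated M \<Longrightarrow> B \<in> sets borel \<Longrightarrow> ssm.inv_meas (fibre M B)"
  using dominatedD[of M] inv_meas_iff_fibre[of M] by blast

text \<open>On the event that the even part is generic for \<kappa>, even part and parities are
  independent and the even part has law \<kappa>. This is the product structure of a stationary
  state.\<close>

lemma rect_E:
  assumes M: "dominated M" and \<kappa>: "\<kappa> \<in> N_extremal \<rho>" "ac \<kappa>" and C: "C \<in> sets borel" and B: "B \<in> sets borel"
  shows "emeasure M (rect (C \<inter> E \<kappa>) B) = emeasure \<kappa> C * emeasure M (rect (E \<kappa>) B)"
proof -
  note d = dominatedD[OF M] and k = N_extremalD[OF \<kappa>(1)]
  have CE: "C \<inter> E \<kappa> \<in> sets borel" "E \<kappa> \<in> sets borel" using C E_measurable[OF \<kappa>(1)] by auto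
  have "emeasure M (rect (C \<inter> E \<kappa>) B) = (\<integral>\<^sup>+x. emeasure (Q x) (C \<inter> E \<kappa>) \<partial>fibre M B)"
    using Q.inv_measD(4)[OF Q_inv[OF fibre_inv[OF M B] ac_fibre[OF M B]] CE(1)]
    by (simp add: emeasure_fibre[OF d(2) B CE(1)])
  also have "\<dots> = (\<integral>\<^sup>+x. emeasure \<kappa> C * indicator (E \<kappa>) x \<partial>fibre M B)"
  proof (rule nn_integral_cong_AE)
    have "AE x in fibre M B. Q x \<in> N_extremal \<rho> \<and> ac (Q x)"
      by (rule AE_ac[OF ac_fibre[OF M B] _ Q_good]) simp
    then show "AE x in fibre M B. emeasure (Q x) (C \<inter> E \<kappa>) = emeasure \<kappa> C * indicator (E \<kappa>) x"
    proof eventually_elim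
      case (elim x)
      have full: "AE y in Q x. Q y = Q x" using elim by (intro E_full) auto
      show ?case
      proof (cases "Q x = \<kappa>")
        case True
        then have "emeasure \<kappa> (C \<inter> E \<kappa>) = emeasure \<kappa> C"
          using full CE C k(3) by (intro emeasure_eq_AE) auto
        then show ?thesis using True by simp
      next
        case False
        then have "emeasure (Q x) (C \<inter> E \<kappa>) = emeasure (Q x) {}"
          using full CE by (intro emeasure_eq_AE) auto
        then show ?thesis using False by simp
      qed
    qed
  qed
  also have "\<dots> = emeasure \<kappa> C * emeasure M (rect (E \<kappa>) B)"
    using CE by (simp add: nn_integral_cmult_indicator emeasure_fibre[OF d(2) B CE(2)])
  finally show ?thesis .
qed

text \<open>Joint translation invariance moves the parity weight of \<kappa> to that of its
  translate, because the generic sets are permuted by \<open>Q_translate\<close>.\<close>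

lemma weight_translate:
  assumes M: "dominated M" and \<kappa>: "\<kappa> \<in> N_extremal \<rho>" and B: "B \<in> sets borel"
  shows "emeasure M (rect (E (push_translate \<kappa>)) B) = emeasure M (rect (E \<kappa>) (zimg (- 1) B))"
proof -
  note d = dominatedD[OF M] and k = N_extremalD[OF \<kappa>]
  have t: "translate \<in> M \<rightarrow>\<^sub>M borel" "even_part \<in> M \<rightarrow>\<^sub>M borel"
    using d translate_measurable even_part_measurable by (simp_all cong: measurable_cong_sets)
  let ?E = "E (push_translate \<kappa>)"
  have E: "?E \<in> sets borel" "E \<kappa> \<in> sets borel" using E_measurable[OF N_extremal_translate[OF \<kappa>]] E_measurable[OF \<kappa>] by auto
  have r: "rect ?E B \<in> sets borel" "rect (E \<kappa>) (zimg (- 1) B) \<in> sets borel"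
    using E B by (intro rect_measurable zimg_measurable; simp)+
  have tr: "translate -` rect ?E B \<in> sets borel" using measurable_sets[OF translate_measurable r(1)] by simp
  have "emeasure M (rect ?E B) = emeasure (distr M borel translate) (rect ?E B)" by (simp add: d(6))
  also have "\<dots> = emeasure M (translate -` rect ?E B)" using emeasure_distr[OF t(1) r(1)] d(3) by simp
  also have "\<dots> = emeasure M (rect (E \<kappa>) (zimg (- 1) B))"
  proof (rule emeasure_eq_AE)
    have "AE x in fibre M UNIV. Q (translate x) = push_translate (Q x)"
      by (rule AE_ac[OF d(8) _ Q_translate]) simp
    then have "AE x in M. Q (translate (even_part x)) = push_translate (Q (even_part x))"
      unfolding fibre_UNIV_eq by (rule AE_distrD[OF t(2)])
    then show "AE x in M. x \<in> translate -` rect ?E B \<longleftrightarrow> x \<in> rect (E \<kappa>) (zimg (- 1) B)"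
    proof eventually_elim
      case (elim x)
      have "push_translate (Q (even_part x)) = push_translate \<kappa> \<longleftrightarrow> Q (even_part x) = \<kappa>"
        using push_translate_inj[OF Q.sets_kernel k(3)] by auto
      then show ?case using elim
        by (simp add: rect_def even_part_translate odd_sites_translate zimg_iff flip: translate_eq_zshift)
    qed
  qed (use r tr d in auto)
  finally show ?thesis .
qed

lemma weight_translate_pow:
  assumes M: "dominated M" and \<kappa>: "\<kappa> \<in> N_extremal \<rho>" and B: "B \<in> sets borel"
  shows "emeasure M (rect (E ((push_translate ^^ j) \<kappa>)) B) = emeasure M (rect (E \<kappa>) (zimg (- int j) B))"
  using B
proof (induction j arbitrary: B)
  case (Suc j)
  have "emeasure M (rect (E ((push_translate ^^ Suc j) \<kappa>)) B) = emeasure M (rect (E ((push_translate ^^ j) \<kappa>)) (zimg (- 1) B))"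
    using weight_translate[OF M N_extremal_translate_pow[OF \<kappa>] Suc.prems] by simp
  also have "\<dots> = emeasure M (rect (E \<kappa>) (zimg (- int j) (zimg (- 1) B)))"
    by (rule Suc.IH) (rule zimg_measurable[OF Suc.prems])
  finally show ?case by (simp add: zimg_add algebra_simps)
qed simp

text \<open>When \<open>n\<close> translations fix \<kappa>, its parity weight is invariant under
  the \<open>n\<close>-th power of the shift, so on an atom of that power it is proportional to
  \<open>lam\<close>. The product form avoids division.\<close>

lemma atom_weight:
  fixes lam :: "spins measure"
  assumes M: "dominated M" and \<kappa>: "\<kappa> \<in> N_extremal \<rho>" and n: "(push_translate ^^ n) \<kappa> = \<kappa>"
    and lam: "shift_invariant lam" and dominated: "\<And>B. B \<in> sets borel \<Longrightarrow> emeasure lam B = 0 \<Longrightarrow> emeasure M (rect UNIV B) = 0"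
    and A: "A \<in> sets borel" "(translate ^^ n) -` A = A"
    and atom: "\<And>C. C \<in> sets borel \<Longrightarrow> (translate ^^ n) -` C = C \<Longrightarrow>
      (AE \<sigma> in lam. \<sigma> \<in> A \<longrightarrow> \<sigma> \<in> C) \<or> (AE \<sigma> in lam. \<sigma> \<in> A \<longrightarrow> \<sigma> \<notin> C)"
    and B: "B \<in> sets borel"
  shows "measure M (rect (E \<kappa>) (B \<inter> A)) * measure lam A = measure M (rect (E \<kappa>) A) * measure lam (B \<inter> A)"
proof -
  interpret lam: shift_invariant lam by fact
  note d = dominatedD[OF M]
  interpret M: prob_space M by (rule d)
  let ?T = "translate ^^ n :: spins \<Rightarrow> spins"
  note Ek = E_measurable[OF \<kappa>]
  let ?R = "rect (E \<kappa>) A"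
  have R: "?R \<in> sets borel" "?R \<in> sets M" using rect_measurable[OF Ek A(1)] d(2) by auto
  define w where "w = distr (density M (indicator ?R)) borel odd_sites"
  have om: "odd_sites \<in> density M (indicator ?R) \<rightarrow>\<^sub>M borel"
    using d odd_sites_measurable by (simp cong: measurable_cong_sets)
  have w: "emeasure w D = emeasure M (rect (E \<kappa>) (D \<inter> A))" if D: "D \<in> sets borel" for D
  proof -
    have "emeasure w D = emeasure (density M (indicator ?R)) (odd_sites -` D)"
      unfolding w_def using emeasure_distr[OF om D] d(3) by simp
    also have "\<dots> = emeasure M (?R \<inter> odd_sites -` D)"
      using odd_sites_vimage[OF D] d(2) R by (simp add: emeasure_density indicator_inter_arith[symmetric])
    also have "?R \<inter> odd_sites -` D = rect (E \<kappa>) (D \<inter> A)" by (auto simp: rect_def)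
    finally show ?thesis .
  qed
  have sw: "sets w = sets borel" by (simp add: w_def)
  have spw: "space w = UNIV" by (simp add: w_def)
  have fw: "finite_measure w"
    by (rule finite_measureI) (simp add: spw w M.emeasure_eq_measure)
  have Tw: "?T \<in> w \<rightarrow>\<^sub>M borel" using sw translate_pow_measurable by (simp cong: measurable_cong_sets)
  have iw: "distr w borel ?T = w"
  proof (rule measure_eqI)
    fix D assume "D \<in> sets (distr w borel ?T)"
    then have D: "D \<in> sets borel" by simp
    have TD: "?T -` D \<in> sets borel" using measurable_sets[OF translate_pow_measurable D] by simp
    have "emeasure (distr w borel ?T) D = emeasure w (?T -` D)" using emeasure_distr[OF Tw D] spw by simp
    also have "\<dots> = emeasure M (rect (E \<kappa>) (zimg (- int n) (D \<inter> A)))"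
      using A(2) unfolding w[OF TD] by (intro arg_cong[where f="\<lambda>B. emeasure M (rect (E \<kappa>) B)"])
        (auto simp: vimage_translate_pow zimg_iff set_eq_iff)
    also have "\<dots> = emeasure w D"
      using weight_translate_pow[OF M \<kappa>, of "D \<inter> A" n] D A(1) by (simp add: n w[OF D])
    finally show "emeasure (distr w borel ?T) D = emeasure w D" .
  qed (simp add: sw)
  have acw: "absolutely_continuous lam w"
    unfolding absolutely_continuous_def
  proof
    fix Z assume "Z \<in> null_sets lam"
    then have Z: "Z \<in> sets borel" "emeasure lam Z = 0" by (auto simp: null_sets_def lam.sets_lam)
    have "emeasure w Z \<le> emeasure M (rect UNIV Z)"
      unfolding w[OF Z(1)] using rect_measurable[OF _ Z(1), of UNIV] d(2) by (intro emeasure_mono) (auto simp: rect_def)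
    then show "Z \<in> null_sets w" using dominated[OF Z] Z sw by (simp add: null_sets_def)
  qed
  have Aw: "AE \<sigma> in w. \<sigma> \<in> A"
  proof -
    have cA: "- A \<in> sets borel" using sets.compl_sets[OF A(1)] by (simp add: Compl_eq_Diff_UNIV)
    have "emeasure w (- A) = 0" unfolding w[OF cA] by (simp add: rect_def)
    then have "AE \<sigma> in w. \<sigma> \<notin> - A" using cA sw by (intro AE_not_in) (simp add: null_sets_def)
    then show ?thesis by simp
  qed
  have "measure w B * measure lam A = measure w UNIV * measure lam (B \<inter> A)"
    using lam.distr_zshift[of "int n"]
    by (intro invariant_on_atom[OF _ translate_pow_measurable lam.prob_space_axioms lam.sets_lam _ fw sw iw acw A Aw atom B])
      (auto simp: translate_pow_eq_zshift)
  then show ?thesis using w[OF B] w[of UNIV] by (simp add: measure_def)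
qed

text \<open>The restriction of \<open>M\<close> to the event that the even part is generic for some translate \<open>tr j\<close>
  while the parities lie in the matching cell is a multiple of the basic state.\<close>

lemma basic_dominated:
  assumes M: "dominated M" and b: "basic_context lam \<kappa> m q A \<rho>" and min: "minimal_period \<kappa> (q * m)" and ac: "ac \<kappa>"
    and c: "0 < c"
    and wt: "\<And>j B. j < q * m \<Longrightarrow> B \<in> sets borel \<Longrightarrow>
      emeasure M (rect (E ((push_translate ^^ j) \<kappa>)) (B \<inter> A (j mod m))) = ennreal c * (ennreal (1 / real q) * emeasure lam (B \<inter> A (j mod m)))"
    and D: "D \<in> sets borel"
  shows "c * measure (basic lam \<kappa> m q A) D \<le> measure M D"
proof -
  interpret b: basic_context lam \<kappa> m q A \<rho> by fact
  note d = dominatedD[OF M]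
  interpret M: prob_space M by (rule d)
  interpret bM: prob_space "basic lam \<kappa> m q A" by (rule b.prob_M)
  note Ej = E_measurable[OF b.tr]
  let ?R = "\<lambda>j. rect (E (b.tr j)) (A (j mod m))"
  have R: "?R j \<in> sets borel" for j using Ej[of j] b.A_mod(1)[of j] by (rule rect_measurable)
  define G where "G = (\<Union>j<q * m. ?R j)"
  have G: "G \<in> sets borel" "G \<in> sets M" unfolding G_def using R d(2) by auto
  \<comment> \<open>Minimality of the period makes the translates distinct, hence their generic sets
    disjoint.\<close>
  have disj: "disjoint_family_on (\<lambda>j. rect (C \<inter> E (b.tr j)) (B \<inter> A (j mod m))) {..<q * m}" for C B
    unfolding disjoint_family_on_def
  proof (intro ballI impI)
    fix i j assume ij: "i \<in> {..<q * m}" "j \<in> {..<q * m}" "i \<noteq> j"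
    have "b.tr i \<noteq> b.tr j" using minimal_period_inj[OF min] ij by blast
    then show "rect (C \<inter> E (b.tr i)) (B \<inter> A (i mod m)) \<inter> rect (C \<inter> E (b.tr j)) (B \<inter> A (j mod m)) = {}"
      by (auto simp: rect_def)
  qed
  have "density M (indicator G) = scale_measure (ennreal c) (basic lam \<kappa> m q A)"
  proof (rule measure_eqI_rect)
    show "finite_measure (density M (indicator G))"
      using G(2) by (intro finite_measureI) (simp add: emeasure_density M.emeasure_eq_measure)
    show "sets (density M (indicator G)) = sets borel" "sets (scale_measure (ennreal c) (basic lam \<kappa> m q A)) = sets borel"
      using d(2) b.sets_M by simp_all
    fix C :: "config set" and B :: "spins set" assume C: "C \<in> sets borel" and B: "B \<in> sets borel"
    have "emeasure (density M (indicator G)) (rect C B) = emeasure M (G \<inter> rect C B)"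
      using rect_measurable[OF C B] d(2) G by (simp add: emeasure_density indicator_inter_arith[symmetric])
    also have "G \<inter> rect C B = (\<Union>j<q * m. rect (C \<inter> E (b.tr j)) (B \<inter> A (j mod m)))"
      by (auto simp: G_def rect_def)
    also have "emeasure M \<dots> = (\<Sum>j<q * m. emeasure M (rect (C \<inter> E (b.tr j)) (B \<inter> A (j mod m))))"
    proof (rule sum_emeasure[symmetric, OF _ disj])
      have "rect (C \<inter> E (b.tr j)) (B \<inter> A (j mod m)) \<in> sets borel" for j
        using C B Ej b.A_mod(1) by (intro rect_measurable sets.Int)
      then show "(\<lambda>j. rect (C \<inter> E (b.tr j)) (B \<inter> A (j mod m))) ` {..<q * m} \<subseteq> sets M" using d(2) by auto
    qed simp
    also have "\<dots> = (\<Sum>j<q * m. ennreal c * (b.wt j B * emeasure (b.tr j) C))"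
    proof (rule sum.cong[OF refl])
      fix j assume j: "j \<in> {..<q * m}"
      have BA: "B \<inter> A (j mod m) \<in> sets borel" using B b.A_mod(1) by auto
      show "emeasure M (rect (C \<inter> E (b.tr j)) (B \<inter> A (j mod m))) = ennreal c * (b.wt j B * emeasure (b.tr j) C)"
        using rect_E[OF M b.tr ac_translate_pow[OF b.\<nu>_ext ac] C BA] wt[OF _ B, of j] j by (simp add: mult_ac)
    qed
    also have "\<dots> = emeasure (scale_measure (ennreal c) (basic lam \<kappa> m q A)) (rect C B)"
      using b.emeasure_rect[OF C B] by (simp add: sum_distrib_left)
    finally show "emeasure (density M (indicator G)) (rect C B) = emeasure (scale_measure (ennreal c) (basic lam \<kappa> m q A)) (rect C B)" .
  qed
  then have "ennreal c * emeasure (basic lam \<kappa> m q A) D = emeasure (density M (indicator G)) D" by simp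
  also have "\<dots> = emeasure M (G \<inter> D)"
    using D d(2) G by (simp add: emeasure_density indicator_inter_arith[symmetric])
  also have "\<dots> \<le> emeasure M D" using D d(2) by (intro emeasure_mono) auto
  finally show ?thesis using c by (simp add: M.emeasure_eq_measure bM.emeasure_eq_measure ennreal_mult[symmetric])
qed

end

section \<open>Reducibility and extremality of basic states\<close>

text \<open>The numbering of the cells is free up to rotation. Rotations serve to match cell 0 with
  the untranslated state \<nu>.\<close>

lemma partition_shift:
  assumes p: "partition_family lam m A" and m: "m > 0"
  shows "partition_family lam m (\<lambda>i. A ((i + s) mod m))"
  unfolding partition_family_def
proof (intro conjI allI impI)
  show "A ((i + s) mod m) \<in> sets borel" for i using partition_familyD(1)[OF p] m by simp
  have ind: "\<exists>i<m. (i + s) mod m = k" if "k < m" for k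
  proof (intro exI conjI)
    show "((k + m - s mod m) mod m + s) mod m = k"
    proof -
      have sm: "s mod m < m" using m by simp
      have "(x mod m + s) mod m = (x + s mod m) mod m" for x by (simp add: mod_simps)
      then have "((k + m - s mod m) mod m + s) mod m = (k + m - s mod m + s mod m) mod m" .
      also have "k + m - s mod m + s mod m = k + m" using sm by linarith
      also have "(k + m) mod m = k" using that by simp
      finally show ?thesis .
    qed
  qed (use m in simp)
  show "AE \<sigma> in lam. \<sigma> \<in> (\<Union>i<m. A ((i + s) mod m))"
    using partition_familyD(2)[OF p] by eventually_elim (use ind in blast)
  fix i j assume ij: "i < j \<and> j < m"
  have "(i + s) mod m \<noteq> (j + s) mod m"
  proof
    assume "(i + s) mod m = (j + s) mod m"
    then have "m dvd j - i" using ij mod_eq_dvd_iff_nat[of "i + s" "j + s" m] by simp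
    then show False using ij by (auto dest: dvd_imp_le)
  qed
  then show "AE \<sigma> in lam. \<sigma> \<notin> A ((i + s) mod m) \<inter> A ((j + s) mod m)"
    using partition_familyD(3)[OF p] m by (auto elim!: eventually_mono)
next
  fix k assume "k < m"
  have "translate ` A ((k + s) mod m) = A (((k + s) mod m + 1) mod m)"
    using p m by (simp add: partition_family_def)
  then show "translate ` A ((k + s) mod m) = A (((k + 1) mod m + s) mod m)"
    by (simp add: mod_simps add.commute add.left_commute)
qed

lemma cell_inclusion_translate:
  assumes lam: "shift_invariant lam" and p': "partition_family lam m' A'" "a < m'" and p: "partition_family lam m A" "b < m"
    and AE: "AE \<sigma> in lam. \<sigma> \<in> A' a \<longrightarrow> \<sigma> \<in> A b"
  shows "AE \<sigma> in lam. \<sigma> \<in> A' ((a + i) mod m') \<longrightarrow> \<sigma> \<in> A ((b + i) mod m)"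
  using shift_invariant.AE_zshift[OF lam AE, of "- int i"]
  unfolding partition_family_zimg[OF p', symmetric] partition_family_zimg[OF p, symmetric] zimg_iff .

lemma minimal_period_unique: "minimal_period \<nu> n \<Longrightarrow> minimal_period \<nu> n' \<Longrightarrow> n = n'"
  unfolding minimal_period_def by (metis linorder_neqE_nat)

lemma basic_dataE:
  assumes "basic_data lam \<nu> m q A"
  obtains \<rho> where "\<rho> \<ge> 1" "basic_context lam \<nu> m q A \<rho>"
  using assms by (auto simp: basic_data_def basic_context_def minimal_period_def)

lemma basic_contextI:
  assumes "ergodic lam" "\<nu> \<in> N_extremal \<rho>" "m > 0" "q > 0" "minimal_period \<nu> (q * m)" "partition_family lam m A"
  shows "basic_context lam \<nu> m q A \<rho>"
  using assms by (simp add: basic_context_def minimal_period_def)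

context decomp
begin

text \<open>In the finite mixture forming the even marginal the term \<open>j = 0\<close> has
  positive weight, since cell 0 is not null.\<close>

lemma basic_ac:
  assumes b: "basic_context lam \<kappa> m q A \<rho>" and M0_eq: "M0 = basic lam \<kappa> m q A"
  shows "ac \<kappa>"
  unfolding absolutely_continuous_def
proof
  interpret b: basic_context lam \<kappa> m q A \<rho> by fact
  fix Z assume "Z \<in> null_sets \<nu>0"
  then have Z: "Z \<in> sets borel" "emeasure \<nu>0 Z = 0" by (auto simp: null_sets_def)
  then have "(\<Sum>j<q * m. b.wt j UNIV * emeasure (b.tr j) Z) = 0"
    using b.emeasure_fibre_M[OF Z(1), of UNIV] by (simp add: M0_eq)
  moreover have "0 \<in> {..<q * m}" using b.m_pos b.q_pos by simp
  ultimately have "b.wt 0 UNIV * emeasure (b.tr 0) Z = 0" by (meson sum_eq_0_iff finite_lessThan)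
  moreover have "b.wt 0 UNIV > 0"
    using partition_family_pos[OF b.erg b.m_pos b.part, of 0] b.m_pos b.q_pos
    by (simp add: b.emeasure_eq_measure ennreal_mult[symmetric])
  ultimately have "emeasure \<kappa> Z = 0" by auto
  then show "Z \<in> null_sets \<kappa>" using Z b.\<nu>D by (simp add: null_sets_def)
qed

text \<open>Each translate is carried by its own generic set and the translates are distinct, so a
  single term of the sum survives. This recovers the cells from the state.\<close>

lemma basic_weight:
  assumes b: "basic_context lam \<kappa> m q A \<rho>" and M0_eq: "M0 = basic lam \<kappa> m q A"
    and min: "minimal_period \<kappa> (q * m)" and j: "j < q * m" and B: "B \<in> sets borel"
  shows "emeasure M0 (rect (E ((push_translate ^^ j) \<kappa>)) B) = ennreal (1 / real q) * emeasure lam (B \<inter> A (j mod m))"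
proof -
  interpret b: basic_context lam \<kappa> m q A \<rho> by fact
  note Ej = E_measurable[OF b.tr]
  have full: "AE x in b.tr l. Q x = b.tr l" for l
    by (rule E_full[OF b.tr ac_translate_pow[OF b.\<nu>_ext basic_ac[OF b M0_eq]]])
  have "emeasure M0 (rect (E (b.tr j)) B) = (\<Sum>l<q * m. b.wt l B * emeasure (b.tr l) (E (b.tr j)))"
    unfolding M0_eq by (rule b.emeasure_rect[OF Ej B])
  also have "\<dots> = (\<Sum>l\<in>{..<q * m}. if l = j then b.wt j B else 0)"
  proof (rule sum.cong[OF refl])
    fix l assume l: "l \<in> {..<q * m}"
    show "b.wt l B * emeasure (b.tr l) (E (b.tr j)) = (if l = j then b.wt j B else 0)"
    proof (cases "l = j")
      case True
      have "emeasure (b.tr j) (E (b.tr j)) = emeasure (b.tr j) UNIV"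
        using full[of j] Ej b.trD(2) by (intro emeasure_eq_AE) auto
      also have "\<dots> = 1" using prob_space.emeasure_space_1[OF b.trD(1)] b.trD(3) by metis
      finally show ?thesis using True by simp
    next
      case False
      then have "b.tr l \<noteq> b.tr j" using minimal_period_inj[OF min] l j by blast
      then have "emeasure (b.tr l) (E (b.tr j)) = emeasure (b.tr l) {}"
        using full[of l] Ej b.trD(2) by (intro emeasure_eq_AE) auto
      then show ?thesis using False by simp
    qed
  qed
  also have "\<dots> = b.wt j B" using j by (simp add: sum.delta)
  finally show ?thesis .
qed

end

text \<open>A finer partition, suitably renumbered, gives a basic state dominated by
  \<open>M\<close>. Extremality makes the two equal, and comparing their weights shows that the
  cells agree modulo null sets, so the refinement was not proper.\<close>

lemma ETIS_not_reducible:
  assumes cnt: "\<And>\<rho>::real. \<rho> \<ge> 1 \<Longrightarrow> countable (N_extremal \<rho>)" and M: "M \<in> ETIS"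
  shows "\<not> reducible M"
proof
  assume "reducible M"
  then obtain lam \<nu> m q A m' q' A' where d: "basic_data lam \<nu> m q A" and d': "basic_data lam \<nu> m' q' A'"
    and pr: "properly_refines lam m' A' m A" and M_eq: "M = basic lam \<nu> m q A"
    unfolding reducible_def pre_reducible_def basic_def by blast
  obtain \<rho> where \<rho>: "\<rho> \<ge> 1" and b: "basic_context lam \<nu> m q A \<rho>" using d by (rule basic_dataE)
  interpret b: basic_context lam \<nu> m q A \<rho> by fact
  have min: "minimal_period \<nu> (q * m)" "minimal_period \<nu> (q' * m')"
    and m': "m' > 0" "q' > 0" and p': "partition_family lam m' A'"
    using d d' by (auto simp: basic_data_def)
  have n: "q' * m' = q * m" by (rule minimal_period_unique[OF min(2,1)])
  obtain Q where dec: "decomp \<rho> M Q"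
    using decomp_exists[of M \<rho>] b.M_TIS b.marginal_N_states cnt[OF \<rho>] by (auto simp: M_eq)
  interpret decomp \<rho> M Q by fact
  have "\<exists>i<m. AE \<sigma> in lam. \<sigma> \<in> A' 0 \<longrightarrow> \<sigma> \<in> A i"
    using pr m'(1) by (auto simp: properly_refines_def refines_def)
  then obtain i where i: "i < m" "AE \<sigma> in lam. \<sigma> \<in> A' 0 \<longrightarrow> \<sigma> \<in> A i" by blast
  \<comment> \<open>The rotation that puts cell 0 of the finer partition inside \<open>A 0\<close>;
    both families are moved on by \<open>m - i\<close> steps, which takes \<open>A i\<close> to
    \<open>A 0\<close>.\<close>
  define s where "s = (m - i) mod m'"
  have s: "s < m'" using m' by (simp add: s_def)
  have s0: "AE \<sigma> in lam. \<sigma> \<in> A' s \<longrightarrow> \<sigma> \<in> A 0"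
    using cell_inclusion_translate[OF b.shift_invariant_axioms p' m'(1) b.part i(1) i(2), of "m - i"] i(1)
    by (simp add: s_def)
  define A2 where "A2 j = A' ((j + s) mod m')" for j
  have p2: "partition_family lam m' A2" unfolding A2_def by (rule partition_shift[OF p' m'(1)])
  have b2: "basic_context lam \<nu> m' q' A2 \<rho>"
    by (rule basic_contextI[OF b.erg b.\<nu>_ext m' min(2) p2])
  interpret b2: basic_context lam \<nu> m' q' A2 \<rho> by fact
  have sub: "AE \<sigma> in lam. \<sigma> \<in> A2 (j mod m') \<longrightarrow> \<sigma> \<in> A (j mod m)" for j
    using cell_inclusion_translate[OF b.shift_invariant_axioms p' s b.part b.m_pos s0, of j]
    by (simp add: A2_def mod_simps add.commute)
  have q: "real q > 0" "real q' > 0" using b.q_pos m' by simp_all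
  have "basic lam \<nu> m' q' A2 = M"
  proof (rule ETIS_dominated[OF M b2.M_TIS])
    \<comment> \<open>\<open>M\<close> carries the density \<open>1 / q\<close> on the smaller cell
      and the finer state \<open>1 / q'\<close>; the constant is their ratio.\<close>
    show "0 < real q' / real q" using q by simp
    fix D :: "config set" assume D: "D \<in> sets borel"
    show "real q' / real q * measure (basic lam \<nu> m' q' A2) D \<le> measure M D"
    proof (rule basic_dominated[OF dominated_M0 b2 min(2) basic_ac[OF b M_eq] _ _ D])
      fix j B assume j: "j < q' * m'" and B: "B \<in> sets (borel :: spins measure)"
      have B2: "B \<inter> A2 (j mod m') \<in> sets borel" using B b2.A_mod(1) by auto
      have "emeasure lam (B \<inter> A2 (j mod m') \<inter> A (j mod m)) = emeasure lam (B \<inter> A2 (j mod m'))"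
        using sub[of j] B2 b.A_mod(1)[of j] by (intro emeasure_eq_AE) (auto simp: b.sets_lam)
      moreover have "ennreal (1 / real q) = ennreal (real q' / real q) * ennreal (1 / real q')"
        using q by (simp add: ennreal_mult[symmetric])
      ultimately show "emeasure M (rect (E ((push_translate ^^ j) \<nu>)) (B \<inter> A2 (j mod m'))) =
          ennreal (real q' / real q) * (ennreal (1 / real q') * emeasure lam (B \<inter> A2 (j mod m')))"
        using basic_weight[OF b M_eq min(1) _ B2, of j] j n by (simp add: mult.assoc)
    qed (use q in simp)
  qed
  then have M_eq2: "M = basic lam \<nu> m' q' A2" ..
  have 0: "0 < q * m" "0 < q' * m'" using b.q_pos b.m_pos m' by simp_all
  have A00: "A 0 \<in> sets borel" "A2 0 \<in> sets borel" using b.A_mod(1)[of 0] b2.A_mod(1)[of 0] by simp_all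
  \<comment> \<open>The test set on which the two descriptions of \<open>M\<close> differ: one gives
    it weight zero, the other a positive multiple of \<open>lam\<close>.\<close>
  then have D: "A 0 - A2 0 \<in> sets borel" by auto
  have "ennreal (1 / real q') * emeasure lam ((A 0 - A2 0) \<inter> A2 0) = ennreal (1 / real q) * emeasure lam ((A 0 - A2 0) \<inter> A 0)"
    using basic_weight[OF b M_eq min(1) 0(1) D] basic_weight[OF b2 M_eq2 min(2) 0(2) D] by simp
  moreover have "(A 0 - A2 0) \<inter> A2 0 = {}" "(A 0 - A2 0) \<inter> A 0 = A 0 - A2 0" by auto
  ultimately have "ennreal (1 / real q) * emeasure lam (A 0 - A2 0) = 0" by simp
  then have "measure lam (A 0 - A2 0) = 0" using q by (simp add: b.emeasure_eq_measure ennreal_mult[symmetric])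
  then have "AE \<sigma> in lam. \<sigma> \<notin> A 0 - A2 0" using D by (intro b.AE_not_inI)
  then have "AE \<sigma> in lam. \<sigma> \<in> A 0 \<longrightarrow> \<sigma> \<in> A' s" by eventually_elim (use s in \<open>auto simp: A2_def\<close>)
  note c = cell_inclusion_translate[OF b.shift_invariant_axioms b.part b.m_pos p' s this]
  have "AE \<sigma> in lam. \<sigma> \<in> A i \<longrightarrow> \<sigma> \<in> A' ((s + i) mod m')" if "i < m" for i
    using c[of i] that by simp
  then have "refines lam m A m' A'" unfolding refines_def using m' by (meson mod_less_divisor)
  then show False using pr by (simp add: properly_refines_def)
qed

text \<open>Irreducibility forces \<open>A 0\<close> to be an atom of the \<open>n\<close>-th power
  of the shift. A component of the state then has weights proportional to those of the state itself,
  and the total mass fixes the factor.\<close>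

lemma irreducible_basic_extremal:
  assumes cnt: "\<And>\<rho>::real. \<rho> \<ge> 1 \<Longrightarrow> countable (N_extremal \<rho>)"
    and d: "basic_data lam \<nu> m q A" and irr: "\<not> reducible (basic lam \<nu> m q A)"
  shows "basic lam \<nu> m q A \<in> ETIS"
proof -
  obtain \<rho> where \<rho>: "\<rho> \<ge> 1" and b: "basic_context lam \<nu> m q A \<rho>" using d by (rule basic_dataE)
  interpret b: basic_context lam \<nu> m q A \<rho> by fact
  let ?M = "basic lam \<nu> m q A" and ?n = "q * m"
  have min: "minimal_period \<nu> ?n" using d by (simp add: basic_data_def)
  obtain Q where dec: "decomp \<rho> ?M Q"
    using decomp_exists[OF b.M_TIS b.marginal_N_states cnt[OF \<rho>]] by blast
  interpret decomp \<rho> ?M Q by fact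
  have n0: "?n > 0" using b.m_pos b.q_pos by simp
  \<comment> \<open>The finest partition for the full period \<open>n\<close>, to be compared with
    \<open>A\<close>.\<close>
  obtain m' q' A' where n: "?n = q' * m'" and m': "m' > 0" "q' > 0" and p': "partition_family lam m' A'"
    and atom': "\<And>C k. C \<in> sets borel \<Longrightarrow> (translate ^^ ?n) -` C = C \<Longrightarrow> k < m' \<Longrightarrow>
      (AE \<sigma> in lam. \<sigma> \<in> A' k \<longrightarrow> \<sigma> \<in> C) \<or> (AE \<sigma> in lam. \<sigma> \<in> A' k \<longrightarrow> \<sigma> \<notin> C)"
    by (rule cyclic_atoms[OF b.erg n0]) blast
  have A0: "A 0 \<in> sets borel" using b.A_mod(1)[of 0] by simp
  have A0_inv: "(translate ^^ ?n) -` A 0 = A 0"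
    using partition_family_zimg[OF b.part b.m_pos, of ?n] zimg_eq_minus[of "int ?n" "A 0"]
    by (simp add: vimage_translate_pow)
  have "\<exists>k<m'. AE \<sigma> in lam. \<sigma> \<in> A' k \<longrightarrow> \<sigma> \<in> A 0"
  proof (rule ccontr)
    assume h: "\<not> ?thesis"
    have "AE \<sigma> in lam. k < m' \<longrightarrow> \<sigma> \<in> A' k \<longrightarrow> \<sigma> \<notin> A 0" for k
      using atom'[OF A0 A0_inv, of k] h by (cases "k < m'") auto
    then have "AE \<sigma> in lam. \<forall>k. k < m' \<longrightarrow> \<sigma> \<in> A' k \<longrightarrow> \<sigma> \<notin> A 0" by (simp add: AE_all_countable)
    then have "AE \<sigma> in lam. \<sigma> \<notin> A 0" using partition_familyD(2)[OF p'] by eventually_elim blast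
    then have "measure lam (A 0) = measure lam {}"
      using A0 by (intro b.finite_measure_eq_AE) (auto simp: b.sets_lam)
    then show False using partition_family_pos[OF b.erg b.m_pos b.part b.m_pos] by simp
  qed
  then obtain k where k: "k < m'" "AE \<sigma> in lam. \<sigma> \<in> A' k \<longrightarrow> \<sigma> \<in> A 0" by blast
  have "refines lam m' A' m A"
    unfolding refines_def
  proof (intro allI impI)
    fix j assume j: "j < m'"
    have "(k + (m' - k + j)) mod m' = j" using k(1) j by simp
    then have "AE \<sigma> in lam. \<sigma> \<in> A' j \<longrightarrow> \<sigma> \<in> A ((m' - k + j) mod m)"
      using cell_inclusion_translate[OF b.shift_invariant_axioms p' k(1) b.part b.m_pos k(2), of "m' - k + j"] by simp
    then show "\<exists>i<m. AE \<sigma> in lam. \<sigma> \<in> A' j \<longrightarrow> \<sigma> \<in> A i" using b.m_pos by (meson mod_less_divisor)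
  qed
  \<comment> \<open>The finest partition yields a basic datum with the same \<nu>. Since it cannot
    refine \<open>A\<close> properly, \<open>A 0\<close> is contained in one of its cells.\<close>
  moreover have d': "basic_data lam \<nu> m' q' A'"
    using d m' p' min n by (simp add: basic_data_def)
  then have "\<not> properly_refines lam m' A' m A"
    using irr d unfolding reducible_def pre_reducible_def basic_def by blast
  ultimately have "refines lam m A m' A'" by (simp add: properly_refines_def)
  then obtain j where j: "j < m'" "AE \<sigma> in lam. \<sigma> \<in> A 0 \<longrightarrow> \<sigma> \<in> A' j"
    using b.m_pos by (auto simp: refines_def)
  have "j = k"
  proof (rule ccontr)
    assume jk: "j \<noteq> k"
    have "AE \<sigma> in lam. \<sigma> \<notin> A' k"
      using k(2) j(2) partition_familyD(3)[OF p'] by eventually_elim (use jk k j in blast)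
    then have "measure lam (A' k) = measure lam {}"
      using partition_familyD(1)[OF p' k(1)] by (intro b.finite_measure_eq_AE) (auto simp: b.sets_lam)
    then show False using partition_family_pos[OF b.erg m'(1) p' k(1)] by simp
  qed
  have atom: "(AE \<sigma> in lam. \<sigma> \<in> A 0 \<longrightarrow> \<sigma> \<in> C) \<or> (AE \<sigma> in lam. \<sigma> \<in> A 0 \<longrightarrow> \<sigma> \<notin> C)"
    if "C \<in> sets borel" "(translate ^^ ?n) -` C = C" for C
    using atom'[OF that k(1)]
  proof
    assume "AE \<sigma> in lam. \<sigma> \<in> A' k \<longrightarrow> \<sigma> \<in> C"
    then have "AE \<sigma> in lam. \<sigma> \<in> A 0 \<longrightarrow> \<sigma> \<in> C" using j(2) by eventually_elim (simp add: \<open>j = k\<close>)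
    then show ?thesis ..
  next
    assume "AE \<sigma> in lam. \<sigma> \<in> A' k \<longrightarrow> \<sigma> \<notin> C"
    then have "AE \<sigma> in lam. \<sigma> \<in> A 0 \<longrightarrow> \<sigma> \<notin> C" using j(2) by eventually_elim (simp add: \<open>j = k\<close>)
    then show ?thesis ..
  qed
  have one: "M1 = ?M"
    if h: "M1 \<in> TIS" "0 < t" "t < (1::real)"
      "\<And>B. B \<in> sets borel \<Longrightarrow> measure ?M B = t * measure M1 B + (1 - t) * measure M2 B" for M1 M2 t
  proof -
    have m1: "prob_space M1" "sets M1 = sets borel" using h(1) by (auto simp: TIS_iff)
    interpret M1: prob_space M1 by (rule m1)
    interpret M: prob_space ?M by (rule b.prob_M)
    have null: "measure M1 B = 0" if "B \<in> sets borel" "measure ?M B = 0" for B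
    proof -
      have "0 \<le> t * measure M1 B" "0 \<le> (1 - t) * measure M2 B" using h by simp_all
      then have "t * measure M1 B = 0" using h(4)[OF that(1)] that(2) by linarith
      then show ?thesis using h by simp
    qed
    have enull: "emeasure M1 B = 0" if "B \<in> sets borel" "emeasure ?M B = 0" for B
      using null[OF that(1)] that(2) by (simp add: M1.emeasure_eq_measure M.emeasure_eq_measure)
    have dominated_M1: "dominated M1"
      unfolding dominated_def absolutely_continuous_def
    proof (intro conjI h(1) subsetI)
      fix Z assume "Z \<in> null_sets (fibre ?M UNIV)"
      then have Z: "Z \<in> sets borel" "emeasure ?M (rect Z UNIV) = 0"
        by (auto simp: null_sets_def emeasure_fibre[OF b.sets_M])
      then have "emeasure M1 (rect Z UNIV) = 0" by (intro enull rect_measurable) auto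
      then show "Z \<in> null_sets (fibre M1 UNIV)" using Z by (simp add: null_sets_def emeasure_fibre[OF m1(2)])
    qed
    have lam0: "emeasure M1 (rect UNIV B) = 0" if "B \<in> sets borel" "emeasure lam B = 0" for B
    proof (rule enull)
      have "emeasure lam (B \<inter> A (j mod m)) \<le> emeasure lam B" for j
        using that(1) by (intro emeasure_mono) (auto simp: b.sets_lam)
      then have "emeasure lam (B \<inter> A (j mod m)) = 0" for j using that(2) by simp
      then show "emeasure ?M (rect UNIV B) = 0" using b.emeasure_rect[OF _ that(1), of UNIV] by simp
    qed (use that in \<open>auto intro: rect_measurable\<close>)
    \<comment> \<open>The proportionality factor on the atom \<open>A 0\<close> between the weight
      of \<nu> under \<open>M1\<close> and \<open>lam\<close>; it will turn out to be
      \<open>1 / q\<close>.\<close>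
    define a where "a = measure M1 (rect (E \<nu>) (A 0)) / measure lam (A 0)"
    have a0: "a \<ge> 0" by (simp add: a_def)
    have lA0: "measure lam (A 0) > 0" by (rule partition_family_pos[OF b.erg b.m_pos b.part b.m_pos])
    have w0: "measure M1 (rect (E \<nu>) B) = a * measure lam (B \<inter> A 0)" if B: "B \<in> sets borel" for B
    proof -
      have BA: "B \<inter> A 0 \<in> sets borel" "B - A 0 \<in> sets borel" using B A0 by auto
      note r = rect_measurable[OF E_measurable[OF b.\<nu>_ext]]
      have "measure M1 (rect (E \<nu>) (B \<inter> A 0)) * measure lam (A 0) = measure M1 (rect (E \<nu>) (A 0)) * measure lam (B \<inter> A 0)"
        by (rule atom_weight[OF dominated_M1 b.\<nu>_ext b.period b.shift_invariant_axioms lam0 A0 A0_inv atom B])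
      then have 1: "measure M1 (rect (E \<nu>) (B \<inter> A 0)) = a * measure lam (B \<inter> A 0)"
        using lA0 by (simp add: a_def field_simps)
      have "(B - A 0) \<inter> A 0 = {}" by auto
      then have "emeasure ?M (rect (E \<nu>) (B - A 0)) = 0"
        using basic_weight[OF b refl min n0 BA(2)] by simp
      then have 2: "measure M1 (rect (E \<nu>) (B - A 0)) = 0"
        using enull[OF r[OF BA(2)]] by (simp add: measure_def)
      have "rect (E \<nu>) B = rect (E \<nu>) (B \<inter> A 0) \<union> rect (E \<nu>) (B - A 0)" by (auto simp: rect_def)
      moreover have "rect (E \<nu>) (B \<inter> A 0) \<inter> rect (E \<nu>) (B - A 0) = {}" by (auto simp: rect_def)
      ultimately have "measure M1 (rect (E \<nu>) B) = measure M1 (rect (E \<nu>) (B \<inter> A 0)) + measure M1 (rect (E \<nu>) (B - A 0))"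
        using r[OF BA(1)] r[OF BA(2)] m1(2) by (simp add: M1.finite_measure_Union)
      then show ?thesis using 1 2 by simp
    qed
    have wj: "measure M1 (rect (E (b.tr j)) B) = a * measure lam (B \<inter> A (j mod m))" if B: "B \<in> sets borel" for j B
    proof -
      have zB: "zimg (- int j) B \<in> sets borel" by (rule zimg_measurable[OF B])
      have "measure M1 (rect (E (b.tr j)) B) = measure M1 (rect (E \<nu>) (zimg (- int j) B))"
        using weight_translate_pow[OF dominated_M1 b.\<nu>_ext B, of j] by (simp add: measure_def)
      also have "\<dots> = a * measure lam (zimg (- int j) B \<inter> A 0)" by (rule w0[OF zB])
      also have "measure lam (zimg (- int j) B \<inter> A 0) = measure lam (zimg (int j) (zimg (- int j) B \<inter> A 0))"
        using zB A0 by (intro b.measure_zimg[symmetric]) auto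
      also have "zimg (int j) (zimg (- int j) B \<inter> A 0) = zimg (int j) (zimg (- int j) B) \<inter> zimg (int j) (A 0)"
        by (auto simp: zimg_iff)
      also have "\<dots> = B \<inter> A (j mod m)"
        using partition_family_zimg[OF b.part b.m_pos, of j] by (simp add: zimg_add)
      finally show ?thesis .
    qed
    have cover: "AE x in fibre ?M UNIV. \<exists>j<?n. Q x = b.tr j"
    proof (rule b.AE_fibre_M)
      have "{x. \<exists>j<?n. Q x = b.tr j} = (\<Union>j<?n. E (b.tr j))" by auto
      then show "{x. \<exists>j<?n. Q x = b.tr j} \<in> sets borel" using E_measurable[OF b.tr] by auto
      fix j
      have "b.tr (j mod ?n) = b.tr j" by (rule funpow_mod_eq[OF b.period])
      moreover have "j mod ?n < ?n" using n0 by simp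
      ultimately show "AE x in b.tr j. \<exists>j<?n. Q x = b.tr j"
        using E_full[OF b.tr ac_translate_pow[OF b.\<nu>_ext basic_ac[OF b refl]], of j]
        by (auto elim!: eventually_mono)
    qed simp
    \<comment> \<open>The orbit of \<nu> carries the even marginal of every dominated state, so the
      weights along it sum to one. Comparing the two sums, for the basic state and for
      \<open>M1\<close>, determines \<open>a\<close>.\<close>
    have total: "(\<Sum>j<?n. measure M (rect (E (b.tr j)) UNIV)) = 1" if "dominated M" for M
    proof -
      note dM = dominatedD[OF that]
      interpret MM: prob_space M by (rule dM)
      have r: "rect (E (b.tr j)) UNIV \<in> sets M" for j
        using rect_measurable[OF E_measurable[OF b.tr], of UNIV] dM(2) by simp
      have disj: "disjoint_family_on (\<lambda>j. rect (E (b.tr j)) UNIV) {..<?n}"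
        unfolding disjoint_family_on_def
      proof (intro ballI impI)
        fix i j assume ij: "i \<in> {..<?n}" "j \<in> {..<?n}" "i \<noteq> j"
        have "b.tr i \<noteq> b.tr j" using minimal_period_inj[OF min] ij by blast
        then show "rect (E (b.tr i)) UNIV \<inter> rect (E (b.tr j)) UNIV = {}" by (auto simp: rect_def)
      qed
      have e: "even_part \<in> M \<rightarrow>\<^sub>M borel" using dM(2) even_part_measurable by (simp cong: measurable_cong_sets)
      have "AE x in fibre M UNIV. \<exists>j<?n. Q x = b.tr j"
        by (rule AE_ac[OF dM(8) _ cover]) simp
      then have "AE x in M. \<exists>j<?n. Q (even_part x) = b.tr j"
        unfolding fibre_UNIV_eq by (rule AE_distrD[OF e])
      then have "AE x in M. x \<in> (\<Union>j<?n. rect (E (b.tr j)) UNIV)"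
        by eventually_elim (auto simp: rect_def)
      then have "measure M (\<Union>j<?n. rect (E (b.tr j)) UNIV) = 1"
        using r by (subst MM.prob_eq_1) auto
      then show ?thesis using MM.finite_measure_finite_Union[OF _ _ disj] r by auto
    qed
    have "(\<Sum>j<?n. measure ?M (rect (E (b.tr j)) UNIV)) = (\<Sum>j<?n. 1 / real q * measure lam (A (j mod m)))"
    proof (rule sum.cong[OF refl])
      fix j assume "j \<in> {..<?n}"
      then show "measure ?M (rect (E (b.tr j)) UNIV) = 1 / real q * measure lam (A (j mod m))"
        using basic_weight[OF b refl min, of j UNIV]
        by (simp add: M.emeasure_eq_measure b.emeasure_eq_measure ennreal_mult[symmetric])
    qed
    then have 1: "1 / real q * (\<Sum>j<?n. measure lam (A (j mod m))) = 1"
      using total[OF dominated_M0] by (simp add: sum_distrib_left)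
    have "a * (\<Sum>j<?n. measure lam (A (j mod m))) = 1"
      using total[OF dominated_M1] wj[of UNIV] by (simp add: sum_distrib_left)
    with 1 have a: "a = 1 / real q" by (metis mult_cancel_right mult_zero_right zero_neq_one)
    have le: "measure ?M D \<le> measure M1 D" if D: "D \<in> sets borel" for D
    proof -
      have "1 * measure ?M D \<le> measure M1 D"
      proof (rule basic_dominated[OF dominated_M1 b min basic_ac[OF b refl] _ _ D])
        fix j B assume B: "B \<in> sets (borel :: spins measure)"
        have "B \<inter> A (j mod m) \<in> sets borel" using B b.A_mod(1) by auto
        then show "emeasure M1 (rect (E ((push_translate ^^ j) \<nu>)) (B \<inter> A (j mod m))) =
            ennreal 1 * (ennreal (1 / real q) * emeasure lam (B \<inter> A (j mod m)))"
          using wj[of "B \<inter> A (j mod m)" j]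
          by (simp add: M1.emeasure_eq_measure b.emeasure_eq_measure ennreal_mult[symmetric] a Int_assoc)
      qed simp
      then show ?thesis by simp
    qed
    show "M1 = ?M"
    proof (rule measure_eqI)
      show "sets M1 = sets ?M" using m1 b.sets_M by simp
      fix D assume "D \<in> sets M1"
      then have D: "D \<in> sets borel" "D \<in> sets M1" "D \<in> sets ?M" using m1 b.sets_M by auto
      \<comment> \<open>Of two probability measures one cannot lie below the other unless they
        agree, as the complement shows.\<close>
      have cD: "- D \<in> sets borel" using sets.compl_sets[OF D(1)] by (simp add: Compl_eq_Diff_UNIV)
      have sp: "space M1 = UNIV" "space ?M = UNIV" using sets_eq_imp_space_eq[OF m1(2)] b.space_M by auto
      have "1 - measure ?M D \<le> 1 - measure M1 D"
        using le[OF cD] M1.prob_compl[OF D(2)] M.prob_compl[OF D(3)] sp by (simp add: Compl_eq_Diff_UNIV)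
      then have "measure M1 D = measure ?M D" using le[OF D(1)] by simp
      then show "emeasure M1 D = emeasure ?M D" by (simp add: M1.emeasure_eq_measure M.emeasure_eq_measure)
    qed
  qed
  have "M1 = ?M \<and> M2 = ?M"
    if h: "M1 \<in> TIS" "M2 \<in> TIS" "0 < t \<and> t < (1::real) \<and>
      (\<forall>B\<in>sets borel. measure ?M B = t * measure M1 B + (1 - t) * measure M2 B)" for M1 M2 t
  proof
    show "M1 = ?M" by (rule one[OF h(1), of t M2]) (use h(3) in auto)
    show "M2 = ?M" by (rule one[OF h(2), of "1 - t" M1]) (use h(3) in auto)
  qed
  then show ?thesis using b.M_TIS unfolding ETIS_def extremal_states_def by blast
qed

section \<open>The density of an extremal state\<close>

text \<open>Garsia's argument with the running maximum \<open>F N\<close> of the partial sums. Where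
  \<open>F N\<close> is positive it is at most \<open>f\<close> plus \<open>F N\<close> after one
  step, and the two maxima have equal integrals.\<close>

lemma maximal_ergodic:
  fixes f :: "'a \<Rightarrow> real"
  assumes M: "finite_measure M" and T: "T \<in> M \<rightarrow>\<^sub>M M" "distr M M T = M" and f: "integrable M f"
    and pos: "AE x in M. \<exists>N. 0 < (\<Sum>k<N. f ((T ^^ k) x))"
  shows "0 \<le> (\<integral>x. f x \<partial>M)"
proof -
  interpret finite_measure M by fact
  define S where "S N x = (\<Sum>k<N. f ((T ^^ k) x))" for N x
  define F where "F N x = Max ((\<lambda>k. S k x) ` {..N})" for N x
  have S_Suc: "S (Suc N) x = f x + S N (T x)" for N x
    unfolding S_def by (subst sum.lessThan_Suc_shift) (simp add: funpow_swap1)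
  have S_le: "S k x \<le> F N x" if "k \<le> N" for k N x
    unfolding F_def using that by (intro Max_ge) auto
  have F0: "0 \<le> F N x" for N x using S_le[of 0 N x] by (simp add: S_def)
  have F_ex: "\<exists>k\<le>N. F N x = S k x" for N x
  proof -
    have "F N x \<in> (\<lambda>k. S k x) ` {..N}" unfolding F_def by (rule Max_in) auto
    then show ?thesis by auto
  qed
  have fm: "f \<in> borel_measurable M" using f by auto
  have iT: "integrable M (\<lambda>x. h (T x))" "(\<integral>x. h (T x) \<partial>M) = (\<integral>x. h x \<partial>M)" if "integrable M h" for h :: "'a \<Rightarrow> real"
  proof -
    have hm: "h \<in> borel_measurable M" using that by auto
    show "integrable M (\<lambda>x. h (T x))" using integrable_distr_eq[OF T(1), of h] hm that by (simp add: T(2))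
    show "(\<integral>x. h (T x) \<partial>M) = (\<integral>x. h x \<partial>M)" using integral_distr[OF T(1), of h] hm by (simp add: T(2))
  qed
  have iS: "integrable M (S N)" for N
  proof (induction N)
    case (Suc N)
    then show ?case using f iT(1)[OF Suc] by (simp add: S_Suc[abs_def])
  qed (simp add: S_def)
  have iF: "integrable M (F N)" for N
  proof (induction N)
    case 0
    show ?case using iS[of 0] by (simp add: F_def)
  next
    case (Suc N)
    have "F (Suc N) x = max (S (Suc N) x) (F N x)" for x
      unfolding F_def atMost_Suc image_insert by (rule Max_insert) auto
    then show ?case using Suc iS[of "Suc N"] by (simp add: integrable_max)
  qed
  let ?I = "\<lambda>N x. indicat_real {x. 0 < F N x} x"
  have Fm: "{x \<in> space M. 0 < F N x} \<in> sets M" for N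
    using iF[of N] by measurable
  \<comment> \<open>The sum over no terms takes part in the maximum, so a positive maximum is
    attained at some \<open>k > 0\<close> and one summand can be split off.\<close>
  have key: "F N x - F N (T x) \<le> f x * ?I N x" for N x
  proof (cases "0 < F N x")
    case True
    obtain k where k: "k \<le> N" "F N x = S k x" using F_ex by blast
    then have "k \<noteq> 0" using True by (auto simp: S_def intro: ccontr)
    then obtain l where l: "k = Suc l" using not0_implies_Suc by blast
    then have "F N x \<le> f x + F N (T x)" using k S_le[of l N "T x"] by (simp add: S_Suc)
    then show ?thesis using True by simp
  next
    case False
    then show ?thesis using F0[of N x] F0[of N "T x"] by simp
  qed
  have Im: "(\<lambda>x. f x * ?I N x) \<in> borel_measurable M" for N
    using fm Fm[of N] by (intro borel_measurable_times) (auto simp: borel_measurable_indicator_iff Int_def conj_commute)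
  have iI: "integrable M (\<lambda>x. f x * ?I N x)" for N
    by (rule Bochner_Integration.integrable_bound[OF f Im]) (auto split: split_indicator)
  have "0 \<le> (\<integral>x. f x * ?I N x \<partial>M)" for N
  proof -
    have "(\<integral>x. F N x - F N (T x) \<partial>M) \<le> (\<integral>x. f x * ?I N x \<partial>M)"
      using iF iT(1) iI key by (intro integral_mono) auto
    then show ?thesis using iF iT[OF iF] by simp
  qed
  moreover have "(\<lambda>N. \<integral>x. f x * ?I N x \<partial>M) \<longlonglongrightarrow> (\<integral>x. f x \<partial>M)"
  proof (rule integral_dominated_convergence[where w="\<lambda>x. \<bar>f x\<bar>"])
    show "AE x in M. (\<lambda>N. f x * ?I N x) \<longlonglongrightarrow> f x"
      using pos
    proof eventually_elim
      case (elim x)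
      then obtain K where K: "0 < S K x" by (auto simp: S_def)
      have "\<forall>\<^sub>F N in sequentially. f x * ?I N x = f x"
        using eventually_ge_at_top[of K]
      proof eventually_elim
        case (elim N)
        then have "0 < F N x" using S_le[OF elim, of x] K by linarith
        then show ?case by simp
      qed
      then show ?case by (rule tendsto_eventually)
    qed
  qed (use f fm Im in \<open>auto split: split_indicator\<close>)
  ultimately show ?thesis by (intro LIMSEQ_le_const) auto
qed

text \<open>\<open>exceeds a S\<close> says that \<open>limsup S N / N > a\<close>; the rational witness makes the event measurable.\<close>

definition exceeds :: "real \<Rightarrow> (nat \<Rightarrow> real) \<Rightarrow> bool" where
  "exceeds a S \<longleftrightarrow> (\<exists>q::rat. a < of_rat q \<and> (\<forall>n. \<exists>N\<ge>n. of_rat q * real N \<le> S N))"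

text \<open>A bounded error and an index shift are negligible against \<open>N\<close>: lowering the
  witness \<open>q\<close> to a rational \<open>p\<close> still above \<open>a\<close> absorbs them
  for large \<open>N\<close>.\<close>

lemma exceeds_mono:
  assumes h: "exceeds a S" and le: "\<And>N. S N \<le> S' (N + d) + c"
  shows "exceeds a S'"
proof -
  obtain q where q: "a < of_rat q" "\<And>n. \<exists>N\<ge>n. of_rat q * real N \<le> S N" using h by (auto simp: exceeds_def)
  obtain p where p: "a < of_rat p" "of_rat p < (of_rat q :: real)" using of_rat_dense[OF q(1)] by auto
  define e where "e = (of_rat q - of_rat p :: real)"
  have e: "e > 0" using p by (simp add: e_def)
  have "\<exists>N\<ge>n. of_rat p * real N \<le> S' N" for n
  proof -
    obtain K where K: "(of_rat p * real d + c) / e \<le> real K" using real_arch_simple by blast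
    obtain N where N: "N \<ge> max n K" "of_rat q * real N \<le> S N" using q(2) by blast
    have "of_rat p * real d + c \<le> e * real K" using K e by (simp add: field_simps)
    also have "\<dots> \<le> e * real N" using N e by simp
    finally have "of_rat p * real (N + d) \<le> of_rat q * real N - c" by (simp add: e_def algebra_simps)
    also have "\<dots> \<le> S' (N + d)" using N le[of N] by linarith
    finally show ?thesis using N by (intro exI[of _ "N + d"]) auto
  qed
  then show ?thesis using p by (auto simp: exceeds_def)
qed

lemma exceeds_unshift:
  assumes h: "exceeds a S'" and le: "\<And>N. S' (Suc N) \<le> S N + c"
  shows "exceeds a S"
proof -
  obtain q where q: "a < of_rat q" "\<And>n. \<exists>N\<ge>n. of_rat q * real N \<le> S' N" using h by (auto simp: exceeds_def)
  obtain p where p: "a < of_rat p" "of_rat p < (of_rat q :: real)" using of_rat_dense[OF q(1)] by auto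
  define e where "e = (of_rat q - of_rat p :: real)"
  have e: "e > 0" using p by (simp add: e_def)
  have "\<exists>N\<ge>n. of_rat p * real N \<le> S N" for n
  proof -
    obtain K where K: "(c - of_rat q) / e \<le> real K" using real_arch_simple by blast
    obtain N' where N': "N' \<ge> Suc (max n K)" "of_rat q * real N' \<le> S' N'" using q(2) by blast
    then obtain N where N: "N' = Suc N" "N \<ge> max n K" by (cases N') auto
    have "c - of_rat q \<le> e * real K" using K e by (simp add: field_simps)
    also have "\<dots> \<le> e * real N" using N e by simp
    finally have "of_rat p * real N \<le> of_rat q * real (Suc N) - c" by (simp add: e_def algebra_simps)
    also have "\<dots> \<le> S N" using N' N le[of N] by simp
    finally show ?thesis using N by (intro exI[of _ N]) auto
  qed
  then show ?thesis using p by (auto simp: exceeds_def)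
qed

lemma exceeds_shift_iff:
  assumes "\<And>N. S' (Suc N) = S N + c"
  shows "exceeds a S' \<longleftrightarrow> exceeds a S"
proof
  assume "exceeds a S'"
  then show "exceeds a S" by (rule exceeds_unshift[where c=c]) (simp add: assms)
next
  assume "exceeds a S"
  then show "exceeds a S'" by (rule exceeds_mono[where d=1 and c="-c"]) (simp add: assms)
qed

lemma exceeds_close_iff:
  assumes "\<And>N. \<bar>S' N - S N\<bar> \<le> c"
  shows "exceeds a S' \<longleftrightarrow> exceeds a S"
proof
  assume "exceeds a S'"
  then show "exceeds a S"
  proof (rule exceeds_mono[where d=0 and c=c])
    show "S' N \<le> S (N + 0) + c" for N using assms[of N] by simp
  qed
next
  assume "exceeds a S"
  then show "exceeds a S'"
  proof (rule exceeds_mono[where d=0 and c=c])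
    show "S N \<le> S' (N + 0) + c" for N using assms[of N] by simp
  qed
qed

text \<open>Upper and lower limits are bounded separately. The levels \<open>1 / (k + 1)\<close> are
  countable, so the exceptional null sets can be united when this is applied.\<close>

lemma tendsto_of_not_exceeds:
  assumes up: "\<And>k. \<not> exceeds (e + 1 / real (Suc k)) S" and lo: "\<And>k. \<not> exceeds (- e + 1 / real (Suc k)) (\<lambda>N. - S N)"
  shows "(\<lambda>N. S N / real N) \<longlonglongrightarrow> e"
proof -
  have ev: "\<forall>\<^sub>F N in sequentially. S N / real N < y"
    if S: "\<And>k. \<not> exceeds (e + 1 / real (Suc k)) S" and y: "e < y" for S e y
  proof -
    obtain k where k: "inverse (real (Suc k)) < y - e" using reals_Archimedean[of "y - e"] y by auto
    then have "e + 1 / real (Suc k) < y" by (simp add: inverse_eq_divide)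
    then obtain q where q: "e + 1 / real (Suc k) < of_rat q" "of_rat q < y" using of_rat_dense by blast
    obtain n where n: "\<And>N. N \<ge> n \<Longrightarrow> S N < of_rat q * real N"
      using S[of k] q(1) unfolding exceeds_def by (meson linorder_not_less)
    show ?thesis
      using eventually_ge_at_top[of "Suc n"]
    proof eventually_elim
      case (elim N)
      then have "S N < of_rat q * real N" "0 < real N" using n[of N] by auto
      then have "S N / real N < of_rat q" by (simp add: pos_divide_less_eq)
      then show ?case using q by simp
    qed
  qed
  show ?thesis
  proof (rule order_tendstoI)
    show "\<forall>\<^sub>F N in sequentially. y < S N / real N" if "y < e" for y
    proof -
      have "\<forall>\<^sub>F N in sequentially. - S N / real N < - y" by (rule ev[OF lo]) (use that in simp)
      then show ?thesis by eventually_elim simp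
    qed
    show "\<forall>\<^sub>F N in sequentially. S N / real N < y" if "e < y" for y by (rule ev[OF up that])
  qed
qed

lemma (in markov_kernel) inv_meas_scale:
  assumes "inv_meas \<mu>" "0 < (c::real)"
  shows "inv_meas (scale_measure (ennreal c) \<mu>)"
proof -
  note m = inv_measD[OF assms(1)]
  interpret finite_measure \<mu> by fact
  have "finite_measure (scale_measure (ennreal c) \<mu>)"
    by (rule finite_measureI) (simp add: emeasure_eq_measure ennreal_mult_eq_top_iff)
  moreover have "(\<lambda>x. emeasure (K x) B) \<in> borel_measurable \<mu>" if "B \<in> sets N" for B
    using measurable_emeasure_kernel[OF kernel_subprob that] m(1) by (simp cong: measurable_cong_sets)
  ultimately show ?thesis
    using m by (auto simp: invariant_under_def nn_integral_scale_measure)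
qed

text \<open>Conditioning on an event of positive probability that is invariant under translation and
  dynamics gives a TIS state dominated by \<open>M\<close>, hence \<open>M\<close> itself.\<close>

lemma ETIS_zero_one:
  assumes M: "M \<in> ETIS" and F: "F \<in> sets borel" "\<And>\<eta>. translate \<eta> \<in> F \<longleftrightarrow> \<eta> \<in> F"
    "\<And>\<eta> b. \<eta> \<in> Xstar \<Longrightarrow> ssm_step \<eta> b \<in> F \<longleftrightarrow> \<eta> \<in> F"
  shows "measure M F = 0 \<or> measure M F = 1"
proof (rule disjCI)
  have MT: "M \<in> TIS" using M by (simp add: ETIS_def extremal_states_def)
  note d = TIS_D[OF MT]
  interpret prob_space M by (rule d)
  assume "measure M F \<noteq> 1"
  show "measure M F = 0"
  proof (rule ccontr)
    assume "measure M F \<noteq> 0"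
    then have p: "measure M F > 0" by (simp add: less_le)
    let ?D = "density M (indicator F)"
    define M' where "M' = scale_measure (ennreal (1 / measure M F)) ?D"
    have FM: "F \<in> sets M" using F d by simp
    have eD: "emeasure ?D B = ennreal (measure M (F \<inter> B))" if "B \<in> sets borel" for B
      using that FM d by (simp add: emeasure_density indicator_inter_arith[symmetric] emeasure_eq_measure)
    have eM': "emeasure M' B = ennreal (measure M (F \<inter> B) / measure M F)" if "B \<in> sets borel" for B
      using p by (simp add: M'_def eD[OF that] ennreal_mult[symmetric])
    have sM': "sets M' = sets borel" using d by (simp add: M'_def)
    then have spM': "space M' = UNIV" using sets_eq_imp_space_eq[of M' borel] by simp
    have "emeasure M' (space M') = 1" using eM'[of UNIV] p spM' by simp
    then have pM': "prob_space M'" by (rule prob_spaceI)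
    interpret M': prob_space M' by (rule pM')
    have "ssm.inv_meas ?D"
    proof (rule ssm.inv_meas_restrict[OF d(6) F(1)])
      show "AE x in M. emeasure (ssm_kernel x) F = indicator F x"
        using d(4)
      proof eventually_elim
        case (elim x)
        show ?case
          using prob_space.emeasure_space_1[OF prob_space_coins]
          by (simp add: emeasure_ssm_kernel[OF F(1)] F(3)[OF elim] space_coins split: split_indicator)
      qed
    qed
    moreover have "shift.inv_meas ?D"
    proof (rule shift.inv_meas_restrict[OF d(5) F(1)])
      show "AE x in M. emeasure (return borel (translate x)) F = indicator F x"
        using F by (simp add: indicator_def)
    qed
    moreover have "AE x in M'. x \<in> Xstar"
    proof -
      have cX: "- Xstar \<in> sets borel" using sets.compl_sets[OF Xstar_measurable(1)] by (simp add: Compl_eq_Diff_UNIV)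
      have "measure M (F \<inter> - Xstar) = measure M {}"
        using d(4) FM cX d(2) by (intro finite_measure_eq_AE) auto
      then have "AE x in M'. x \<notin> - Xstar"
        using cX sM' by (intro AE_not_in) (simp add: null_sets_def eM')
      then show ?thesis by simp
    qed
    moreover have "ssm.inv_meas M'" if "ssm.inv_meas ?D"
      unfolding M'_def by (rule ssm.inv_meas_scale[OF that]) (use p in simp)
    moreover have "shift.inv_meas M'" if "shift.inv_meas ?D"
      unfolding M'_def by (rule shift.inv_meas_scale[OF that]) (use p in simp)
    ultimately have "M' \<in> TIS"
      using pM' sM' by (simp add: TIS_iff)
    then have "M' = M"
    proof (rule ETIS_dominated[OF M _ p])
      fix B :: "config set" assume B: "B \<in> sets borel"
      have "measure M' B = measure M (F \<inter> B) / measure M F"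
        using eM'[OF B] p by (simp add: M'.emeasure_eq_measure)
      then have "measure M F * measure M' B = measure M (F \<inter> B)" using p by simp
      also have "\<dots> \<le> measure M B" using B d by (intro finite_measure_mono) auto
      finally show "measure M F * measure M' B \<le> measure M B" .
    qed
    then have "measure M F = 1" using eM'[OF F(1)] p by (simp add: emeasure_eq_measure)
    then show False using \<open>measure M F \<noteq> 1\<close> by simp
  qed
qed

text \<open>The dynamics leaves parities fixed, so every shift-invariant parity event falls under
  the zero-one law.\<close>

lemma ETIS_ergodic_parity:
  assumes M: "M \<in> ETIS"
  shows "ergodic (distr M borel odd_sites)"
proof -
  have MT: "M \<in> TIS" using M by (simp add: ETIS_def extremal_states_def)
  interpret L: shift_invariant "distr M borel odd_sites" by (rule shift_invariant_marginals(2)[OF MT])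
  have "measure (distr M borel odd_sites) B = 0 \<or> measure (distr M borel odd_sites) B = 1"
    if B: "B \<in> sets borel" "translate -` B = B" for B
  proof -
    have "measure (distr M borel odd_sites) B = measure M (odd_sites -` B)"
      using measure_distr[OF TIS_measurable(2)[OF MT] B(1)] TIS_D(3)[OF MT] by simp
    moreover have "measure M (odd_sites -` B) = 0 \<or> measure M (odd_sites -` B) = 1"
    proof (rule ETIS_zero_one[OF M odd_sites_vimage[OF B(1)]])
      show "translate \<eta> \<in> odd_sites -` B \<longleftrightarrow> \<eta> \<in> odd_sites -` B" for \<eta>
        using B(2) by (auto simp: odd_sites_translate)
    qed (simp add: odd_sites_ssm_step)
    ultimately show ?thesis by simp
  qed
  then show ?thesis
    using L.prob_space_axioms L.lam_translate
    by (auto simp: ergodic_def states_on_def transl_inv_def push_translate_def)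
qed

text \<open>The limsup event has probability zero or one. If it had probability one, partial sums of
  \<open>f - a\<close> would become positive almost surely, and the maximal ergodic lemma would
  bound the mean of \<open>f\<close> below by \<open>a\<close>.\<close>

lemma average_upper:
  assumes M: "M \<in> ETIS" and T: "T \<in> borel \<rightarrow>\<^sub>M borel" "distr (fibre M UNIV) borel T = fibre M UNIV"
    and f: "integrable (fibre M UNIV) f" "f \<in> borel_measurable borel"
    and X: "\<And>\<eta> N. X \<eta> N = (\<Sum>k<N. f ((T ^^ k) \<eta>))"
    and tr: "\<And>\<eta>. exceeds a (X (translate \<eta>)) \<longleftrightarrow> exceeds a (X \<eta>)"
    and st: "\<And>\<eta> b. \<eta> \<in> Xstar_even \<Longrightarrow> exceeds a (X (ssm_step \<eta> b)) \<longleftrightarrow> exceeds a (X \<eta>)"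
    and a: "(\<integral>x. f x \<partial>fibre M UNIV) < a"
  shows "AE \<eta> in fibre M UNIV. \<not> exceeds a (X \<eta>)"
proof -
  have MT: "M \<in> TIS" using M by (simp add: ETIS_def extremal_states_def)
  interpret L: shift_invariant "fibre M UNIV" by (rule shift_invariant_marginals(1)[OF MT])
  have Tk: "T ^^ k \<in> borel \<rightarrow>\<^sub>M borel" for k
  proof (induction k)
    case 0
    show ?case by (simp add: id_def)
  next
    case (Suc k)
    show ?case unfolding funpow.simps by (rule measurable_comp[OF Suc T(1)])
  qed
  have Xm: "(\<lambda>\<eta>. X \<eta> N) \<in> borel_measurable borel" for N
    unfolding X by (intro borel_measurable_sum measurable_compose[OF Tk f(2)])
  define F where "F = {\<eta>. exceeds a (X \<eta>)}"
  have "Measurable.pred borel (\<lambda>\<eta>. exceeds a (X \<eta>))"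
    unfolding exceeds_def using Xm by measurable
  then have F: "F \<in> sets borel" by (simp add: F_def pred_def)
  have "measure M (even_part -` F) = 0 \<or> measure M (even_part -` F) = 1"
  proof (rule ETIS_zero_one[OF M even_part_vimage[OF F]])
    show "translate \<eta> \<in> even_part -` F \<longleftrightarrow> \<eta> \<in> even_part -` F" for \<eta>
      by (simp add: F_def even_part_translate tr)
    show "ssm_step \<eta> b \<in> even_part -` F \<longleftrightarrow> \<eta> \<in> even_part -` F" if "\<eta> \<in> Xstar" for \<eta> b
      using that by (simp add: F_def even_part_ssm_step st even_part_Xstar)
  qed
  moreover have mF: "measure M (even_part -` F) = measure (fibre M UNIV) F"
    using measure_distr[OF TIS_measurable(1)[OF MT] F] TIS_D(3)[OF MT] by (simp add: fibre_UNIV_eq)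
  moreover have "measure (fibre M UNIV) F \<noteq> 1"
  proof
    assume "measure (fibre M UNIV) F = 1"
    then have AE: "AE \<eta> in fibre M UNIV. \<eta> \<in> F"
      using F L.prob_eq_1 by simp
    have "0 \<le> (\<integral>x. f x - a \<partial>fibre M UNIV)"
    proof (rule maximal_ergodic[where T=T])
      show "finite_measure (fibre M UNIV)" by unfold_locales
      show "T \<in> fibre M UNIV \<rightarrow>\<^sub>M fibre M UNIV" using T(1) by (simp cong: measurable_cong_sets)
      have "distr (fibre M UNIV) (fibre M UNIV) T = distr (fibre M UNIV) borel T" by (rule distr_cong) simp_all
      then show "distr (fibre M UNIV) (fibre M UNIV) T = fibre M UNIV" using T(2) by simp
      show "integrable (fibre M UNIV) (\<lambda>x. f x - a)" using f by simp
      show "AE x in fibre M UNIV. \<exists>N. 0 < (\<Sum>k<N. f ((T ^^ k) x) - a)"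
        using AE
      proof eventually_elim
        case (elim x)
        then obtain q N where q: "a < of_rat q" "N \<ge> 1" "of_rat q * real N \<le> X x N"
          unfolding F_def exceeds_def by blast
        have "a * real N < of_rat q * real N" using q by simp
        also have "\<dots> \<le> X x N" by (rule q)
        finally show ?case by (intro exI[of _ N]) (simp add: X sum_subtractf mult.commute)
      qed
    qed
    then show False using a f L.prob_space by simp
  qed
  ultimately have "measure (fibre M UNIV) F = 0" by simp
  then have "AE \<eta> in fibre M UNIV. \<eta> \<notin> F" by (intro L.AE_not_inI F)
  then show ?thesis by eventually_elim (simp add: F_def)
qed

lemma real_ssm_step:
  "real (ssm_step \<eta> b i) = real (\<eta> i) + real_of_int (ssm_flux \<eta> b (i - 1)) - real_of_int (ssm_flux \<eta> b i)"
  using arg_cong[OF int_ssm_step[of \<eta> b i], of real_of_int] by simp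

lemma ssm_flux_bound: "\<bar>real_of_int (ssm_flux \<eta> b k)\<bar> \<le> 1"
  by (simp add: ssm_flux_def)

text \<open>Telescoping: only the fluxes through the two ends of the interval change the number of
  particles inside it.\<close>

lemma right_sum_step: "\<bar>right_sum (ssm_step \<eta> b) N - right_sum \<eta> N\<bar> \<le> 2"
proof -
  have "right_sum (ssm_step \<eta> b) N - right_sum \<eta> N = real_of_int (ssm_flux \<eta> b 0) - real_of_int (ssm_flux \<eta> b (int N))"
    by (induction N) (simp_all add: right_sum_def real_ssm_step add.commute)
  then show ?thesis using ssm_flux_bound[of \<eta> b 0] ssm_flux_bound[of \<eta> b "int N"] by linarith
qed

lemma left_sum_step: "\<bar>left_sum (ssm_step \<eta> b) N - left_sum \<eta> N\<bar> \<le> 2"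
proof -
  have "left_sum (ssm_step \<eta> b) N - left_sum \<eta> N =
      real_of_int (ssm_flux \<eta> b (- int N - 1)) - real_of_int (ssm_flux \<eta> b (- 1))"
  proof (induction N)
    case (Suc N)
    have "- int N - 1 - 1 = - int (Suc N) - 1" by simp
    then show ?case using Suc by (simp add: left_sum_def real_ssm_step)
  qed (simp add: left_sum_def)
  then show ?thesis using ssm_flux_bound[of \<eta> b "-1"] ssm_flux_bound[of \<eta> b "- int N - 1"] by linarith
qed

lemma coordinate_real_measurable: "(\<lambda>\<eta>::config. real (\<eta> i)) \<in> borel_measurable borel"
  by (rule measurable_compose[OF measurable_coordinate_count]) simp

text \<open>The density is the mean \<open>e\<close> of the even part, which regularity makes
  finite. Upper bounds for the averages of the stacks and of their negatives, on either side of the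
  origin, give the limits.\<close>

lemma ETIS_density:
  assumes M: "M \<in> ETIS" and reg: "regular M"
  obtains \<rho> where "\<rho> \<ge> 1" "fibre M UNIV \<in> N_states \<rho>"
proof -
  have MT: "M \<in> TIS" using M by (simp add: ETIS_def extremal_states_def)
  note d = TIS_D[OF MT] and m = TIS_measurable[OF MT]
  let ?\<nu> = "fibre M UNIV"
  interpret L: shift_invariant ?\<nu> by (rule shift_invariant_marginals(1)[OF MT])
  have X: "AE \<eta> in ?\<nu>. \<eta> \<in> Xstar_even"
    unfolding fibre_UNIV_eq using d(4) Xstar_measurable by (subst AE_distr_iff[OF m(1)]) (auto simp: even_part_Xstar)
  have inv: "ssm.inv_meas ?\<nu>"
    using inv_meas_iff_fibre[OF d(2,8,4)] d(6) by simp
  have int0: "integrable ?\<nu> (\<lambda>\<eta>. real (\<eta> 0))"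
  proof (rule integrableI_nonneg)
    show "(\<lambda>\<eta>. real (\<eta> 0)) \<in> borel_measurable ?\<nu>"
      using coordinate_real_measurable by (simp cong: measurable_cong_sets)
    have "(\<integral>\<^sup>+\<eta>. ennreal (real (\<eta> 0)) \<partial>?\<nu>) = (\<integral>\<^sup>+\<eta>. ennreal (real (even_part \<eta> 0)) \<partial>M)"
      unfolding fibre_UNIV_eq using coordinate_real_measurable by (subst nn_integral_distr[OF m(1)]) auto
    also have "\<dots> \<le> (\<integral>\<^sup>+\<eta>. of_nat (\<eta> 0) \<partial>M)"
      by (intro nn_integral_mono) (simp add: even_part_def ennreal_of_nat_eq_real_of_nat)
    also have "\<dots> < \<infinity>" using reg by (simp add: regular_def)
    finally show "(\<integral>\<^sup>+\<eta>. ennreal (real (\<eta> 0)) \<partial>?\<nu>) < \<infinity>" .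
  qed simp
  define e where "e = (\<integral>\<eta>. real (\<eta> 0) \<partial>?\<nu>)"
  have coord: "integrable ?\<nu> (\<lambda>\<eta>. real (\<eta> i))" "(\<integral>\<eta>. real (\<eta> i) \<partial>?\<nu>) = e" for i
  proof -
    have z: "zshift (- i) \<eta> 0 = \<eta> i" for \<eta> :: config by (simp add: zshift_def)
    show "integrable ?\<nu> (\<lambda>\<eta>. real (\<eta> i))"
      using integrable_distr_eq[OF L.lam_measurable coordinate_real_measurable, of "-i" 0] int0
      by (simp add: L.distr_zshift z)
    show "(\<integral>\<eta>. real (\<eta> i) \<partial>?\<nu>) = e"
      using integral_distr[OF L.lam_measurable coordinate_real_measurable, of "-i" 0]
      by (simp add: L.distr_zshift z e_def)
  qed
  \<comment> \<open>Two adjacent stacks are not both short and so hold at least two particles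
    together; this yields \<open>e \<ge> 1\<close>.\<close>
  have "2 \<le> (\<integral>\<eta>. real (\<eta> 0) + real (\<eta> 1) \<partial>?\<nu>)"
  proof -
    have "(\<integral>\<eta>. 2 \<partial>?\<nu>) \<le> (\<integral>\<eta>. real (\<eta> 0) + real (\<eta> 1) \<partial>?\<nu>)"
    proof (rule integral_mono_AE)
      show "AE \<eta> in ?\<nu>. 2 \<le> real (\<eta> 0) + real (\<eta> 1)"
        using X
      proof eventually_elim
        case (elim \<eta>)
        then have "\<not> (short (\<eta> 0) \<and> short (\<eta> (0 + 1)))" unfolding Xstar_even_def Xstar_def by blast
        then show ?case by (auto simp: short_def)
      qed
    qed (use coord in simp_all)
    then show ?thesis using L.prob_space by simp
  qed
  then have e1: "e \<ge> 1" using coord by simp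
  have unz: "untranslate = (zshift (- 1) :: config \<Rightarrow> config)" by (auto simp: untranslate_def zshift_def)
  have Tinv: "distr ?\<nu> borel untranslate = ?\<nu>" "distr ?\<nu> borel translate = ?\<nu>"
    using L.distr_zshift[of "-1"] L.lam_translate by (simp_all add: unz)
  have un_pow: "(untranslate ^^ k) \<eta> i = \<eta> (i + int k)" for k i and \<eta> :: config
  proof (induction k arbitrary: i)
    case (Suc k)
    have "(untranslate ^^ Suc k) \<eta> i = (untranslate ^^ k) \<eta> (i + 1)" by (simp add: untranslate_def)
    then show ?case by (simp only: Suc) (simp add: add.assoc)
  qed simp
  have R: "c * right_sum \<eta> N = (\<Sum>k<N. c * real ((untranslate ^^ k) \<eta> 1))" for c \<eta> N
    by (simp add: right_sum_def un_pow sum_distrib_left add.commute)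
  have Lf: "c * left_sum \<eta> N = (\<Sum>k<N. c * real ((translate ^^ k) \<eta> (- 1)))" for c \<eta> N
  proof -
    have "- 1 - int k = - int k - 1" for k by simp
    then show ?thesis by (simp only: left_sum_def translate_pow sum_distrib_left)
  qed
  \<comment> \<open>Used with \<open>c = 1\<close> for the upper and \<open>c = -1\<close> for the
    lower limit.\<close>
  have right: "AE \<eta> in ?\<nu>. \<not> exceeds a (\<lambda>N. c * right_sum \<eta> N)" if c: "c * e < a" "\<bar>c\<bar> \<le> 1" for a c
  proof (rule average_upper[OF M untranslate_measurable Tinv(1) _ _ R])
    show "integrable ?\<nu> (\<lambda>\<eta>. c * real (\<eta> 1))" using coord by simp
    show "(\<lambda>\<eta>::config. c * real (\<eta> 1)) \<in> borel_measurable borel"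
      by (intro borel_measurable_times coordinate_real_measurable) simp
    show "exceeds a (\<lambda>N. c * right_sum (translate \<eta>) N) \<longleftrightarrow> exceeds a (\<lambda>N. c * right_sum \<eta> N)" for \<eta>
      by (rule exceeds_shift_iff[where c="c * real (\<eta> 0)"]) (simp add: right_sum_translate distrib_left)
    show "exceeds a (\<lambda>N. c * right_sum (ssm_step \<eta> b) N) \<longleftrightarrow> exceeds a (\<lambda>N. c * right_sum \<eta> N)" for \<eta> b
    proof (rule exceeds_close_iff)
      show "\<bar>c * right_sum (ssm_step \<eta> b) N - c * right_sum \<eta> N\<bar> \<le> 1 * 2" for N
        unfolding right_diff_distrib[symmetric] abs_mult using c right_sum_step by (intro mult_mono) auto
    qed
    show "(\<integral>\<eta>. c * real (\<eta> 1) \<partial>?\<nu>) < a" using coord c by simp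
  qed
  have left: "AE \<eta> in ?\<nu>. \<not> exceeds a (\<lambda>N. c * left_sum \<eta> N)" if c: "c * e < a" "\<bar>c\<bar> \<le> 1" for a c
  proof (rule average_upper[OF M translate_measurable Tinv(2) _ _ Lf])
    show "integrable ?\<nu> (\<lambda>\<eta>. c * real (\<eta> (- 1)))" using coord by simp
    show "(\<lambda>\<eta>::config. c * real (\<eta> (- 1))) \<in> borel_measurable borel"
      by (intro borel_measurable_times coordinate_real_measurable) simp
    show "exceeds a (\<lambda>N. c * left_sum (translate \<eta>) N) \<longleftrightarrow> exceeds a (\<lambda>N. c * left_sum \<eta> N)" for \<eta>
      by (rule exceeds_shift_iff[where c="c * real (\<eta> (- 1))", symmetric]) (simp add: left_sum_translate distrib_left)
    show "exceeds a (\<lambda>N. c * left_sum (ssm_step \<eta> b) N) \<longleftrightarrow> exceeds a (\<lambda>N. c * left_sum \<eta> N)" for \<eta> b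
    proof (rule exceeds_close_iff)
      show "\<bar>c * left_sum (ssm_step \<eta> b) N - c * left_sum \<eta> N\<bar> \<le> 1 * 2" for N
        unfolding right_diff_distrib[symmetric] abs_mult using c left_sum_step by (intro mult_mono) auto
    qed
    show "(\<integral>\<eta>. c * real (\<eta> (- 1)) \<partial>?\<nu>) < a" using coord c by simp
  qed
  have "AE \<eta> in ?\<nu>. \<forall>k. \<not> exceeds (e + 1 / real (Suc k)) (right_sum \<eta>) \<and>
      \<not> exceeds (- e + 1 / real (Suc k)) (\<lambda>N. - right_sum \<eta> N) \<and>
      \<not> exceeds (e + 1 / real (Suc k)) (left_sum \<eta>) \<and>
      \<not> exceeds (- e + 1 / real (Suc k)) (\<lambda>N. - left_sum \<eta> N)"
    unfolding AE_all_countable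
  proof
    fix k
    show "AE \<eta> in ?\<nu>. \<not> exceeds (e + 1 / real (Suc k)) (right_sum \<eta>) \<and>
      \<not> exceeds (- e + 1 / real (Suc k)) (\<lambda>N. - right_sum \<eta> N) \<and>
      \<not> exceeds (e + 1 / real (Suc k)) (left_sum \<eta>) \<and>
      \<not> exceeds (- e + 1 / real (Suc k)) (\<lambda>N. - left_sum \<eta> N)"
      using right[of 1 "e + 1 / real (Suc k)"] right[of "-1" "- e + 1 / real (Suc k)"]
        left[of 1 "e + 1 / real (Suc k)"] left[of "-1" "- e + 1 / real (Suc k)"] by simp
  qed
  then have "AE \<eta> in ?\<nu>. dens e \<eta>"
    by eventually_elim (auto simp: dens_def intro!: tendsto_of_not_exceeds)
  then have "?\<nu> \<in> N_states e"
    using X inv L.prob_space_axioms by (simp add: N_states_iff has_density_iff)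
  then show ?thesis using that e1 by blast
qed

text \<open>Truncating at \<open>K\<close> permits dominated convergence: the truncated mean is at
  most the mean of the truncated spatial average, which tends to \<open>min \<rho> K\<close>.
  Monotone convergence removes \<open>K\<close>, and the parities add at most 1.\<close>

lemma TIS_regular:
  assumes M: "M \<in> TIS" and dn: "AE \<eta> in fibre M UNIV. dens \<rho> \<eta>"
  shows "regular M"
proof -
  note d = TIS_D[OF M] and m = TIS_measurable[OF M]
  let ?\<nu> = "fibre M UNIV"
  interpret L: shift_invariant ?\<nu> by (rule shift_invariant_marginals(1)[OF M])
  interpret M: prob_space M by (rule d)
  have trunc_m: "(\<lambda>\<eta>::config. min (real (\<eta> i)) (real K)) \<in> borel_measurable borel" for i K
    using coordinate_real_measurable by measurable
  have trunc: "(\<integral>\<eta>. min (real (\<eta> 0)) (real K) \<partial>?\<nu>) \<le> \<rho>" for K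
  proof -
    let ?g = "\<lambda>\<eta>::config. min (real (\<eta> 0)) (real K)"
    have int: "integrable ?\<nu> (\<lambda>\<eta>. min (real (\<eta> i)) (real K))" for i
      using trunc_m by (intro L.integrable_const_bound[where B="real K"]) (auto cong: measurable_cong_sets)
    have eq: "(\<integral>\<eta>. min (real (\<eta> i)) (real K) \<partial>?\<nu>) = (\<integral>\<eta>. ?g \<eta> \<partial>?\<nu>)" for i
      using integral_distr[OF L.lam_measurable trunc_m, of "-i" 0 K] by (simp add: L.distr_zshift zshift_def)
    let ?h = "\<lambda>N \<eta>. min (right_sum \<eta> N / real N) (real K)"
    have hm: "?h N \<in> borel_measurable ?\<nu>" for N
    proof -
      have "(\<lambda>\<eta>. right_sum \<eta> N / real N) \<in> borel_measurable borel"
        unfolding right_sum_def by (intro borel_measurable_divide borel_measurable_sum coordinate_real_measurable borel_measurable_const)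
      then show ?thesis by (simp cong: measurable_cong_sets)
    qed
    have h0: "0 \<le> right_sum \<eta> N" for \<eta> N by (simp add: right_sum_def sum_nonneg)
    have hb: "\<bar>?h N \<eta>\<bar> \<le> real K" for N \<eta> using h0[of \<eta> N] by simp
    \<comment> \<open>By translation invariance the mean at one site equals that of the average over
      \<open>N\<close> sites, and an average of truncated values is at most the truncated
      average.\<close>
    have le: "(\<integral>\<eta>. ?g \<eta> \<partial>?\<nu>) \<le> (\<integral>\<eta>. ?h N \<eta> \<partial>?\<nu>)" if N: "N > 0" for N
    proof -
      have "(\<integral>\<eta>. ?g \<eta> \<partial>?\<nu>) = (\<Sum>k<N. \<integral>\<eta>. ?g \<eta> \<partial>?\<nu>) / real N" using N by simp
      also have "\<dots> = (\<Sum>k<N. \<integral>\<eta>. min (real (\<eta> (int k + 1))) (real K) \<partial>?\<nu>) / real N"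
        by (intro arg_cong[where f="\<lambda>x. x / real N"] sum.cong refl eq[symmetric])
      also have "\<dots> = (\<integral>\<eta>. (\<Sum>k<N. min (real (\<eta> (int k + 1))) (real K)) / real N \<partial>?\<nu>)"
        using int by simp
      also have "\<dots> \<le> (\<integral>\<eta>. ?h N \<eta> \<partial>?\<nu>)"
      proof (rule integral_mono)
        show "integrable ?\<nu> (\<lambda>\<eta>. (\<Sum>k<N. min (real (\<eta> (int k + 1))) (real K)) / real N)" using int by simp
        show "integrable ?\<nu> (?h N)"
          using hm hb by (intro L.integrable_const_bound[where B="real K"]) auto
        fix \<eta>
        have "(\<Sum>k<N. min (real (\<eta> (int k + 1))) (real K)) \<le> right_sum \<eta> N"
          unfolding right_sum_def by (intro sum_mono) simp
        moreover have "(\<Sum>k<N. min (real (\<eta> (int k + 1))) (real K)) \<le> (\<Sum>k<N. real K)"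
          by (intro sum_mono) simp
        ultimately show "(\<Sum>k<N. min (real (\<eta> (int k + 1))) (real K)) / real N \<le> ?h N \<eta>"
          using N by (simp add: divide_right_mono divide_le_eq mult.commute)
      qed
      finally show ?thesis .
    qed
    have "(\<lambda>N. \<integral>\<eta>. ?h N \<eta> \<partial>?\<nu>) \<longlonglongrightarrow> (\<integral>\<eta>. min \<rho> (real K) \<partial>?\<nu>)"
    proof (rule integral_dominated_convergence[where w="\<lambda>_. real K"])
      show "AE \<eta> in ?\<nu>. (\<lambda>N. ?h N \<eta>) \<longlonglongrightarrow> min \<rho> (real K)"
        using dn by eventually_elim (intro tendsto_min tendsto_const, simp add: dens_def)
    qed (use hm hb in auto)
    then have "(\<integral>\<eta>. ?g \<eta> \<partial>?\<nu>) \<le> (\<integral>\<eta>. min \<rho> (real K) \<partial>?\<nu>)"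
      by (rule LIMSEQ_le_const) (use le in \<open>auto intro!: exI[of _ 1]\<close>)
    then show ?thesis using L.prob_space by simp
  qed
  have nn: "(\<integral>\<^sup>+\<eta>. ennreal (real (\<eta> 0)) \<partial>?\<nu>) \<le> ennreal \<rho>"
  proof -
    have s: "(\<lambda>K::nat. ennreal (min (real n) (real K))) \<longlonglongrightarrow> ennreal (real n)" for n
    proof (rule tendsto_eventually)
      show "\<forall>\<^sub>F K in sequentially. ennreal (min (real n) (real K)) = ennreal (real n)"
        using eventually_ge_at_top[of n] by eventually_elim simp
    qed
    have "(\<lambda>K. \<integral>\<^sup>+\<eta>. ennreal (min (real (\<eta> 0)) (real K)) \<partial>?\<nu>) \<longlonglongrightarrow> (\<integral>\<^sup>+\<eta>. ennreal (real (\<eta> 0)) \<partial>?\<nu>)"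
    proof (rule nn_integral_LIMSEQ)
      show "incseq (\<lambda>K \<eta>. ennreal (min (real (\<eta> 0)) (real K)))"
        by (auto simp: incseq_def le_fun_def intro!: ennreal_leI)
      show "(\<lambda>\<eta>. ennreal (min (real (\<eta> 0)) (real K))) \<in> borel_measurable ?\<nu>" for K
        using trunc_m by (simp cong: measurable_cong_sets)
    qed (rule s)
    moreover have "(\<integral>\<^sup>+\<eta>. ennreal (min (real (\<eta> 0)) (real K)) \<partial>?\<nu>) \<le> ennreal \<rho>" for K
    proof -
      have "(\<integral>\<^sup>+\<eta>. ennreal (min (real (\<eta> 0)) (real K)) \<partial>?\<nu>) = ennreal (\<integral>\<eta>. min (real (\<eta> 0)) (real K) \<partial>?\<nu>)"
        using trunc_m by (intro nn_integral_eq_integral L.integrable_const_bound[where B="real K"]) (auto cong: measurable_cong_sets)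
      then show ?thesis using trunc by (simp add: ennreal_leI)
    qed
    ultimately show ?thesis by (intro LIMSEQ_le_const2) auto
  qed
  have "(\<integral>\<^sup>+\<eta>. of_nat (\<eta> 0) \<partial>M) \<le> (\<integral>\<^sup>+\<eta>. ennreal (real (even_part \<eta> 0)) + 1 \<partial>M)"
  proof (rule nn_integral_mono)
    fix \<eta> :: config
    have "\<eta> 0 \<le> even_part \<eta> 0 + 1" by (simp add: even_part_def)
    then have "(of_nat (\<eta> 0) :: ennreal) \<le> of_nat (even_part \<eta> 0 + 1)" by (rule of_nat_mono)
    then show "of_nat (\<eta> 0) \<le> ennreal (real (even_part \<eta> 0)) + 1"
      by (simp add: ennreal_of_nat_eq_real_of_nat add.commute)
  qed
  also have "\<dots> = (\<integral>\<^sup>+\<eta>. ennreal (real (even_part \<eta> 0)) \<partial>M) + 1"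
  proof -
    have "(\<lambda>\<eta>. ennreal (real (even_part \<eta> 0))) \<in> borel_measurable M"
      using measurable_compose[OF m(1) coordinate_real_measurable, of 0] by simp
    then show ?thesis using M.emeasure_space_1 by (simp add: nn_integral_add)
  qed
  also have "(\<integral>\<^sup>+\<eta>. ennreal (real (even_part \<eta> 0)) \<partial>M) = (\<integral>\<^sup>+\<eta>. ennreal (real (\<eta> 0)) \<partial>?\<nu>)"
    unfolding fibre_UNIV_eq using coordinate_real_measurable by (subst nn_integral_distr[OF m(1)]) auto
  also have "\<dots> + 1 \<le> ennreal \<rho> + 1" using nn by (rule add_right_mono)
  also have "\<dots> < \<infinity>" by simp
  finally show ?thesis by (simp add: regular_def)
qed

lemma push_translate_pow_inj:
  fixes M1 M2 :: "(int \<Rightarrow> 'a::second_countable_topology) measure"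
  assumes "sets M1 = sets borel" "sets M2 = sets borel" "(push_translate ^^ i) M1 = (push_translate ^^ i) M2"
  shows "M1 = M2"
  using assms(3)
proof (induction i)
  case (Suc i)
  have "sets ((push_translate ^^ i) M1) = sets borel" "sets ((push_translate ^^ i) M2) = sets borel"
    using assms(1,2) by (simp_all add: push_translate_pow)
  then have "(push_translate ^^ i) M1 = (push_translate ^^ i) M2"
    by (rule push_translate_inj) (use Suc.prems in simp)
  then show ?case by (rule Suc.IH)
qed simp

lemma (in decomp) finite_period:
  assumes \<kappa>: "\<kappa> \<in> N_extremal \<rho>" and p: "emeasure \<nu>0 (E \<kappa>) > 0"
  obtains n where "minimal_period \<kappa> n"
proof -
  interpret N: prob_space \<nu>0 by (rule \<nu>0D)
  let ?tr = "\<lambda>j. (push_translate ^^ j) \<kappa>"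
  note Ej = E_measurable[OF N_extremal_translate_pow[OF \<kappa>]]
  have w: "measure \<nu>0 (E (?tr j)) = measure \<nu>0 (E \<kappa>)" for j
    using weight_translate_pow[OF dominated_M0 \<kappa>, of UNIV j] Ej[of j] Ej[of 0] M0D(2)
    by (simp add: measure_def emeasure_fibre zimg_def)
  have c: "measure \<nu>0 (E \<kappa>) > 0" using p by (simp add: N.emeasure_eq_measure)
  have "\<not> inj ?tr"
  proof
    assume inj: "inj ?tr"
    \<comment> \<open>Enough translates that disjoint generic sets of equal mass would exceed total
      mass one.\<close>
    obtain K where K: "1 < real K * measure \<nu>0 (E \<kappa>)"
      using reals_Archimedean2[of "1 / measure \<nu>0 (E \<kappa>)"] c by (auto simp: field_simps)
    have "disjoint_family_on (\<lambda>j. E (?tr j)) {..<K}"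
      using inj by (auto simp: disjoint_family_on_def inj_def)
    then have "(\<Sum>j<K. measure \<nu>0 (E (?tr j))) = measure \<nu>0 (\<Union>j<K. E (?tr j))"
      using Ej by (intro N.finite_measure_finite_Union[symmetric]) auto
    also have "\<dots> \<le> 1" by (rule N.prob_le_1)
    finally show False using K by (simp add: w)
  qed
  \<comment> \<open>Two translates coincide; injectivity of the push-forward removes the first
    \<open>i\<close> steps and leaves a genuine period.\<close>
  then obtain i j where ij: "i < j" "?tr i = ?tr j" unfolding inj_def by (metis linorder_neqE_nat)
  have s: "sets \<kappa> = sets borel" "sets (?tr (j - i)) = sets borel"
    using N_extremalD(3)[OF \<kappa>] N_extremalD(3)[OF N_extremal_translate_pow[OF \<kappa>]] by auto
  have "?tr (i + (j - i)) = (push_translate ^^ i) (?tr (j - i))" by (simp only: funpow_add comp_def)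
  then have "(push_translate ^^ i) (?tr (j - i)) = (push_translate ^^ i) \<kappa>" using ij by simp
  from push_translate_pow_inj[OF s(2,1) this] have r: "0 < j - i \<and> ?tr (j - i) = \<kappa>" using ij by simp
  define n where "n = (LEAST n. 0 < n \<and> ?tr n = \<kappa>)"
  have "0 < n \<and> ?tr n = \<kappa>" unfolding n_def by (rule LeastI[of "\<lambda>n. 0 < n \<and> ?tr n = \<kappa>", OF r])
  moreover have "?tr k \<noteq> \<kappa>" if "0 < k" "k < n" for k
    using not_less_Least[of k "\<lambda>n. 0 < n \<and> ?tr n = \<kappa>"] that by (auto simp: n_def)
  ultimately have "minimal_period \<kappa> n" by (simp add: minimal_period_def)
  then show ?thesis by (rule that)
qed

text \<open>A single charged state \<kappa> together with a single atom suffices: the basic state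
  built on them is dominated by \<open>M\<close>, and extremality gives equality.\<close>

lemma regular_ETIS_basic:
  assumes cnt: "\<And>\<rho>::real. \<rho> \<ge> 1 \<Longrightarrow> countable (N_extremal \<rho>)" and M: "M \<in> ETIS" and reg: "regular M"
  obtains lam \<kappa> m q A where "basic_data lam \<kappa> m q A" "M = basic lam \<kappa> m q A"
proof -
  have MT: "M \<in> TIS" using M by (simp add: ETIS_def extremal_states_def)
  obtain \<rho> where \<rho>: "\<rho> \<ge> 1" "fibre M UNIV \<in> N_states \<rho>" by (rule ETIS_density[OF M reg])
  obtain Q where "decomp \<rho> M Q" by (rule decomp_exists[OF MT \<rho>(2) cnt[OF \<rho>(1)]])
  then interpret decomp \<rho> M Q .
  interpret M: prob_space M by (rule M0D)
  obtain \<kappa> where \<kappa>: "\<kappa> \<in> N_extremal \<rho>" and p: "emeasure \<nu>0 (E \<kappa>) > 0" using exists_charged by blast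
  have ac: "ac \<kappa>" by (rule ac_of_pos[OF \<kappa> p])
  obtain n where min: "minimal_period \<kappa> n" by (rule finite_period[OF \<kappa> p])
  then have n0: "n > 0" and per: "(push_translate ^^ n) \<kappa> = \<kappa>" by (auto simp: minimal_period_def)
  define lam where "lam = distr M borel odd_sites"
  have erg: "ergodic lam" unfolding lam_def by (rule ETIS_ergodic_parity[OF M])
  interpret L: shift_invariant lam by (rule ergodic_shift_invariant[OF erg])
  have lam: "emeasure lam B = emeasure M (rect UNIV B)" if "B \<in> sets borel" for B
    using emeasure_distr[OF TIS_measurable(2)[OF MT] that] M0D(3) by (simp add: lam_def rect_def vimage_def)
  obtain m q A0 where n: "n = q * m" and m: "m > 0" "q > 0" and part0: "partition_family lam m A0"
    and atom0: "\<And>C k. C \<in> sets borel \<Longrightarrow> (translate ^^ n) -` C = C \<Longrightarrow> k < m \<Longrightarrow>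
      (AE \<sigma> in lam. \<sigma> \<in> A0 k \<longrightarrow> \<sigma> \<in> C) \<or> (AE \<sigma> in lam. \<sigma> \<in> A0 k \<longrightarrow> \<sigma> \<notin> C)"
    by (rule cyclic_atoms[OF erg n0]) blast
  note Ek = E_measurable[OF \<kappa>]
  \<comment> \<open>The atoms cover almost all parities, so the positive weight of \<kappa> cannot
    vanish on each of them.\<close>
  have "\<exists>k<m. measure M (rect (E \<kappa>) (A0 k)) > 0"
  proof (rule ccontr)
    assume h: "\<not> ?thesis"
    have "AE x in M. k < m \<longrightarrow> x \<notin> rect (E \<kappa>) (A0 k)" for k
    proof (cases "k < m")
      case True
      then have "measure M (rect (E \<kappa>) (A0 k)) = 0" using h by (auto simp: less_le)
      then have "AE x in M. x \<notin> rect (E \<kappa>) (A0 k)"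
        using rect_measurable[OF Ek partition_familyD(1)[OF part0 True]] M0D(2)
        by (intro AE_not_in) (simp add: null_sets_def M.emeasure_eq_measure)
      then show ?thesis by eventually_elim simp
    qed simp
    then have "AE x in M. \<forall>k. k < m \<longrightarrow> x \<notin> rect (E \<kappa>) (A0 k)" by (simp add: AE_all_countable)
    moreover have "AE x in M. \<exists>i<m. odd_sites x \<in> A0 i"
      using partition_familyD(2)[OF part0] unfolding lam_def by (rule AE_distrD[OF TIS_measurable(2)[OF MT]])
    ultimately have "AE x in M. x \<notin> rect (E \<kappa>) UNIV" by eventually_elim (auto simp: rect_def)
    then have "measure M (rect (E \<kappa>) UNIV) = measure M {}"
      using rect_measurable[OF Ek, of UNIV] M0D(2) by (intro M.finite_measure_eq_AE) auto
    then show False using p by (simp add: emeasure_fibre[OF M0D(2) _ Ek] M.emeasure_eq_measure)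
  qed
  then obtain k where k: "k < m" "measure M (rect (E \<kappa>) (A0 k)) > 0" by blast
  \<comment> \<open>Renumbered so that the charged atom becomes cell 0, the one attached to \<kappa>
    itself.\<close>
  define A where "A i = A0 ((i + k) mod m)" for i
  have part: "partition_family lam m A" unfolding A_def by (rule partition_shift[OF part0 m(1)])
  have A_0: "A 0 = A0 k" using k by (simp add: A_def)
  have min': "minimal_period \<kappa> (q * m)" using min n by simp
  have b: "basic_context lam \<kappa> m q A \<rho>" by (rule basic_contextI[OF erg \<kappa> m min' part])
  interpret b: basic_context lam \<kappa> m q A \<rho> by fact
  have Am: "A 0 \<in> sets borel" using b.A_mod(1)[of 0] by simp
  have A_inv: "(translate ^^ n) -` A 0 = A 0"
    using partition_family_zimg[OF part m(1), of n] zimg_eq_minus[of "int n" "A 0"] n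
    by (simp add: vimage_translate_pow)
  have lA: "measure lam (A 0) > 0" by (rule partition_family_pos[OF erg m(1) part m(1)])
  define a where "a = measure M (rect (E \<kappa>) (A 0)) / measure lam (A 0)"
  have a0: "a > 0" using k lA by (simp add: a_def A_0)
  have w0: "measure M (rect (E \<kappa>) (B \<inter> A 0)) = a * measure lam (B \<inter> A 0)" if B: "B \<in> sets borel" for B
  proof -
    have "measure M (rect (E \<kappa>) (B \<inter> A 0)) * measure lam (A 0) = measure M (rect (E \<kappa>) (A 0)) * measure lam (B \<inter> A 0)"
      by (rule atom_weight[OF dominated_M0 \<kappa> per L.shift_invariant_axioms _ Am A_inv _ B])
        (use atom0[OF _ _ k(1)] in \<open>simp_all add: A_0 lam\<close>)
    then show ?thesis using lA by (simp add: a_def field_simps)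
  qed
  have "basic lam \<kappa> m q A = M"
  proof (rule ETIS_dominated[OF M b.M_TIS])
    \<comment> \<open>On the cell belonging to a translate of \<kappa>, the parity weight is
      \<open>a\<close> times \<open>lam\<close> under \<open>M\<close> and \<open>1 / q\<close>
      times \<open>lam\<close> under the basic state; the constant is their ratio.\<close>
    show c: "0 < a * real q" using a0 m by simp
    fix D :: "config set" assume D: "D \<in> sets borel"
    show "a * real q * measure (basic lam \<kappa> m q A) D \<le> measure M D"
    proof (rule basic_dominated[OF dominated_M0 b min' ac c _ D])
      fix j B assume B: "B \<in> sets (borel :: spins measure)"
      have BA: "B \<inter> A (j mod m) \<in> sets borel" using B b.A_mod(1) by auto
      have zB: "zimg (- int j) B \<in> sets borel" by (rule zimg_measurable[OF B])
      have z: "zimg (int j) (A 0) = A (j mod m)" using partition_family_zimg[OF part m(1), of j] by simp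
      then have zA: "zimg (- int j) (A (j mod m)) = A 0" unfolding z[symmetric] by (simp add: zimg_add)
      have "zimg (- int j) (B \<inter> A (j mod m)) = zimg (- int j) B \<inter> zimg (- int j) (A (j mod m))"
        by (simp add: zimg_def)
      then have zBA: "zimg (- int j) (B \<inter> A (j mod m)) = zimg (- int j) B \<inter> A 0" by (simp only: zA)
      have zz: "zimg (int j) (zimg (- int j) B \<inter> A 0) = B \<inter> A (j mod m)"
        unfolding zBA[symmetric] by (simp add: zimg_add)
      have "measure M (rect (E (b.tr j)) (B \<inter> A (j mod m))) = measure M (rect (E \<kappa>) (zimg (- int j) B \<inter> A 0))"
        using weight_translate_pow[OF dominated_M0 \<kappa> BA, of j] by (simp add: measure_def zBA)
      also have "\<dots> = a * measure lam (zimg (- int j) B \<inter> A 0)" by (rule w0[OF zB])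
      also have "measure lam (zimg (- int j) B \<inter> A 0) = measure lam (B \<inter> A (j mod m))"
        using L.measure_zimg[of "zimg (- int j) B \<inter> A 0" "int j"] zB Am by (simp add: zz)
      finally show "emeasure M (rect (E (b.tr j)) (B \<inter> A (j mod m))) =
          ennreal (a * real q) * (ennreal (1 / real q) * emeasure lam (B \<inter> A (j mod m)))"
        using a0 m by (simp add: M.emeasure_eq_measure L.emeasure_eq_measure ennreal_mult[symmetric])
    qed
  qed
  moreover have "basic_data lam \<kappa> m q A"
    using erg \<kappa> \<rho>(1) m min' part by (auto simp: basic_data_def)
  ultimately show ?thesis using that by blast
qed

theorem theoremB5:
  assumes "\<And>\<rho>::real. \<rho> \<ge> 1 \<Longrightarrow> countable (N_extremal \<rho>)"
  shows "{M \<in> ETIS. regular M} = {M. irreducible_basic_state M}"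
proof (intro set_eqI iffI; elim CollectE conjE; intro CollectI)
  fix M assume M: "M \<in> ETIS" "regular M"
  obtain lam \<kappa> m q A where "basic_data lam \<kappa> m q A" "M = basic lam \<kappa> m q A"
    by (rule regular_ETIS_basic[OF assms M])
  then have "basic_state M" unfolding basic_state_def pre_basic_def basic_def by blast
  then show "irreducible_basic_state M"
    using ETIS_not_reducible[OF assms M(1)] by (simp add: irreducible_basic_state_def)
next
  fix M assume "irreducible_basic_state M"
  then obtain lam \<nu> m q A where d: "basic_data lam \<nu> m q A" and M: "M = basic lam \<nu> m q A" and irr: "\<not> reducible M"
    unfolding irreducible_basic_state_def basic_state_def pre_basic_def basic_def by blast
  obtain \<rho> where "basic_context lam \<nu> m q A \<rho>" using d by (rule basic_dataE)
  then interpret b: basic_context lam \<nu> m q A \<rho> .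
  \<comment> \<open>The finite mean is not part of the definition of a basic state; it follows from
    the density of its even marginal.\<close>
  have "regular M"
    using TIS_regular[OF b.M_TIS, of \<rho>] b.marginal_N_states by (simp add: M N_states_iff has_density_iff)
  moreover have "M \<in> ETIS" unfolding M by (rule irreducible_basic_extremal[OF assms d irr[unfolded M]])
  ultimately show "M \<in> ETIS \<and> regular M" by simp
qed

end
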